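(* Let $(L_t)_{t\ge0}$ be a one-dimensional Lévy process with Lévy triplet $(a,\sigma^2,\nu)$ such that $\mathbb{E}e^{\lambda|L_1|}<\infty$ for all $\lambda\ge0$. For $\xi\in\mathbb{R}$ let $$\Psi(\xi)=a\xi+\tfrac12\sigma^2\xi^2+\int_{\mathbb{R}\setminus\{0\}}\big(e^{\xi y}-1-\xi y\chi_{\{|y|\le1\}}\big)\nu(dy)$$ be the logarithmic moment generating function of $L_1$, and let $\Psi^*(p)=\sup_{\xi\in\mathbb{R}}\{\xi p-\Psi(\xi)\}$ be its Legendre transform. Define $S:\mathcal{D}[0,1]\to[0,\infty]$ by $$S(\phi)=\begin{cases}\int_0^1\Psi^*(\phi'(t))\,dt, & \phi\in AC[0,1],\ \phi(0)=0,\\ \infty, & \text{otherwise.}\end{cases}$$ Then the scaled Lévy processes $L^\varepsilon_t:=\varepsilon L_{t/\varepsilon}$, $t\in[0,1]$, satisfy a large deviation principle in $(\mathcal{D}[0,1],\|\cdot\|_\infty)$ as $\varepsilon\to0$ with action functional $S$; i.e. for every open set $U\in\mathcal{B}$ and every closed set $F\in\mathcal{B}$, $$\liminf_{\varepsilon\to0}\varepsilon\log\mathbb{P}(L^\varepsilon\in U)\ge-\inf_{\phi\in U}S(\phi),\qquad \limsup_{\varepsilon\to0}\varepsilon\log\mathbb{P}(L^\varepsilon\in F)\le-\inf_{\phi\in F}S(\phi).$$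
   Context: $\mathcal{D}[0,1]$ is the space of real-valued càdlàg functions on $[0,1]$ with the topology of the supremum norm $\|f\|_\infty=\sup_{t\in[0,1]}|f(t)|$, equipped with the $\sigma$-algebra $\mathcal{B}=\sigma(\pi_t;\,t\in[0,1])$ generated by the projections $\pi_t(f)=f(t)$ (which is not the Borel $\sigma$-algebra of the supremum norm). "Open" and "closed" refer to the supremum norm. $AC[0,1]$ is the space of absolutely continuous functions on $[0,1]$ with value $0$ at $0$. A Lévy process $L$ starts at $0$ a.s., has independent and stationary increments, is stochastically continuous and has càdlàg paths; it has triplet $(a,\sigma^2,\nu)$, with $a\in\mathbb{R}$, $\sigma\ge0$, $\int_{\mathbb{R}\setminus\{0\}}(y^2\wedge1)\nu(dy)<\infty$, if $\mathbb{E}e^{i\xi L_t}=e^{t\psi(\xi)}$ with $\psi(\xi)=ia\xi-\frac12\sigma^2\xi^2+\int_{\mathbb{R}\setminus\{0\}}(e^{i\xi y}-1-i\xi y\chi_{\{|y|\le1\}})\nu(dy)$. An action functional is a $[0,\infty]$-valued function all of whose sublevel sets $\{S\le r\}$, $r\ge0$, are compact (a "good rate function"); a large deviation principle in $(\mathcal{D}[0,1],\|\cdot\|_\infty)$ with action functional $S$ means that $S$ is an action functional and that the displayed lower and upper bounds hold. Conventions: $\log0=-\infty$, $\inf\emptyset=+\infty$. *)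

theory Defs
  imports "HOL-Probability.Probability"
begin

section \<open>The space of cadlag functions on the unit interval\<close>

definition cadlag_on :: "real set \<Rightarrow> (real \<Rightarrow> real) \<Rightarrow> bool" where
  "cadlag_on I f \<longleftrightarrow> (\<forall>t\<in>I. (f \<longlongrightarrow> f t) (at t within I \<inter> {t<..}) \<and>
                            (\<exists>l. (f \<longlongrightarrow> l) (at t within I \<inter> {..<t})))"

text \<open>Functions on \<open>[0,1]\<close> are represented by their extensional representatives
  (equal to \<^const>\<open>undefined\<close> outside \<open>[0,1]\<close>), so that equality of representatives is equality
  on \<open>[0,1]\<close>.\<close>

definition D01 :: "(real \<Rightarrow> real) set" where
  "D01 = {f \<in> extensional {0..1}. cadlag_on {0..1} f}"

text \<open>The metric of \<^const>\<open>funspace\<close> is the supremum metric on bounded functions; the lemmas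
  \<open>mspace_D01_metric\<close> and \<open>mdist_D01_metric\<close> below show that no cadlag function is lost and
  that the distance is the expected one.\<close>

definition D01_metric :: "(real \<Rightarrow> real) metric" where
  "D01_metric = submetric (funspace {0..1} euclidean_metric) D01"

definition D01_sigma :: "(real \<Rightarrow> real) measure" where
  "D01_sigma = sigma D01 {{f \<in> D01. f t \<in> A} | t A. t \<in> {0..1} \<and> A \<in> sets borel}"

lemma cadlag_on_bounded:
  assumes "cadlag_on {0..1} f"
  shows "\<exists>B. \<forall>t\<in>{0..1}. \<bar>f t\<bar> \<le> B"
proof -
  have "\<exists>d>0. \<exists>B. \<forall>s\<in>{0..1}. dist s t < d \<longrightarrow> \<bar>f s\<bar> \<le> B" if t: "t \<in> {0..1}" for t
  proof -
    obtain l where r: "(f \<longlongrightarrow> f t) (at t within {0..1} \<inter> {t<..})"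
      and l: "(f \<longlongrightarrow> l) (at t within {0..1} \<inter> {..<t})"
      using assms t unfolding cadlag_on_def by blast
    obtain d1 where d1: "d1 > 0"
        "\<And>s. s \<in> {0..1} \<Longrightarrow> t < s \<Longrightarrow> dist s t < d1 \<Longrightarrow> dist (f s) (f t) < 1"
      using tendstoD[OF r, of 1] unfolding eventually_at by auto
    obtain d2 where d2: "d2 > 0"
        "\<And>s. s \<in> {0..1} \<Longrightarrow> s < t \<Longrightarrow> dist s t < d2 \<Longrightarrow> dist (f s) l < 1"
      using tendstoD[OF l, of 1] unfolding eventually_at by auto
    have "\<bar>f s\<bar> \<le> \<bar>f t\<bar> + \<bar>l\<bar> + 1" if s: "s \<in> {0..1}" "dist s t < min d1 d2" for s
    proof (cases s t rule: linorder_cases)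
      case less
      then show ?thesis using d2(2)[of s] s by (auto simp: dist_real_def)
    next
      case equal
      then show ?thesis by auto
    next
      case greater
      then show ?thesis using d1(2)[of s] s by (auto simp: dist_real_def)
    qed
    then show ?thesis using d1(1) d2(1) by (intro exI[of _ "min d1 d2"] conjI exI[of _ "\<bar>f t\<bar> + \<bar>l\<bar> + 1"]) auto
  qed
  then obtain d B where dB: "\<And>t. t \<in> {0..1} \<Longrightarrow> d t > 0"
      "\<And>t s. t \<in> {0..1} \<Longrightarrow> s \<in> {0..1} \<Longrightarrow> dist s t < d t \<Longrightarrow> \<bar>f s\<bar> \<le> B t"
    by metis
  obtain T where T: "T \<subseteq> {0..1}" "finite T" "{0..1::real} \<subseteq> (\<Union>t\<in>T. ball t (d t))"
    by (rule compactE_image[of "{0..1::real}" "{0..1}" "\<lambda>t. ball t (d t)"])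
       (use dB(1) in \<open>auto intro!: bexI\<close>)
  have "\<bar>f s\<bar> \<le> (\<Sum>t\<in>T. \<bar>B t\<bar>)" if s: "s \<in> {0..1}" for s
  proof -
    obtain t where t: "t \<in> T" "dist s t < d t"
      using T(3) s by (auto simp: dist_commute subset_iff)
    have "\<bar>f s\<bar> \<le> \<bar>B t\<bar>" using dB(2)[of t s] t s T(1) by auto
    also have "\<dots> \<le> (\<Sum>t\<in>T. \<bar>B t\<bar>)" using t T(2) by (intro member_le_sum) auto
    finally show ?thesis .
  qed
  then show ?thesis by blast
qed

lemma mspace_D01_metric [simp]: "mspace D01_metric = D01"
proof -
  have "f \<in> Met_TC.fspace {0..1}" if f: "f \<in> D01" for f
  proof -
    obtain B where "\<forall>t\<in>{0..1}. \<bar>f t\<bar> \<le> B"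
      using f cadlag_on_bounded unfolding D01_def by blast
    then have "bounded (f ` {0..1})" by (auto simp: bounded_iff)
    then show ?thesis
      using f unfolding D01_def Met_TC.fspace_def by (simp add: mbounded_iff_bounded)
  qed
  then show ?thesis
    by (auto simp: D01_metric_def)
qed

lemma mdist_D01_metric:
  assumes "f \<in> D01" "g \<in> D01"
  shows "mdist D01_metric f g = (SUP t\<in>{0..1}. \<bar>f t - g t\<bar>)"
proof -
  have "f \<in> Met_TC.fspace {0..1}" "g \<in> Met_TC.fspace {0..1}"
    using assms mspace_D01_metric by (auto simp: D01_metric_def)
  then show ?thesis
    by (auto simp: D01_metric_def Met_TC.fdist_def dist_real_def)
qed

section \<open>Large deviation principles\<close>

definition action_functional :: "'a topology \<Rightarrow> ('a \<Rightarrow> ennreal) \<Rightarrow> bool" where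
  "action_functional T S \<longleftrightarrow>
     (\<forall>r::real. r \<ge> 0 \<longrightarrow> compactin T {x \<in> topspace T. S x \<le> ennreal r})"

definition ext_log :: "real \<Rightarrow> ereal" where
  "ext_log p = (if p = 0 then - \<infinity> else ereal (ln p))"

text \<open>\<open>X \<epsilon>\<close>, for \<open>\<epsilon> > 0\<close>, are random elements of the topological space \<open>T\<close>, which carries the
  sigma-algebra \<open>B\<close>; in general \<open>B\<close> is smaller than the Borel sigma-algebra of \<open>T\<close>.\<close>

definition large_deviation_principle ::
    "'w measure \<Rightarrow> 'a topology \<Rightarrow> 'a measure \<Rightarrow> (real \<Rightarrow> 'w \<Rightarrow> 'a) \<Rightarrow> ('a \<Rightarrow> ennreal) \<Rightarrow> bool" where
  "large_deviation_principle M T B X S \<longleftrightarrow>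
     action_functional T S \<and>
     (\<forall>U. openin T U \<and> U \<in> sets B \<longrightarrow>
        Liminf (at_right 0) (\<lambda>\<epsilon>. ereal \<epsilon> * ext_log (measure M {\<omega> \<in> space M. X \<epsilon> \<omega> \<in> U}))
          \<ge> - enn2ereal (INF x\<in>U. S x)) \<and>
     (\<forall>F. closedin T F \<and> F \<in> sets B \<longrightarrow>
        Limsup (at_right 0) (\<lambda>\<epsilon>. ereal \<epsilon> * ext_log (measure M {\<omega> \<in> space M. X \<epsilon> \<omega> \<in> F}))
          \<le> - enn2ereal (INF x\<in>F. S x))"

section \<open>Levy processes\<close>

locale levy_process = prob_space M for M :: "'w measure" +
  fixes L :: "real \<Rightarrow> 'w \<Rightarrow> real"
  assumes random_variable_L: "\<And>t. t \<ge> 0 \<Longrightarrow> random_variable borel (L t)"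
    and start_0: "AE \<omega> in M. L 0 \<omega> = 0"
    and independent_increments:
      "\<And>(t :: nat \<Rightarrow> real) n. 0 \<le> t 0 \<Longrightarrow> (\<And>i. i < n \<Longrightarrow> t i \<le> t (Suc i)) \<Longrightarrow>
         indep_vars (\<lambda>_. borel) (\<lambda>i \<omega>. L (t (Suc i)) \<omega> - L (t i) \<omega>) {..<n}"
    and stationary_increments:
      "\<And>s h. s \<ge> 0 \<Longrightarrow> h \<ge> 0 \<Longrightarrow>
         distr M borel (\<lambda>\<omega>. L (s + h) \<omega> - L s \<omega>) = distr M borel (\<lambda>\<omega>. L h \<omega> - L 0 \<omega>)"
    and stochastically_continuous:
      "\<And>t \<delta>. t \<ge> 0 \<Longrightarrow> \<delta> > 0 \<Longrightarrow>
         ((\<lambda>s. prob {\<omega> \<in> space M. \<bar>L s \<omega> - L t \<omega>\<bar> > \<delta>}) \<longlongrightarrow> 0) (at t within {0..})"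
    and cadlag_paths: "\<And>\<omega>. \<omega> \<in> space M \<Longrightarrow> cadlag_on {0..} (\<lambda>t. L t \<omega>)"

text \<open>A Levy measure is a measure on the space \<open>\<real> - {0}\<close>, so integrals with respect to \<open>\<nu>\<close>
  need no further restriction of the domain.\<close>

definition levy_measure :: "real measure \<Rightarrow> bool" where
  "levy_measure \<nu> \<longleftrightarrow> sets \<nu> = sets (restrict_space borel (- {0})) \<and>
     (\<integral>\<^sup>+ y. ennreal (min (y\<^sup>2) 1) \<partial>\<nu>) < \<infinity>"

definition characteristic_exponent :: "real \<Rightarrow> real \<Rightarrow> real measure \<Rightarrow> real \<Rightarrow> complex" where
  "characteristic_exponent a \<sigma> \<nu> \<xi> =
     \<i> * of_real (a * \<xi>) - of_real (\<sigma>\<^sup>2 * \<xi>\<^sup>2 / 2) +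
     (CLINT y|\<nu>. iexp (\<xi> * y) - 1 - \<i> * of_real (\<xi> * y * indicator {y. \<bar>y\<bar> \<le> 1} y))"

definition has_levy_triplet ::
    "'w measure \<Rightarrow> (real \<Rightarrow> 'w \<Rightarrow> real) \<Rightarrow> real \<Rightarrow> real \<Rightarrow> real measure \<Rightarrow> bool" where
  "has_levy_triplet M L a \<sigma> \<nu> \<longleftrightarrow> \<sigma> \<ge> 0 \<and> levy_measure \<nu> \<and>
     (\<forall>t\<ge>0. \<forall>\<xi>. (CLINT \<omega>|M. iexp (\<xi> * L t \<omega>)) = exp (of_real t * characteristic_exponent a \<sigma> \<nu> \<xi>))"

text \<open>The integral is a Bochner integral, with value \<open>0\<close> for a non-integrable integrand. For the
  Levy measure of a process with exponential moments of all orders the integrand is integrable for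
  every \<open>\<xi>\<close>.\<close>

definition log_mgf :: "real \<Rightarrow> real \<Rightarrow> real measure \<Rightarrow> real \<Rightarrow> real" where
  "log_mgf a \<sigma> \<nu> \<xi> = a * \<xi> + \<sigma>\<^sup>2 * \<xi>\<^sup>2 / 2 +
     (LINT y|\<nu>. exp (\<xi> * y) - 1 - \<xi> * y * indicator {y. \<bar>y\<bar> \<le> 1} y)"

definition legendre_transform :: "(real \<Rightarrow> real) \<Rightarrow> real \<Rightarrow> ereal" where
  "legendre_transform f p = (SUP \<xi>. ereal (\<xi> * p - f \<xi>))"

definition scaled_path :: "(real \<Rightarrow> 'w \<Rightarrow> real) \<Rightarrow> real \<Rightarrow> 'w \<Rightarrow> real \<Rightarrow> real" where
  "scaled_path L \<epsilon> \<omega> = (\<lambda>t\<in>{0..1}. \<epsilon> * L (t / \<epsilon>) \<omega>)"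

text \<open>Hence the probabilities in \<open>large_deviation_principle\<close> are those of genuine events.\<close>

lemma (in levy_process) measurable_scaled_path:
  assumes "\<epsilon> > 0"
  shows "scaled_path L \<epsilon> \<in> measurable M D01_sigma"
proof -
  have D: "scaled_path L \<epsilon> \<omega> \<in> D01" if w: "\<omega> \<in> space M" for \<omega>
  proof -
    have "(scaled_path L \<epsilon> \<omega> \<longlongrightarrow> \<epsilon> * c) (at t within {0..1} \<inter> J)"
      if t: "t \<in> {0..1}" and c: "((\<lambda>s. L s \<omega>) \<longlongrightarrow> c) (at (t / \<epsilon>) within {0..} \<inter> K)"
        and JK: "\<And>s. s \<in> J \<Longrightarrow> s / \<epsilon> \<in> K \<and> s \<noteq> t" for t c J K
    proof -
      have "filterlim (\<lambda>s. s / \<epsilon>) (at (t / \<epsilon>) within {0..} \<inter> K) (at t within {0..1} \<inter> J)"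
        unfolding filterlim_at using assms JK
        by (auto intro!: tendsto_intros simp: eventually_at_filter)
      then have "((\<lambda>s. \<epsilon> * L (s / \<epsilon>) \<omega>) \<longlongrightarrow> \<epsilon> * c) (at t within {0..1} \<inter> J)"
        by (intro tendsto_mult tendsto_const filterlim_compose[OF c])
      then show ?thesis
        by (rule Lim_transform_eventually) (auto simp: eventually_at_filter scaled_path_def)
    qed note lim = this
    have "(scaled_path L \<epsilon> \<omega> \<longlongrightarrow> scaled_path L \<epsilon> \<omega> t) (at t within {0..1} \<inter> {t<..}) \<and>
        (\<exists>l. (scaled_path L \<epsilon> \<omega> \<longlongrightarrow> l) (at t within {0..1} \<inter> {..<t}))"
      if t: "t \<in> {0..1}" for t
    proof -
      have "t / \<epsilon> \<in> {0..}" using t assms by simp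
      then obtain l where r: "((\<lambda>s. L s \<omega>) \<longlongrightarrow> L (t / \<epsilon>) \<omega>) (at (t / \<epsilon>) within {0..} \<inter> {t / \<epsilon><..})"
        and l: "((\<lambda>s. L s \<omega>) \<longlongrightarrow> l) (at (t / \<epsilon>) within {0..} \<inter> {..<t / \<epsilon>})"
        using cadlag_paths[OF w] unfolding cadlag_on_def by blast
      show ?thesis
        using lim[OF t r, of "{t<..}"] lim[OF t l, of "{..<t}"] assms t
        by (auto simp: scaled_path_def divide_strict_right_mono)
    qed
    then show ?thesis
      unfolding D01_def cadlag_on_def by (auto simp: scaled_path_def)
  qed
  show ?thesis
    unfolding D01_sigma_def
  proof (rule measurable_measure_of)
    fix Y assume "Y \<in> {{f \<in> D01. f t \<in> A} | t A. t \<in> {0..1} \<and> A \<in> sets borel}"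
    then obtain t A where Y: "Y = {f \<in> D01. f t \<in> A}" "t \<in> {0..1}" "A \<in> sets borel" by blast
    have [measurable]: "L (t / \<epsilon>) \<in> borel_measurable M" "A \<in> sets borel"
      using random_variable_L[of "t / \<epsilon>"] Y assms by auto
    have "scaled_path L \<epsilon> -` Y \<inter> space M = {\<omega> \<in> space M. \<epsilon> * L (t / \<epsilon>) \<omega> \<in> A}"
      using D Y by (auto simp: scaled_path_def)
    also have "\<dots> \<in> sets M" by measurable
    finally show "scaled_path L \<epsilon> -` Y \<inter> space M \<in> sets M" .
  qed (use D in auto)
qed

section \<open>The action functional\<close>

definition absolutely_continuous_fun :: "real \<Rightarrow> real \<Rightarrow> (real \<Rightarrow> real) \<Rightarrow> bool" where
  "absolutely_continuous_fun a b f \<longleftrightarrow>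
     (\<forall>e>0. \<exists>d>0. \<forall>(n::nat) u v.
        (\<forall>i<n. a \<le> u i \<and> u i \<le> v i \<and> v i \<le> b) \<and>
        disjoint_family_on (\<lambda>i. {u i<..<v i}) {..<n} \<and>
        (\<Sum>i<n. v i - u i) < d \<longrightarrow>
        (\<Sum>i<n. \<bar>f (v i) - f (u i)\<bar>) < e)"

definition AC01 :: "(real \<Rightarrow> real) set" where
  "AC01 = {\<phi> \<in> extensional {0..1}. absolutely_continuous_fun 0 1 \<phi> \<and> \<phi> 0 = 0}"

text \<open>The derivative of \<open>\<phi> \<in> AC01\<close> exists at almost every point of \<open>[0,1]\<close>; the value that
  \<^const>\<open>deriv\<close> takes at the exceptional points, among them \<open>0\<close> and \<open>1\<close>, does not affect the
  integral. The conversion \<^const>\<open>e2ennreal\<close> sends negative numbers to \<open>0\<close>; this is harmless by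
  \<open>legendre_transform_log_mgf_nonneg\<close>.\<close>

definition levy_action :: "real \<Rightarrow> real \<Rightarrow> real measure \<Rightarrow> (real \<Rightarrow> real) \<Rightarrow> ennreal" where
  "levy_action a \<sigma> \<nu> \<phi> =
     (if \<phi> \<in> AC01 \<and> \<phi> 0 = 0
      then \<integral>\<^sup>+ t\<in>{0..1}. e2ennreal (legendre_transform (log_mgf a \<sigma> \<nu>) (deriv \<phi> t)) \<partial>lborel
      else \<infinity>)"

lemma legendre_transform_log_mgf_nonneg: "0 \<le> legendre_transform (log_mgf a \<sigma> \<nu>) p"
  unfolding legendre_transform_def by (rule SUP_upper2[of 0]) (simp_all add: log_mgf_def)

end

theory Submission
  imports Defs "HOL-Complex_Analysis.Complex_Analysis" "HOL-Real_Asymp.Real_Asymp"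
begin

text \<open>Doob's maximal inequality for products of independent factors, written with a tilting density as a
  weight so that the measure never changes, controls how far the path strays from a polygon on finitely
  many blocks. Without tilting it makes an excursion of \<open>L\<^sup>\<epsilon>\<close> from its own interpolation superexponentially
  unlikely, and the slopes of that interpolation are independent with Chernoff tails; hence the upper bound,
  as a closed set keeps a positive distance from a compact sublevel set of \<open>S\<close> disjoint from it. With the
  tilt that makes a given polygon the typical path it yields the lower bound.

  The identity \<open>E (exp (\<xi> L\<^sub>t)) = exp (t \<Psi> \<xi>)\<close> comes from the identity theorem: both sides are entire and
  agree on the imaginary axis. That \<open>\<nu>\<close> has the required exponential moments is seen by testing the small
  increments \<open>L\<^sub>1\<^sub>/\<^sub>n\<close> against powers of \<open>1 - cos (h y)\<close>, whose limits are integrals of characteristic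
  exponents, and summing the resulting bounds for even moments to a hyperbolic cosine.

  Superlinear growth of \<open>\<Psi>\<^sup>*\<close> makes the sublevel sets of \<open>S\<close> uniformly absolutely continuous; they are
  closed because, by Jensen and Fatou, \<open>S \<phi> \<le> r\<close> if and only if the sums of \<open>\<Psi>\<^sup>*\<close> over the difference
  quotients of \<open>\<phi>\<close> on all uniform grids are bounded by \<open>r\<close>.\<close>

section \<open>Absolutely continuous functions are indefinite integrals\<close>

text \<open>The number \<open>m\<close> of blocks is fixed before \<epsilon>. In the time of
  \<open>L\<close> a block then lasts \<open>T = 1 / (m * \<epsilon>)\<close>, and factors such as
  \<open>tail_const \<eta> ^ m\<close> are constants that disappear from \<epsilon> log. The
  projection \<sigma>-algebra makes no trouble: bad events are measurable by construction, and the
  given set is compared with them by inclusion up to the null set where \<open>L 0\<close> is not 0,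
  so no distance between paths has to be measurable.

  Three degeneracies shape the rest. The supremum in the Legendre transform need not be attained, as
  for a slope at the edge of the range of the derivative of \<Psi>; nearby slopes are used instead,
  and they cost no more. \<Psi> is a Bochner integral with a default value, so it says nothing until
  \<open>\<nu>\<close> is known to have exponential moments, which are assumed of \<open>L 1\<close>
  only. The action reads the derivative of a function given by an \<epsilon>-\<delta> condition,
  hence the detour through Stieltjes measures and their densities.\<close>

lemma absolutely_continuous_funD:
  fixes a b e :: real
  assumes "absolutely_continuous_fun a b f" "e > 0"
  obtains d where "d > 0"
    "\<And>(I :: 'i set) u v. finite I \<Longrightarrow> (\<And>i. i \<in> I \<Longrightarrow> a \<le> u i \<and> u i \<le> v i \<and> v i \<le> b) \<Longrightarrow>
       disjoint_family_on (\<lambda>i. {u i<..<v i}) I \<Longrightarrow> (\<Sum>i\<in>I. v i - u i) < d \<Longrightarrow>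
       (\<Sum>i\<in>I. \<bar>f (v i) - f (u i)\<bar>) < e"
proof -
  from assms have "\<exists>d>0. \<forall>(n::nat) u v.
        (\<forall>i<n. a \<le> u i \<and> u i \<le> v i \<and> v i \<le> b) \<and>
        disjoint_family_on (\<lambda>i. {u i<..<v i}) {..<n} \<and>
        (\<Sum>i<n. v i - u i) < d \<longrightarrow>
        (\<Sum>i<n. \<bar>f (v i) - f (u i)\<bar>) < e"
    unfolding absolutely_continuous_fun_def by (elim allE impE) simp_all
  then obtain d where d0: "d > 0" and d: "\<forall>(n::nat) u v. (\<forall>i<n. a \<le> u i \<and> u i \<le> v i \<and> v i \<le> b) \<and>
        disjoint_family_on (\<lambda>i. {u i<..<v i}) {..<n} \<and>
        (\<Sum>i<n. v i - u i) < d \<longrightarrow> (\<Sum>i<n. \<bar>f (v i) - f (u i)\<bar>) < e"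
    by (elim exE conjE)
  show ?thesis
  proof (rule that[OF d0])
    fix I :: "'i set" and u v
    assume I: "finite I" "\<And>i. i \<in> I \<Longrightarrow> a \<le> u i \<and> u i \<le> v i \<and> v i \<le> b"
      "disjoint_family_on (\<lambda>i. {u i<..<v i}) I" "(\<Sum>i\<in>I. v i - u i) < d"
    \<comment> \<open>The definition numbers the intervals by an initial segment of the naturals; a
      bijection frees the index set, which is later a set of pairs.\<close>
    obtain h where h: "bij_betw h {0..<card I} I"
      using ex_bij_betw_nat_finite[OF I(1)] by blast
    have h': "bij_betw h {..<card I} I" using h by (simp add: atLeast0LessThan)
    have "(\<Sum>i<card I. \<bar>f (v (h i)) - f (u (h i))\<bar>) < e"
    proof (intro d[rule_format] conjI allI impI)
      fix i assume i: "i < card I"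
      then have "h i \<in> I" using bij_betwE[OF h'] by auto
      from I(2)[OF this] show "a \<le> u (h i)" "u (h i) \<le> v (h i)" "v (h i) \<le> b" by auto
    next
      show "disjoint_family_on (\<lambda>i. {u (h i)<..<v (h i)}) {..<card I}"
        unfolding disjoint_family_on_def
      proof safe
        fix m n x assume mn: "m < card I" "n < card I" "m \<noteq> n" "x \<in> {u (h m)<..<v (h m)}" "x \<in> {u (h n)<..<v (h n)}"
        then have "h m \<noteq> h n" "h m \<in> I" "h n \<in> I"
          using h' by (auto simp: bij_betw_def inj_on_def)
        then show "x \<in> {}" using I(3) mn unfolding disjoint_family_on_def by blast
      qed
      show "(\<Sum>i<card I. v (h i) - u (h i)) < d"
        using I(4) sum.reindex_bij_betw[OF h', of "\<lambda>i. v i - u i"] by simp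
    qed
    then show "(\<Sum>i\<in>I. \<bar>f (v i) - f (u i)\<bar>) < e"
      using sum.reindex_bij_betw[OF h', of "\<lambda>i. \<bar>f (v i) - f (u i)\<bar>"] by simp
  qed
qed

lemma absolutely_continuous_fun_uniform:
  assumes "absolutely_continuous_fun a b f" "e > 0"
  shows "\<exists>d>0. \<forall>s\<in>{a..b}. \<forall>t\<in>{a..b}. \<bar>t - s\<bar> < d \<longrightarrow> \<bar>f t - f s\<bar> < e"
proof -
  obtain d where d: "d > 0"
    "\<And>(I :: unit set) u v. finite I \<Longrightarrow> (\<And>i. i \<in> I \<Longrightarrow> a \<le> u i \<and> u i \<le> v i \<and> v i \<le> b) \<Longrightarrow>
       disjoint_family_on (\<lambda>i. {u i<..<v i}) I \<Longrightarrow> (\<Sum>i\<in>I. v i - u i) < d \<Longrightarrow>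
       (\<Sum>i\<in>I. \<bar>f (v i) - f (u i)\<bar>) < e"
    using absolutely_continuous_funD[OF assms, where 'i=unit] by blast
  have le: "\<bar>f t - f s\<bar> < e" if "a \<le> s" "s \<le> t" "t \<le> b" "\<bar>t - s\<bar> < d" for s t
    using d(2)[of "{()}" "\<lambda>_. s" "\<lambda>_. t"] that by (auto simp: disjoint_family_on_def)
  have "\<bar>f t - f s\<bar> < e" if "s \<in> {a..b}" "t \<in> {a..b}" "\<bar>t - s\<bar> < d" for s t
    using le[of s t] le[of t s] that by (cases "s \<le> t") (auto simp: abs_minus_commute)
  then show ?thesis using d(1) by blast
qed

lemma absolutely_continuous_fun_continuous:
  assumes "absolutely_continuous_fun a b f"
  shows "continuous_on {a..b} f"
  unfolding continuous_on_iff dist_real_def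
proof (intro ballI allI impI)
  fix x e :: real assume x: "x \<in> {a..b}" "0 < e"
  from absolutely_continuous_fun_uniform[OF assms x(2)]
  show "\<exists>d>0. \<forall>x'\<in>{a..b}. \<bar>x' - x\<bar> < d \<longrightarrow> \<bar>f x' - f x\<bar> < e" using x(1) by blast
qed

section \<open>Variation along dyadic grids\<close>

definition dyadic :: "nat \<Rightarrow> nat \<Rightarrow> real" where
  "dyadic n i = real i / 2 ^ n"

lemma dyadic_0 [simp]: "dyadic n 0 = 0"
  and dyadic_end [simp]: "dyadic n (2 ^ n) = 1"
  and dyadic_nonneg [simp]: "0 \<le> dyadic n i"
  by (auto simp: dyadic_def)

lemma dyadic_mono: "i \<le> j \<Longrightarrow> dyadic n i \<le> dyadic n j"
  by (simp add: dyadic_def divide_right_mono)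

lemma dyadic_le_1: "i \<le> 2 ^ n \<Longrightarrow> dyadic n i \<le> 1"
  using dyadic_mono[of i "2^n" n] by simp

lemma dyadic_Suc: "dyadic n (Suc i) = dyadic n i + 1 / 2 ^ n"
  by (simp add: dyadic_def add_divide_distrib)

lemma dyadic_refine: "dyadic (Suc n) (2 * i) = dyadic n i"
  by (simp add: dyadic_def)

text \<open>Cutting the grid points at \<open>t\<close>, instead of stopping the sum there, keeps
  one index set for all \<open>t\<close>: cells beyond \<open>t\<close> contribute 0, and two values
  of \<open>t\<close> can be compared cell by cell.\<close>

definition dyadic_variation :: "(real \<Rightarrow> real) \<Rightarrow> nat \<Rightarrow> real \<Rightarrow> real" where
  "dyadic_variation f n t =
     (\<Sum>i<2^n. \<bar>f (min t (dyadic n (Suc i))) - f (min t (dyadic n i))\<bar>)"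

lemma sum_lessThan_double: "(\<Sum>i<2*m. g i) = (\<Sum>i<m. g (2*i) + g (Suc (2*i)) :: real)"
  by (induction m) (auto simp: algebra_simps)

lemma dyadic_variation_Suc: "dyadic_variation f n t \<le> dyadic_variation f (Suc n) t"
proof -
  have "dyadic_variation f (Suc n) t =
    (\<Sum>i<2^n. \<bar>f (min t (dyadic (Suc n) (Suc (2*i)))) - f (min t (dyadic (Suc n) (2*i)))\<bar>
            + \<bar>f (min t (dyadic (Suc n) (Suc (Suc (2*i))))) - f (min t (dyadic (Suc n) (Suc (2*i))))\<bar>)"
    unfolding dyadic_variation_def power_Suc by (rule sum_lessThan_double)
  also have "\<dots> \<ge> dyadic_variation f n t"
    unfolding dyadic_variation_def
  proof (rule sum_mono)
    fix i
    have "dyadic (Suc n) (Suc (Suc (2*i))) = dyadic n (Suc i)"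
      using dyadic_refine[of n "Suc i"] by simp
    then show "\<bar>f (min t (dyadic n (Suc i))) - f (min t (dyadic n i))\<bar> \<le>
       \<bar>f (min t (dyadic (Suc n) (Suc (2*i)))) - f (min t (dyadic (Suc n) (2*i)))\<bar>
            + \<bar>f (min t (dyadic (Suc n) (Suc (Suc (2*i))))) - f (min t (dyadic (Suc n) (Suc (2*i))))\<bar>"
      using abs_triangle_ineq[of "f (min t (dyadic (Suc n) (Suc (2*i)))) - f (min t (dyadic n i))"
          "f (min t (dyadic n (Suc i))) - f (min t (dyadic (Suc n) (Suc (2*i))))"]
      by (simp add: dyadic_refine)
  qed
  finally show ?thesis .
qed

lemma dyadic_variation_0 [simp]: "dyadic_variation f n 0 = 0"
  unfolding dyadic_variation_def by simp

text \<open>Cells on either side of \<open>s\<close> give equality; for the cell that straddles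
  \<open>s\<close> the triangle inequality at \<open>s\<close> is used.\<close>

lemma dyadic_variation_diff_le:
  assumes "s \<le> t"
  shows "dyadic_variation f n t - dyadic_variation f n s \<le>
    (\<Sum>i<2^n. \<bar>f (max s (min t (dyadic n (Suc i)))) - f (max s (min t (dyadic n i)))\<bar>)"
  unfolding dyadic_variation_def sum_subtractf[symmetric]
proof (rule sum_mono)
  fix i
  have "dyadic n i \<le> dyadic n (Suc i)" by (rule dyadic_mono) simp
  then consider "dyadic n (Suc i) \<le> s" | "s \<le> dyadic n i" | "dyadic n i < s" "s < dyadic n (Suc i)" by linarith
  then show "\<bar>f (min t (dyadic n (Suc i))) - f (min t (dyadic n i))\<bar> -
         \<bar>f (min s (dyadic n (Suc i))) - f (min s (dyadic n i))\<bar>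
         \<le> \<bar>f (max s (min t (dyadic n (Suc i)))) - f (max s (min t (dyadic n i)))\<bar>"
  proof cases
    case 1
    with \<open>dyadic n i \<le> dyadic n (Suc i)\<close> assms show ?thesis by (simp add: min_absorb2 max_absorb1)
  next
    case 2
    with \<open>dyadic n i \<le> dyadic n (Suc i)\<close> assms show ?thesis by (simp add: min_absorb1 max_absorb2)
  next
    case 3
    with assms show ?thesis by (simp add: min_absorb1 max_absorb2 min_absorb2 max_absorb1)
  qed
qed

text \<open>For fixed \<open>n\<close> the dyadic variation need not increase in \<open>t\<close>,
  since \<open>f\<close> may turn back inside the cell containing \<open>s\<close>. That cell costs
  twice the oscillation \<open>w\<close>, an error that disappears as the grid is refined.\<close>

lemma dyadic_variation_diff_ge:
  assumes "0 \<le> s" "s \<le> t" "t \<le> 1"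
    and w: "\<And>x y. 0 \<le> x \<Longrightarrow> x \<le> 1 \<Longrightarrow> 0 \<le> y \<Longrightarrow> y \<le> 1 \<Longrightarrow> \<bar>x - y\<bar> \<le> 1 / 2 ^ n \<Longrightarrow> \<bar>f x - f y\<bar> \<le> w"
  shows "\<bar>f t - f s\<bar> - 2 * w \<le> dyadic_variation f n t - dyadic_variation f n s"
proof -
  define A where "A t i = f (min t (dyadic n (Suc i))) - f (min t (dyadic n i))" for t i
  \<comment> \<open>The index of the only cell that can contain \<open>s\<close> in its
    interior.\<close>
  define k where "k = nat \<lfloor>s * 2 ^ n\<rfloor>"
  have w0: "w \<ge> 0" using w[of 0 0] by simp
  have tel: "(\<Sum>i<2^n. A r i) = f r - f 0" if "0 \<le> r" "r \<le> 1" for r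
    unfolding A_def using that by (subst sum_lessThan_telescope) auto
  have one: "\<bar>A t i\<bar> - \<bar>A s i\<bar> \<ge> \<bar>A t i - A s i\<bar> - (if i = k then 2 * w else 0)" if i: "i < 2 ^ n" for i
  proof -
    have le: "dyadic n i \<le> dyadic n (Suc i)" by (rule dyadic_mono) simp
    then consider "dyadic n (Suc i) \<le> s" | "s \<le> dyadic n i" | "dyadic n i < s" "s < dyadic n (Suc i)" by linarith
    then show ?thesis
    proof cases
      case 1
      then have "A t i = A s i" unfolding A_def using le assms by (simp add: min_absorb2)
      then show ?thesis using w0 by simp
    next
      case 2
      then have "A s i = 0" unfolding A_def using le assms by (simp add: min_absorb1)
      then show ?thesis using w0 by simp
    next
      case 3
      then have "real i < s * 2^n" "s * 2 ^ n < real i + 1"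
        by (simp_all add: dyadic_def field_simps)
      then have "\<lfloor>s * 2 ^ n\<rfloor> = int i" by linarith
      then have "i = k" unfolding k_def by simp
      moreover have "A s i = f s - f (dyadic n i)"
        using 3 by (simp add: A_def min_absorb1 min_absorb2)
      moreover have "\<bar>f s - f (dyadic n i)\<bar> \<le> w"
        using 3 assms(1-3) dyadic_Suc[of n i] dyadic_nonneg[of n i] by (intro w; linarith)
      ultimately show ?thesis by auto
    qed
  qed
  have "\<bar>f t - f s\<bar> = \<bar>\<Sum>i<2^n. A t i - A s i\<bar>"
    using tel[of t] tel[of s] assms by (simp add: sum_subtractf)
  also have "\<dots> \<le> (\<Sum>i<2^n. \<bar>A t i - A s i\<bar>)" by (rule sum_abs)
  also have "\<dots> \<le> (\<Sum>i<2^n. \<bar>A t i\<bar> - \<bar>A s i\<bar> + (if i = k then 2 * w else 0))"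
    by (intro sum_mono) (use one in force)
  also have "\<dots> \<le> dyadic_variation f n t - dyadic_variation f n s + 2 * w"
    unfolding dyadic_variation_def A_def[symmetric] using w0
    by (simp add: sum.distrib sum_subtractf sum.delta)
  finally show ?thesis by simp
qed

text \<open>The limit of the dyadic variations is a monotone majorant of \<open>f\<close> inheriting its absolute
  continuity.\<close>

lemma monotone_majorant:
  assumes ac: "absolutely_continuous_fun 0 1 f"
  obtains V where
    "\<And>s t. 0 \<le> s \<Longrightarrow> s \<le> t \<Longrightarrow> t \<le> 1 \<Longrightarrow> \<bar>f t - f s\<bar> \<le> V t - V s"
    "\<And>e. e > 0 \<Longrightarrow> \<exists>d>0. \<forall>(I :: nat set) u v. finite I \<longrightarrow> (\<forall>i\<in>I. 0 \<le> u i \<and> u i \<le> v i \<and> v i \<le> 1) \<longrightarrow>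
       disjoint_family_on (\<lambda>i. {u i<..<v i}) I \<longrightarrow> (\<Sum>i\<in>I. v i - u i) < d \<longrightarrow>
       (\<Sum>i\<in>I. V (v i) - V (u i)) \<le> e"
proof -
  \<comment> \<open>One \<open>d\<close> serves all grids \<open>n\<close>, which is what lets the
    estimate pass to the limit.\<close>
  have key: "\<exists>d>0. \<forall>n (I :: nat set) u v. finite I \<longrightarrow> (\<forall>i\<in>I. 0 \<le> u i \<and> u i \<le> v i \<and> v i \<le> 1) \<longrightarrow>
       disjoint_family_on (\<lambda>i. {u i<..<v i}) I \<longrightarrow> (\<Sum>i\<in>I. v i - u i) < d \<longrightarrow>
       (\<Sum>i\<in>I. dyadic_variation f n (v i) - dyadic_variation f n (u i)) \<le> e" if e: "e > 0" for e
  proof -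
    obtain d where d: "d > 0"
      "\<And>(I :: (nat \<times> nat) set) u v. finite I \<Longrightarrow> (\<And>i. i \<in> I \<Longrightarrow> 0 \<le> u i \<and> u i \<le> v i \<and> v i \<le> 1) \<Longrightarrow>
       disjoint_family_on (\<lambda>i. {u i<..<v i}) I \<Longrightarrow> (\<Sum>i\<in>I. v i - u i) < d \<Longrightarrow>
       (\<Sum>i\<in>I. \<bar>f (v i) - f (u i)\<bar>) < e"
      using absolutely_continuous_funD[OF ac e, where 'i="nat \<times> nat"] by blast
    show ?thesis
    proof (intro exI[of _ d] conjI d(1) allI impI)
      fix n and I :: "nat set" and u v
      assume I: "finite I" "\<forall>i\<in>I. 0 \<le> u i \<and> u i \<le> v i \<and> v i \<le> 1"
        "disjoint_family_on (\<lambda>i. {u i<..<v i}) I" "(\<Sum>i\<in>I. v i - u i) < d"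
      \<comment> \<open>\<open>c l\<close> clamps to the \<open>l\<close>-th interval. Clamping
        every grid cell to every interval gives disjoint intervals indexed by pairs, and for fixed
        \<open>l\<close> their lengths telescope to that of the interval.\<close>
      define c where "c l x = max (u l) (min (v l) x)" for l x
      have cm: "x \<le> y \<Longrightarrow> c l x \<le> c l y" for l x y unfolding c_def by auto
      have c01: "u l \<le> c l x \<and> c l x \<le> v l" if "l \<in> I" for l x
        using I(2) that unfolding c_def by auto
      have "(\<Sum>i\<in>I. dyadic_variation f n (v i) - dyadic_variation f n (u i)) \<le>
        (\<Sum>l\<in>I. \<Sum>i<2^n. \<bar>f (c l (dyadic n (Suc i))) - f (c l (dyadic n i))\<bar>)"
        unfolding c_def by (intro sum_mono dyadic_variation_diff_le) (use I(2) in auto)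
      also have "\<dots> = (\<Sum>p\<in>I \<times> {..<(2::nat)^n}. \<bar>f (c (fst p) (dyadic n (Suc (snd p)))) - f (c (fst p) (dyadic n (snd p)))\<bar>)"
        by (simp add: sum.cartesian_product case_prod_unfold)
      also have "\<dots> < e"
      proof (rule d(2))
        show "finite (I \<times> {..<(2::nat)^n})" using I(1) by simp
        show "0 \<le> c (fst p) (dyadic n (snd p)) \<and> c (fst p) (dyadic n (snd p)) \<le> c (fst p) (dyadic n (Suc (snd p))) \<and>
          c (fst p) (dyadic n (Suc (snd p))) \<le> 1" if p: "p \<in> I \<times> {..<(2::nat)^n}" for p
        proof -
          have "fst p \<in> I" using p by auto
          then have "0 \<le> u (fst p)" "v (fst p) \<le> 1" using I(2) by auto
          moreover have "c (fst p) (dyadic n (snd p)) \<le> c (fst p) (dyadic n (Suc (snd p)))"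
            by (intro cm dyadic_mono) simp
          ultimately show ?thesis
            using c01[OF \<open>fst p \<in> I\<close>, of "dyadic n (snd p)"] c01[OF \<open>fst p \<in> I\<close>, of "dyadic n (Suc (snd p))"]
            by linarith
        qed
        show "disjoint_family_on (\<lambda>p. {c (fst p) (dyadic n (snd p))<..<c (fst p) (dyadic n (Suc (snd p)))}) (I \<times> {..<(2::nat)^n})"
          unfolding disjoint_family_on_def
        proof (intro ballI impI)
          fix p p'
          assume h0: "p \<in> I \<times> {..<(2::nat)^n}" "p' \<in> I \<times> {..<(2::nat)^n}" "p \<noteq> p'"
          obtain l i l' i' where p: "p = (l, i)" "p' = (l', i')" by (cases p, cases p') auto
          have False if "x \<in> {c l (dyadic n i)<..<c l (dyadic n (Suc i))}"
            "x \<in> {c l' (dyadic n i')<..<c l' (dyadic n (Suc i'))}" for x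
          proof (cases "l = l'")
            case True
            then have "i \<noteq> i'" using h0 p by auto
            then consider "Suc i \<le> i'" | "Suc i' \<le> i" by linarith
            then show ?thesis
              by cases (use that True cm[OF dyadic_mono[of "Suc i" i' n], of l] cm[OF dyadic_mono[of "Suc i'" i n], of l] in auto)
          next
            case False
            have "x \<in> {u l<..<v l} \<inter> {u l'<..<v l'}"
              using that h0 p c01[of l "dyadic n i"] c01[of l "dyadic n (Suc i)"] c01[of l' "dyadic n i'"] c01[of l' "dyadic n (Suc i')"]
              by auto
            then show ?thesis using I(3) h0 p False unfolding disjoint_family_on_def by blast
          qed
          then show "{c (fst p) (dyadic n (snd p))<..<c (fst p) (dyadic n (Suc (snd p)))} \<inter>
              {c (fst p') (dyadic n (snd p'))<..<c (fst p') (dyadic n (Suc (snd p')))} = {}"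
            using p by (simp only: fst_conv snd_conv) blast
        qed
        have "(\<Sum>p\<in>I \<times> {..<(2::nat)^n}. c (fst p) (dyadic n (Suc (snd p))) - c (fst p) (dyadic n (snd p)))
          = (\<Sum>l\<in>I. \<Sum>i<2^n. c l (dyadic n (Suc i)) - c l (dyadic n i))"
          by (simp add: sum.cartesian_product case_prod_unfold)
        also have "\<dots> = (\<Sum>l\<in>I. v l - u l)"
        proof (rule sum.cong[OF refl])
          fix l assume l: "l \<in> I"
          show "(\<Sum>i<2^n. c l (dyadic n (Suc i)) - c l (dyadic n i)) = v l - u l"
            using I(2) l by (subst sum_lessThan_telescope) (auto simp: c_def)
        qed
        finally show "(\<Sum>p\<in>I \<times> {..<(2::nat)^n}. c (fst p) (dyadic n (Suc (snd p))) - c (fst p) (dyadic n (snd p))) < d"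
          using I(4) by simp
      qed
      finally show "(\<Sum>i\<in>I. dyadic_variation f n (v i) - dyadic_variation f n (u i)) \<le> e" by simp
    qed
  qed
  obtain d where d: "d > 0" "\<And>n (I :: nat set) u v. finite I \<Longrightarrow> (\<forall>i\<in>I. 0 \<le> u i \<and> u i \<le> v i \<and> v i \<le> 1) \<Longrightarrow>
       disjoint_family_on (\<lambda>i. {u i<..<v i}) I \<Longrightarrow> (\<Sum>i\<in>I. v i - u i) < d \<Longrightarrow>
       (\<Sum>i\<in>I. dyadic_variation f n (v i) - dyadic_variation f n (u i)) \<le> 1"
    using key[of 1] by auto
  \<comment> \<open>Cutting the unit interval into \<open>N\<close> pieces shorter than
    \<open>d\<close> bounds all dyadic variations at 1 by \<open>N\<close>.\<close>
  obtain N :: nat where N: "N > 0" "1 / real N < d"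
  proof -
    obtain n where "1 / real (Suc n) < d" using nat_approx_posE[OF d(1)] by blast
    then show ?thesis using that[of "Suc n"] by simp
  qed
  have bound1: "dyadic_variation f n 1 \<le> real N" for n
  proof -
    have "dyadic_variation f n 1 = (\<Sum>j<N. dyadic_variation f n (real (Suc j) / N) - dyadic_variation f n (real j / N))"
      using N by (subst sum_lessThan_telescope) auto
    also have "\<dots> \<le> (\<Sum>j<N. 1)"
    proof (rule sum_mono)
      fix j assume "j \<in> {..<N}"
      then have "real (Suc j) / N \<le> 1" "real j / N \<le> real (Suc j) / N" "real (Suc j) / N - real j / N < d"
        using N by (auto simp: field_simps)
      moreover have "disjoint_family_on (\<lambda>_. {real j / N<..<real (Suc j) / N}) {0::nat}"
        by (simp add: disjoint_family_on_def)
      ultimately have "(\<Sum>i\<in>{0::nat}. dyadic_variation f n (real (Suc j) / N) - dyadic_variation f n (real j / N)) \<le> 1"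
        by (intro d(2)) (simp_all only: sum.insert sum.empty finite.intros empty_iff ball_simps simp_thms add_0_right, simp_all)
      then show "dyadic_variation f n (real (Suc j) / N) - dyadic_variation f n (real j / N) \<le> 1"
        by simp
    qed
    finally show ?thesis by simp
  qed
  obtain B where B: "\<And>x. 0 \<le> x \<Longrightarrow> x \<le> 1 \<Longrightarrow> \<bar>f x\<bar> \<le> B"
  proof -
    have "continuous_on {0..1} f" by (rule absolutely_continuous_fun_continuous[OF ac])
    then have "bounded (f ` {0..1})" by (intro compact_imp_bounded compact_continuous_image) auto
    then obtain B where "\<forall>x\<in>{0..1}. \<bar>f x\<bar> \<le> B" unfolding bounded_iff by auto
    then show ?thesis using that[of B] by simp
  qed
  have boundt: "dyadic_variation f n t \<le> real N + 4 * B" if "0 \<le> t" "t \<le> 1" for n t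
  proof -
    \<comment> \<open>Monotonicity in \<open>t\<close> can fail only by the oscillation of
      \<open>f\<close>, here at most \<open>2 * B\<close>.\<close>
    have "\<bar>f 1 - f t\<bar> - 2 * (2 * B) \<le> dyadic_variation f n 1 - dyadic_variation f n t"
    proof (rule dyadic_variation_diff_ge)
      fix x y :: real assume "0 \<le> x" "x \<le> 1" "0 \<le> y" "y \<le> 1"
      then show "\<bar>f x - f y\<bar> \<le> 2 * B" using B[of x] B[of y] by linarith
    qed (use that in auto)
    then show ?thesis using bound1[of n] by linarith
  qed
  define V where "V t = lim (\<lambda>n. dyadic_variation f n t)" for t
  have lim: "(\<lambda>n. dyadic_variation f n t) \<longlonglongrightarrow> V t" if t01: "0 \<le> t" "t \<le> 1" for t
  proof -
    have "incseq (\<lambda>n. dyadic_variation f n t)" by (rule incseq_SucI) (rule dyadic_variation_Suc)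
    then obtain l where "(\<lambda>n. dyadic_variation f n t) \<longlonglongrightarrow> l"
      using incseq_convergent[of "\<lambda>n. dyadic_variation f n t" "real N + 4 * B"] boundt[OF t01] by metis
    then have "convergent (\<lambda>n. dyadic_variation f n t)" by (auto simp: convergent_def)
    then show ?thesis unfolding V_def convergent_LIMSEQ_iff .
  qed
  show ?thesis
  proof (rule that[of V])
    fix s t :: real assume st: "0 \<le> s" "s \<le> t" "t \<le> 1"
    \<comment> \<open>By uniform continuity the oscillation over one cell falls below
      \<open>e\<close> for large \<open>n\<close>.\<close>
    have that': "\<bar>f t - f s\<bar> - 2 * e \<le> V t - V s" if e: "e > 0" for e
    proof (rule tendsto_lowerbound[OF tendsto_diff[OF lim lim]])
      obtain d where d: "d > 0" "\<forall>s\<in>{0..1}. \<forall>t\<in>{0..1}. \<bar>t - s\<bar> < d \<longrightarrow> \<bar>f t - f s\<bar> < e"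
        using absolutely_continuous_fun_uniform[OF ac e] by blast
      have "(\<lambda>n. 1 / 2 ^ n :: real) \<longlonglongrightarrow> 0"
        using LIMSEQ_power_zero[of "1/2 :: real"] by (simp add: power_divide)
      then have "\<forall>\<^sub>F n in sequentially. 1 / 2 ^ n < d" using d(1) by (rule order_tendstoD)
      then show "\<forall>\<^sub>F n in sequentially. \<bar>f t - f s\<bar> - 2 * e \<le> dyadic_variation f n t - dyadic_variation f n s"
      proof eventually_elim
        case (elim n)
        show ?case
        proof (rule dyadic_variation_diff_ge[OF st])
          fix x y :: real assume "0 \<le> x" "x \<le> 1" "0 \<le> y" "y \<le> 1" "\<bar>x - y\<bar> \<le> 1 / 2 ^ n"
          then show "\<bar>f x - f y\<bar> \<le> e" using d(2)[rule_format, of y x] elim by simp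
        qed
      qed
    qed (use st in auto)
    have "\<bar>f t - f s\<bar> \<le> V t - V s + e" if "e > 0" for e
    proof -
      have "\<bar>f t - f s\<bar> - 2 * (e / 2) \<le> V t - V s" by (rule that') (use that in simp)
      then show ?thesis by simp
    qed
    then show "\<bar>f t - f s\<bar> \<le> V t - V s" by (rule field_le_epsilon)
  next
    fix e :: real assume "e > 0"
    then obtain d where d: "d > 0" "\<And>n (I :: nat set) u v. finite I \<Longrightarrow> (\<forall>i\<in>I. 0 \<le> u i \<and> u i \<le> v i \<and> v i \<le> 1) \<Longrightarrow>
       disjoint_family_on (\<lambda>i. {u i<..<v i}) I \<Longrightarrow> (\<Sum>i\<in>I. v i - u i) < d \<Longrightarrow>
       (\<Sum>i\<in>I. dyadic_variation f n (v i) - dyadic_variation f n (u i)) \<le> e"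
      using key[of e] by auto
    show "\<exists>d>0. \<forall>(I :: nat set) u v. finite I \<longrightarrow> (\<forall>i\<in>I. 0 \<le> u i \<and> u i \<le> v i \<and> v i \<le> 1) \<longrightarrow>
       disjoint_family_on (\<lambda>i. {u i<..<v i}) I \<longrightarrow> (\<Sum>i\<in>I. v i - u i) < d \<longrightarrow>
       (\<Sum>i\<in>I. V (v i) - V (u i)) \<le> e"
    proof (intro exI[of _ d] conjI d(1) allI impI)
      fix I :: "nat set" and u v
      assume I: "finite I" "\<forall>i\<in>I. 0 \<le> u i \<and> u i \<le> v i \<and> v i \<le> 1"
        "disjoint_family_on (\<lambda>i. {u i<..<v i}) I" "(\<Sum>i\<in>I. v i - u i) < d"
      have b: "0 \<le> u i" "u i \<le> 1" "0 \<le> v i" "v i \<le> 1" if "i \<in> I" for i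
        using bspec[OF I(2) that] by linarith+
      have "(\<lambda>n. \<Sum>i\<in>I. dyadic_variation f n (v i) - dyadic_variation f n (u i)) \<longlonglongrightarrow> (\<Sum>i\<in>I. V (v i) - V (u i))"
        by (intro tendsto_sum tendsto_diff lim b)
      then show "(\<Sum>i\<in>I. V (v i) - V (u i)) \<le> e"
        by (rule LIMSEQ_le_const2) (use d(2)[OF I] in auto)
    qed
  qed
qed

section \<open>Stieltjes measures and their densities\<close>

text \<open>By outer regularity a Lebesgue null set lies in open sets of arbitrarily small length,
  and inside (0,1] an open set is the increasing union over \<open>n\<close> of the dyadic cells it
  contains. On finitely many cells the hypothesis \<open>ac\<close> bounds the measure. Outside
  (0,1] there is no mass, as \<open>F\<close> is constant there.\<close>

lemma absolutely_continuous_interval_measure: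
  fixes F :: "real \<Rightarrow> real"
  assumes mono: "\<And>s t. s \<le> t \<Longrightarrow> F s \<le> F t"
    and cont: "\<And>x. continuous (at_right x) F"
    and low: "\<And>x. x \<le> 0 \<Longrightarrow> F x = F 0" and high: "\<And>x. 1 \<le> x \<Longrightarrow> F x = F 1"
    and ac: "\<And>e. e > 0 \<Longrightarrow> \<exists>d>0. \<forall>(I :: nat set) u v. finite I \<longrightarrow> (\<forall>i\<in>I. 0 \<le> u i \<and> u i \<le> v i \<and> v i \<le> 1) \<longrightarrow>
       disjoint_family_on (\<lambda>i. {u i<..<v i}) I \<longrightarrow> (\<Sum>i\<in>I. v i - u i) < d \<longrightarrow>
       (\<Sum>i\<in>I. F (v i) - F (u i)) \<le> e"
  shows "absolutely_continuous lborel (interval_measure F)"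
proof -
  let ?\<mu> = "interval_measure F"
  note Ioc = emeasure_interval_measure_Ioc[of _ _ F, OF _ mono cont]
  have neg: "{..0} \<in> null_sets ?\<mu>"
  proof -
    have "{..0::real} = (\<Union>k::nat. {- real k<..0})"
    proof (intro set_eqI iffI)
      fix x :: real assume "x \<in> {..0}"
      moreover obtain k :: nat where "- x < real k" using reals_Archimedean2 by blast
      ultimately show "x \<in> (\<Union>k::nat. {- real k<..0})" by (auto intro!: exI[of _ k])
    qed auto
    moreover have "{- real k<..0} \<in> null_sets ?\<mu>" for k
      using Ioc[of "- real k" 0] low[of "- real k"] by (auto simp: null_sets_def)
    ultimately show ?thesis by (simp only: null_sets_UN)
  qed
  have pos: "{1<..} \<in> null_sets ?\<mu>"
  proof -
    have "{1::real<..} = (\<Union>k::nat. {1<..1 + real k})"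
    proof (intro set_eqI iffI)
      fix x :: real assume "x \<in> {1<..}"
      moreover obtain k :: nat where "x < real k" using reals_Archimedean2 by blast
      ultimately show "x \<in> (\<Union>k::nat. {1<..1 + real k})" by (auto intro!: exI[of _ k])
    qed auto
    moreover have "{1<..1 + real k} \<in> null_sets ?\<mu>" for k
      using Ioc[of 1 "1 + real k"] high[of "1 + real k"] by (auto simp: null_sets_def)
    ultimately show ?thesis by (simp only: null_sets_UN)
  qed
  have small: "\<exists>d>0. \<forall>U. open U \<longrightarrow> emeasure lborel U < ennreal d \<longrightarrow> emeasure ?\<mu> (U \<inter> {0<..1}) \<le> ennreal e"
    if e: "e > 0" for e :: real
  proof -
    from ac[OF e] obtain d where d0: "d > 0" and d: "\<forall>(I :: nat set) u v. finite I \<longrightarrow> (\<forall>i\<in>I. 0 \<le> u i \<and> u i \<le> v i \<and> v i \<le> 1) \<longrightarrow>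
       disjoint_family_on (\<lambda>i. {u i<..<v i}) I \<longrightarrow> (\<Sum>i\<in>I. v i - u i) < d \<longrightarrow>
       (\<Sum>i\<in>I. F (v i) - F (u i)) \<le> e" by (elim exE conjE)
    have "emeasure ?\<mu> (U \<inter> {0<..1}) \<le> ennreal e" if U: "open U" "emeasure lborel U < ennreal d" for U
    proof -
      \<comment> \<open>Half-open cells have an increment of \<open>F\<close> as their exact
        measure, while \<open>ac\<close> speaks of open intervals; disjointness is therefore proved
        in two versions.\<close>
      define C where "C n i = {dyadic n i<..dyadic n (Suc i)}" for n i
      define J where "J n = {i. i < (2::nat) ^ n \<and> C n i \<subseteq> U}" for n
      define A where "A n = (\<Union>i\<in>J n. C n i)" for n
      have fin: "finite (J n)" for n unfolding J_def by auto
      have Suc_le: "dyadic n i \<le> dyadic n (Suc i)" for n i by (rule dyadic_mono) simp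
      have disj: "disjoint_family_on (C n) (J n)" for n
        unfolding disjoint_family_on_def
      proof (intro ballI impI)
        fix i j assume "i \<in> J n" "j \<in> J n" "i \<noteq> j"
        then consider "Suc i \<le> j" | "Suc j \<le> i" by linarith
        then show "C n i \<inter> C n j = {}"
          by cases (use dyadic_mono[of "Suc i" j n] dyadic_mono[of "Suc j" i n] in \<open>auto simp: C_def\<close>)
      qed
      have disj': "disjoint_family_on (\<lambda>i. {dyadic n i<..<dyadic n (Suc i)}) (J n)" for n
        using disj[of n] unfolding disjoint_family_on_def C_def by fastforce
      have Cs: "C n i \<in> sets borel" for n i by (simp add: C_def)
      have em: "emeasure ?\<mu> (A n) \<le> ennreal e" for n
      proof -
        have "emeasure lborel (A n) = (\<Sum>i\<in>J n. emeasure lborel (C n i))"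
          unfolding A_def by (rule sum_emeasure[symmetric]) (use fin disj Cs in auto)
        also have "\<dots> = (\<Sum>i\<in>J n. ennreal (dyadic n (Suc i) - dyadic n i))"
          unfolding C_def using Suc_le by (intro sum.cong) auto
        also have "\<dots> = ennreal (\<Sum>i\<in>J n. dyadic n (Suc i) - dyadic n i)"
          using Suc_le by (intro sum_ennreal) simp
        finally have len: "emeasure lborel (A n) = ennreal (\<Sum>i\<in>J n. dyadic n (Suc i) - dyadic n i)" .
        have "emeasure lborel (A n) \<le> emeasure lborel U"
          by (rule emeasure_mono) (use U(1) in \<open>auto simp: A_def J_def\<close>)
        with U(2) len have "ennreal (\<Sum>i\<in>J n. dyadic n (Suc i) - dyadic n i) < ennreal d" by (metis le_less_trans)
        moreover have "0 \<le> (\<Sum>i\<in>J n. dyadic n (Suc i) - dyadic n i)"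
          by (intro sum_nonneg) (use Suc_le in simp)
        ultimately have len': "(\<Sum>i\<in>J n. dyadic n (Suc i) - dyadic n i) < d"
          by (simp add: ennreal_less_iff)
        have "emeasure ?\<mu> (A n) = (\<Sum>i\<in>J n. emeasure ?\<mu> (C n i))"
          unfolding A_def by (rule sum_emeasure[symmetric]) (use fin disj Cs in auto)
        also have "\<dots> = (\<Sum>i\<in>J n. ennreal (F (dyadic n (Suc i)) - F (dyadic n i)))"
          unfolding C_def using Suc_le by (intro sum.cong Ioc) auto
        also have "\<dots> = ennreal (\<Sum>i\<in>J n. F (dyadic n (Suc i)) - F (dyadic n i))"
          using mono[OF Suc_le] by (intro sum_ennreal) simp
        also have "(\<Sum>i\<in>J n. F (dyadic n (Suc i)) - F (dyadic n i)) \<le> e"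
        proof (rule d[rule_format, OF fin _ disj' len'])
          fix i assume "i \<in> J n"
          then have "Suc i \<le> 2 ^ n" by (simp add: J_def)
          then show "0 \<le> dyadic n i \<and> dyadic n i \<le> dyadic n (Suc i) \<and> dyadic n (Suc i) \<le> 1"
            using Suc_le dyadic_le_1[of "Suc i" n] by simp
        qed
        finally show ?thesis by (simp add: ennreal_leI)
      qed
      \<comment> \<open>The cells are closed on the right, hence the ceiling minus one.\<close>
      have cell: "x \<in> C n (nat (\<lceil>x * 2 ^ n\<rceil> - 1)) \<and> nat (\<lceil>x * 2 ^ n\<rceil> - 1) < 2 ^ n"
        if x: "0 < x" "x \<le> 1" for x n
      proof -
        let ?c = "\<lceil>x * 2 ^ n\<rceil>"
        have 1: "?c \<ge> 1" using x by simp
        have "x * 2 ^ n \<le> 2 ^ n" using x by simp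
        then have 2: "?c \<le> 2 ^ n" by (simp add: ceiling_le_iff)
        have "real (nat (?c - 1)) = of_int ?c - 1" "real (Suc (nat (?c - 1))) = of_int ?c"
          using 1 by (auto simp: of_nat_nat)
        moreover have "of_int ?c - 1 < x * 2 ^ n" "x * 2 ^ n \<le> of_int ?c" by linarith+
        ultimately have "x \<in> C n (nat (?c - 1))"
          unfolding C_def dyadic_def by (simp add: field_simps del: of_nat_Suc)
        moreover have "nat (?c - 1) < 2 ^ n"
        proof -
          have "?c - 1 < 2 ^ n" using 2 by linarith
          then show ?thesis using 1 by (simp add: nat_less_iff)
        qed
        ultimately show ?thesis by simp
      qed
      have "U \<inter> {0<..1} \<subseteq> (\<Union>n. A n)"
      proof
        fix x assume x: "x \<in> U \<inter> {0<..1}"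
        then obtain r where r: "r > 0" "ball x r \<subseteq> U" using U(1) by (auto simp: open_contains_ball)
        obtain n where n: "(1/2) ^ n < r" using real_arch_pow_inv[of r "1/2"] r by auto
        let ?i = "nat (\<lceil>x * 2 ^ n\<rceil> - 1)"
        have c: "x \<in> C n ?i" "?i < 2 ^ n" using cell[of x n] x by auto
        have "C n ?i \<subseteq> ball x r"
        proof
          fix y assume "y \<in> C n ?i"
          then have "\<bar>x - y\<bar> < r"
            using c(1) n dyadic_Suc[of n ?i] unfolding C_def
            by (simp add: power_one_over abs_less_iff)
          then show "y \<in> ball x r" by (simp add: dist_real_def)
        qed
        then show "x \<in> (\<Union>n. A n)" using r(2) c unfolding A_def J_def by blast
      qed
      then have "emeasure ?\<mu> (U \<inter> {0<..1}) \<le> emeasure ?\<mu> (\<Union>n. A n)"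
        by (rule emeasure_mono) (auto simp: A_def C_def)
      also have "\<dots> = (SUP n. emeasure ?\<mu> (A n))"
      proof (rule SUP_emeasure_incseq[symmetric])
        show "range A \<subseteq> sets ?\<mu>" by (auto simp: A_def C_def)
        show "incseq A"
        proof (rule incseq_SucI, rule subsetI)
          fix n x assume "x \<in> A n"
          then obtain i where i: "i < 2 ^ n" "C n i \<subseteq> U" "x \<in> C n i" unfolding A_def J_def by blast
          \<comment> \<open>A cell is the union of two cells of the next grid, so the sets
            \<open>A n\<close> increase.\<close>
          have "C (Suc n) (2 * i) \<union> C (Suc n) (Suc (2 * i)) = C n i"
            using dyadic_refine[of n i] dyadic_refine[of n "Suc i"] Suc_le[of "Suc n" "2 * i"] Suc_le[of "Suc n" "Suc (2 * i)"]
            unfolding C_def by (auto simp del: dyadic_refine)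
          then have "x \<in> C (Suc n) (2 * i) \<and> C (Suc n) (2 * i) \<subseteq> U \<or>
              x \<in> C (Suc n) (Suc (2 * i)) \<and> C (Suc n) (Suc (2 * i)) \<subseteq> U"
            using i(2,3) by blast
          moreover have "2 * i < 2 ^ Suc n" "Suc (2 * i) < 2 ^ Suc n" using i(1) by auto
          ultimately show "x \<in> A (Suc n)" unfolding A_def J_def by blast
        qed
      qed
      also have "\<dots> \<le> ennreal e" by (rule SUP_least) (rule em)
      finally show ?thesis .
    qed
    then show ?thesis using d0 by blast
  qed
  show ?thesis
    unfolding absolutely_continuous_def
  proof
    fix N :: "real set" assume "N \<in> null_sets lborel"
    then have N: "N \<in> sets borel" "emeasure lborel N = 0" by auto
    have "emeasure ?\<mu> (N \<inter> {0<..1}) \<le> 0 + ennreal e" if e: "e > 0" for e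
    proof -
      obtain d where d: "d > 0" "\<forall>U. open U \<longrightarrow> emeasure lborel U < ennreal d \<longrightarrow> emeasure ?\<mu> (U \<inter> {0<..1}) \<le> ennreal e"
        using small[OF e] by (elim exE conjE)
      obtain U where U: "open U" "N \<subseteq> U" "emeasure lborel (U - N) < d"
        using outer_regular_lborel[OF N(1) d(1)] .
      have "emeasure lborel U = emeasure lborel ((U - N) \<union> N)" using U(2) by (simp add: Un_absorb2)
      also have "\<dots> \<le> emeasure lborel (U - N) + emeasure lborel N"
        by (rule emeasure_subadditive) (use U N in auto)
      finally have "emeasure lborel U < d" using U(3) N(2) by simp
      then have "emeasure ?\<mu> (U \<inter> {0<..1}) \<le> ennreal e" using d(2) U(1) by simp
      moreover have "emeasure ?\<mu> (N \<inter> {0<..1}) \<le> emeasure ?\<mu> (U \<inter> {0<..1})"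
        by (rule emeasure_mono) (use U N in auto)
      ultimately show ?thesis by simp
    qed
    then have "emeasure ?\<mu> (N \<inter> {0<..1}) \<le> 0" by (rule ennreal_le_epsilon)
    then have "emeasure ?\<mu> (N \<inter> {0<..1}) = 0" by simp
    then have "N \<inter> {0<..1} \<in> null_sets ?\<mu>" using N(1) by (intro null_setsI) simp_all
    then have "({..0} \<union> {1<..}) \<union> (N \<inter> {0<..1}) \<in> null_sets ?\<mu>" by (intro null_sets.Un neg pos)
    moreover have "N \<in> sets ?\<mu>" using N(1) by simp
    moreover have "N \<subseteq> ({..0} \<union> {1<..}) \<union> (N \<inter> {0<..1})"
    proof
      fix x assume "x \<in> N"
      then show "x \<in> ({..0} \<union> {1<..}) \<union> (N \<inter> {0<..1})" by (cases "x \<le> 0"; cases "x \<le> 1") simp_all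
    qed
    ultimately show "N \<in> null_sets ?\<mu>" by (rule null_sets_subset)
  qed
qed

text \<open>Extended by constants, \<open>F\<close> is the distribution function of a measure that
  is absolutely continuous by the preceding lemma; its Radon-Nikodym density, cut to (0,1], is the
  wanted \<open>g\<close>.\<close>

lemma monotone_absolutely_continuous_density:
  fixes F :: "real \<Rightarrow> real"
  assumes mono: "\<And>s t. 0 \<le> s \<Longrightarrow> s \<le> t \<Longrightarrow> t \<le> 1 \<Longrightarrow> F s \<le> F t"
    and ac: "\<And>e. e > 0 \<Longrightarrow> \<exists>d>0. \<forall>(I :: nat set) u v. finite I \<longrightarrow> (\<forall>i\<in>I. 0 \<le> u i \<and> u i \<le> v i \<and> v i \<le> 1) \<longrightarrow>
       disjoint_family_on (\<lambda>i. {u i<..<v i}) I \<longrightarrow> (\<Sum>i\<in>I. v i - u i) < d \<longrightarrow>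
       (\<Sum>i\<in>I. F (v i) - F (u i)) \<le> e"
  obtains g :: "real \<Rightarrow> real" where "integrable lborel g"
    "\<And>s t. 0 \<le> s \<Longrightarrow> s \<le> t \<Longrightarrow> t \<le> 1 \<Longrightarrow> F t - F s = (LINT x:{s..t}|lborel. g x)"
proof -
  define G where "G x = F (max 0 (min 1 x))" for x
  have mG: "G s \<le> G t" if "s \<le> t" for s t unfolding G_def using that by (intro mono) auto
  have cG: "continuous (at_right x) G" for x
    unfolding continuous_within
  proof (rule tendstoI)
    fix e :: real assume "e > 0"
    then have "e / 2 > 0" by simp
    from ac[OF this] obtain d where d: "d > 0" "\<forall>(I :: nat set) u v. finite I \<longrightarrow> (\<forall>i\<in>I. 0 \<le> u i \<and> u i \<le> v i \<and> v i \<le> 1) \<longrightarrow>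
       disjoint_family_on (\<lambda>i. {u i<..<v i}) I \<longrightarrow> (\<Sum>i\<in>I. v i - u i) < d \<longrightarrow>
       (\<Sum>i\<in>I. F (v i) - F (u i)) \<le> e / 2" by (elim exE conjE)
    have "dist (G y) (G x) < e" if y: "x < y" "y < x + d" for y
    proof -
      have "(\<Sum>i\<in>{0::nat}. F (max 0 (min 1 y)) - F (max 0 (min 1 x))) \<le> e / 2"
        by (rule d(2)[rule_format]) (use y d(1) in \<open>auto simp: disjoint_family_on_def\<close>)
      then show ?thesis using mG[of x y] y \<open>e > 0\<close> by (simp add: dist_real_def G_def)
    qed
    then show "\<forall>\<^sub>F y in at_right x. dist (G y) (G x) < e"
      unfolding eventually_at_right_field using d(1) by (intro exI[of _ "x + d"]) auto
  qed
  have ac': "absolutely_continuous lborel (interval_measure G)"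
  proof (rule absolutely_continuous_interval_measure[OF mG cG])
    fix e :: real assume "e > 0"
    from ac[OF this] obtain d where d: "d > 0" "\<forall>(I :: nat set) u v. finite I \<longrightarrow> (\<forall>i\<in>I. 0 \<le> u i \<and> u i \<le> v i \<and> v i \<le> 1) \<longrightarrow>
       disjoint_family_on (\<lambda>i. {u i<..<v i}) I \<longrightarrow> (\<Sum>i\<in>I. v i - u i) < d \<longrightarrow>
       (\<Sum>i\<in>I. F (v i) - F (u i)) \<le> e" by (elim exE conjE)
    show "\<exists>d>0. \<forall>(I :: nat set) u v. finite I \<longrightarrow> (\<forall>i\<in>I. 0 \<le> u i \<and> u i \<le> v i \<and> v i \<le> 1) \<longrightarrow>
       disjoint_family_on (\<lambda>i. {u i<..<v i}) I \<longrightarrow> (\<Sum>i\<in>I. v i - u i) < d \<longrightarrow>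
       (\<Sum>i\<in>I. G (v i) - G (u i)) \<le> e"
    proof (intro exI[of _ d] conjI d(1) allI impI)
      fix I :: "nat set" and u v
      assume I: "finite I" "\<forall>i\<in>I. 0 \<le> u i \<and> u i \<le> v i \<and> v i \<le> 1"
        "disjoint_family_on (\<lambda>i. {u i<..<v i}) I" "(\<Sum>i\<in>I. v i - u i) < d"
      have "(\<Sum>i\<in>I. G (v i) - G (u i)) = (\<Sum>i\<in>I. F (v i) - F (u i))"
      proof (rule sum.cong[OF refl])
        fix i assume "i \<in> I"
        then have "0 \<le> u i" "u i \<le> v i" "v i \<le> 1" using I(2) by auto
        then show "G (v i) - G (u i) = F (v i) - F (u i)" by (simp add: G_def)
      qed
      then show "(\<Sum>i\<in>I. G (v i) - G (u i)) \<le> e" using d(2)[rule_format, OF I(1) _ I(3,4)] I(2) by simp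
    qed
  qed (simp_all add: G_def)
  obtain f where f: "f \<in> borel_measurable lborel" "density lborel f = interval_measure G"
    using sigma_finite_measure.Radon_Nikodym[OF lborel.sigma_finite_measure_axioms ac'] by auto
  have fm[measurable]: "f \<in> borel_measurable borel" using f(1) by simp
  have Ioc: "(\<integral>\<^sup>+x. f x * indicator {s<..t} x \<partial>lborel) = ennreal (G t - G s)" if "s \<le> t" for s t
  proof -
    have "(\<integral>\<^sup>+x. f x * indicator {s<..t} x \<partial>lborel) = emeasure (density lborel f) {s<..t}"
      by (simp add: emeasure_density)
    then show ?thesis using emeasure_interval_measure_Ioc[OF that mG cG] f(2) by simp
  qed
  have tot: "(\<integral>\<^sup>+x. f x * indicator {0<..1} x \<partial>lborel) < \<infinity>" using Ioc[of 0 1] by simp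
  \<comment> \<open>\<open>enn2real\<close> loses nothing almost everywhere: the density has total
    mass \<open>F 1 - F 0\<close> on (0,1], so it is finite off a null set.\<close>
  define g where "g x = enn2real (f x * indicator {0<..1} x)" for x
  have fin: "AE x in lborel. f x * indicator {0<..1} x \<noteq> \<infinity>"
    by (rule nn_integral_noteq_infinite) (use tot in auto)
  have gi: "integrable lborel g"
  proof (rule integrableI_bounded)
    have "(\<integral>\<^sup>+x. ennreal (norm (g x)) \<partial>lborel) = (\<integral>\<^sup>+x. f x * indicator {0<..1} x \<partial>lborel)"
      by (rule nn_integral_cong_AE) (use fin in eventually_elim, auto simp: g_def less_top)
    then show "(\<integral>\<^sup>+x. ennreal (norm (g x)) \<partial>lborel) < \<infinity>" using tot by simp
  qed (unfold g_def, measurable)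
  show ?thesis
  proof (rule that[OF gi])
    fix s t :: real assume st: "0 \<le> s" "s \<le> t" "t \<le> 1"
    have "(LINT x:{s..t}|lborel. g x) = (LINT x:{s<..t}|lborel. g x)"
      unfolding set_lebesgue_integral_def
    proof (rule integral_cong_AE)
      show "AE x in lborel. indicator {s..t} x *\<^sub>R g x = indicator {s<..t} x *\<^sub>R g x"
        using AE_lborel_singleton[of s] by eventually_elim (auto simp: indicator_def)
    qed (use gi in auto)
    also have "\<dots> = enn2real (\<integral>\<^sup>+x. ennreal (indicator {s<..t} x *\<^sub>R g x) \<partial>lborel)"
      unfolding set_lebesgue_integral_def
      by (rule integral_eq_nn_integral) (use gi in \<open>auto simp: g_def\<close>)
    also have "(\<integral>\<^sup>+x. ennreal (indicator {s<..t} x *\<^sub>R g x) \<partial>lborel) = (\<integral>\<^sup>+x. f x * indicator {s<..t} x \<partial>lborel)"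
      by (rule nn_integral_cong_AE, use fin in eventually_elim)
         (use st in \<open>auto simp: g_def less_top indicator_def split: if_splits\<close>)
    also have "\<dots> = ennreal (F t - F s)" using Ioc[of s t] st by (simp add: G_def)
    finally show "F t - F s = (LINT x:{s..t}|lborel. g x)" using mono[OF st] by simp
  qed
qed

section \<open>Lebesgue differentiation\<close>

lemma null_set_lborel_uminus:
  assumes "N \<in> null_sets (lborel :: real measure)"
  shows "uminus -` N \<in> null_sets (lborel :: real measure)"
proof -
  have N: "N \<in> sets borel" using assms by auto
  have "emeasure lborel (uminus -` N) = emeasure (distr lborel borel uminus) N"
    using N by (simp add: emeasure_distr)
  also have "\<dots> = 0" using assms by (simp add: lborel_distr_uminus null_sets_def)
  finally show ?thesis using N measurable_sets_borel[of uminus borel N] by (simp add: null_sets_def)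
qed

lemma lebesgue_differentiation_right:
  fixes g :: "real \<Rightarrow> real"
  assumes "integrable lborel g"
  obtains N where "N \<in> null_sets lborel"
    "\<And>x e. x \<notin> N \<Longrightarrow> 0 < e \<Longrightarrow> \<exists>d>0. \<forall>h. 0 < h \<and> h < d \<longrightarrow> \<bar>(LINT y:{x..x + h}|lborel. g y) / h - g x\<bar> < e"
proof -
  have si: "set_integrable lborel {a..b} g" for a b
    unfolding set_integrable_def using assms by (intro integrable_mult_indicator) auto
  have "g integrable_on cbox a b" for a b
    using set_borel_integral_eq_integral(1)[OF si[of a b]] by simp
  from integrable_ccontinuous_explicit[OF this] obtain N where N: "negligible N"
    "\<And>x e. x \<notin> N \<Longrightarrow> 0 < e \<Longrightarrow> \<exists>d>0. \<forall>h. 0 < h \<and> h < d \<longrightarrow>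
        norm (integral (cbox x (x + h *\<^sub>R One)) g /\<^sub>R h ^ DIM(real) - g x) < e" by blast
  \<comment> \<open>The exceptional set is only negligible; statements about \<open>lborel\<close>
    need a Borel null set around it.\<close>
  obtain N' where N': "N' \<in> null_sets lborel" "N \<subseteq> N'"
    using N(1) by (auto simp: negligible_iff_null_sets null_sets_completion_iff2)
  show ?thesis
  proof (rule that[OF N'(1)])
    fix x e :: real assume "x \<notin> N'" "0 < e"
    then obtain d where d: "d > 0" "\<forall>h. 0 < h \<and> h < d \<longrightarrow>
        norm (integral (cbox x (x + h *\<^sub>R One)) g /\<^sub>R h ^ DIM(real) - g x) < e"
      using N(2)[of x e] N'(2) by blast
    show "\<exists>d>0. \<forall>h. 0 < h \<and> h < d \<longrightarrow> \<bar>(LINT y:{x..x + h}|lborel. g y) / h - g x\<bar> < e"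
      using d set_borel_integral_eq_integral(2)[OF si]
      by (intro exI[of _ d]) (simp add: divide_inverse mult.commute)
  qed
qed

text \<open>The averages in \<open>lebesgue_differentiation_right\<close> extend to the right of the
  point only. Left averages at \<open>t\<close> are right averages at \<open>- t\<close> of the
  reflected density.\<close>

lemma lebesgue_differentiation:
  fixes g f :: "real \<Rightarrow> real"
  assumes g: "integrable lborel g"
    and f: "\<And>s t. 0 \<le> s \<Longrightarrow> s \<le> t \<Longrightarrow> t \<le> 1 \<Longrightarrow> f t - f s = (LINT x:{s..t}|lborel. g x)"
  shows "AE t in lborel. t \<in> {0<..<1} \<longrightarrow> (f has_real_derivative g t) (at t)"
proof -
  obtain N where N: "N \<in> null_sets lborel"
    "\<And>x e. x \<notin> N \<Longrightarrow> 0 < e \<Longrightarrow> \<exists>d>0. \<forall>h. 0 < h \<and> h < d \<longrightarrow> \<bar>(LINT y:{x..x + h}|lborel. g y) / h - g x\<bar> < e"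
    using lebesgue_differentiation_right[OF g] by blast
  have g': "integrable lborel (\<lambda>x. g (- x))"
    using lborel_integrable_real_affine[OF g, of "-1" 0] by simp
  obtain N' where N': "N' \<in> null_sets lborel"
    "\<And>x e. x \<notin> N' \<Longrightarrow> 0 < e \<Longrightarrow> \<exists>d>0. \<forall>h. 0 < h \<and> h < d \<longrightarrow> \<bar>(LINT y:{x..x + h}|lborel. g (- y)) / h - g (- x)\<bar> < e"
    using lebesgue_differentiation_right[OF g'] by blast
  have refl: "(LINT y:{- t..- t + h}|lborel. g (- y)) = (LINT y:{t - h..t}|lborel. g y)" for t h
  proof -
    have "(LINT y:{t - h..t}|lborel. g y) = (\<integral>y. indicator {t - h..t} (0 + (-1) * y) * g (0 + (-1) * y) \<partial>lborel)"
      unfolding set_lebesgue_integral_def using lborel_integral_real_affine[of "-1" "\<lambda>y. indicator {t - h..t} y * g y" 0]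
      by simp
    also have "\<dots> = (LINT y:{- t..- t + h}|lborel. g (- y))"
      unfolding set_lebesgue_integral_def by (intro Bochner_Integration.integral_cong) (auto simp: indicator_def)
    finally show ?thesis by simp
  qed
  have "(f has_real_derivative g t) (at t)" if t: "t \<in> {0<..<1}" "t \<notin> N" "t \<notin> uminus -` N'" for t
    unfolding DERIV_def
  proof (rule LIM_I)
    fix e :: real assume e: "0 < e"
    obtain d1 where d1: "d1 > 0" "\<forall>h. 0 < h \<and> h < d1 \<longrightarrow> \<bar>(LINT y:{t..t + h}|lborel. g y) / h - g t\<bar> < e"
      using N(2)[OF t(2) e] by blast
    have "- t \<notin> N'" using t(3) by simp
    from N'(2)[OF this e] obtain d2 where d2: "d2 > 0"
      "\<forall>h. 0 < h \<and> h < d2 \<longrightarrow> \<bar>(LINT y:{t - h..t}|lborel. g y) / h - g t\<bar> < e"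
      unfolding refl by auto
    define d where "d = min (min d1 d2) (min t (1 - t))"
    have d: "d > 0" using d1(1) d2(1) t(1) by (auto simp: d_def)
    show "\<exists>s>0. \<forall>x. x \<noteq> 0 \<and> norm (x - 0) < s \<longrightarrow> norm ((f (t + x) - f t) / x - g t) < e"
    proof (intro exI[of _ d] conjI d allI impI)
      fix h :: real assume h: "h \<noteq> 0 \<and> norm (h - 0) < d"
      show "norm ((f (t + h) - f t) / h - g t) < e"
      proof (cases "h > 0")
        case True
        have "f (t + h) - f t = (LINT x:{t..t + h}|lborel. g x)"
          by (rule f) (use True h t in \<open>auto simp: d_def\<close>)
        then show ?thesis using d1(2) True h by (simp add: d_def)
      next
        case False
        then have hn: "h < 0" using h by simp
        have "f t - f (t - (- h)) = (LINT x:{t - (- h)..t}|lborel. g x)"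
          by (rule f) (use hn h t in \<open>auto simp: d_def\<close>)
        then have "(f (t + h) - f t) / h = (LINT x:{t - (- h)..t}|lborel. g x) / (- h)"
          using hn by (simp add: field_simps)
        moreover have "\<bar>(LINT y:{t - (- h)..t}|lborel. g y) / (- h) - g t\<bar> < e"
          using d2(2)[rule_format, of "- h"] hn h by (simp add: d_def)
        ultimately show ?thesis by simp
      qed
    qed
  qed
  moreover have "AE t in lborel. t \<notin> N \<and> t \<notin> uminus -` N'"
    using AE_not_in[OF N(1)] AE_not_in[OF null_set_lborel_uminus[OF N'(1)]] by auto
  ultimately show ?thesis by auto
qed

text \<open>\<open>f\<close> is the difference of its majorant \<open>V\<close> and of
  \<open>V - f\<close>. Both are increasing because increments of \<open>f\<close> are dominated by
  those of \<open>V\<close>, and \<open>V - f\<close> inherits the absolute continuity of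
  \<open>V\<close> at the price of a factor 2.\<close>

theorem absolutely_continuous_fun_FTC:
  assumes ac: "absolutely_continuous_fun 0 1 f"
  obtains g where "integrable lborel g"
    "\<And>s t. 0 \<le> s \<Longrightarrow> s \<le> t \<Longrightarrow> t \<le> 1 \<Longrightarrow> f t - f s = (LINT x:{s..t}|lborel. g x)"
    "AE t in lborel. t \<in> {0<..<1} \<longrightarrow> (f has_real_derivative g t) (at t)"
proof -
  obtain V where V: "\<And>s t. 0 \<le> s \<Longrightarrow> s \<le> t \<Longrightarrow> t \<le> 1 \<Longrightarrow> \<bar>f t - f s\<bar> \<le> V t - V s"
    and Vac: "\<And>e. e > 0 \<Longrightarrow> \<exists>d>0. \<forall>(I :: nat set) u v. finite I \<longrightarrow> (\<forall>i\<in>I. 0 \<le> u i \<and> u i \<le> v i \<and> v i \<le> 1) \<longrightarrow>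
       disjoint_family_on (\<lambda>i. {u i<..<v i}) I \<longrightarrow> (\<Sum>i\<in>I. v i - u i) < d \<longrightarrow>
       (\<Sum>i\<in>I. V (v i) - V (u i)) \<le> e"
    using monotone_majorant[OF ac] by blast
  have V_mono: "V s \<le> V t" if "0 \<le> s" "s \<le> t" "t \<le> 1" for s t using V[OF that] by linarith
  obtain g1 where g1: "integrable lborel g1"
    "\<And>s t. 0 \<le> s \<Longrightarrow> s \<le> t \<Longrightarrow> t \<le> 1 \<Longrightarrow> V t - V s = (LINT x:{s..t}|lborel. g1 x)"
    using monotone_absolutely_continuous_density[OF V_mono Vac] by blast
  have W_mono: "V s - f s \<le> V t - f t" if "0 \<le> s" "s \<le> t" "t \<le> 1" for s t using V[OF that] by linarith
  have Wac: "\<exists>d>0. \<forall>(I :: nat set) u v. finite I \<longrightarrow> (\<forall>i\<in>I. 0 \<le> u i \<and> u i \<le> v i \<and> v i \<le> 1) \<longrightarrow>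
       disjoint_family_on (\<lambda>i. {u i<..<v i}) I \<longrightarrow> (\<Sum>i\<in>I. v i - u i) < d \<longrightarrow>
       (\<Sum>i\<in>I. (V (v i) - f (v i)) - (V (u i) - f (u i))) \<le> e" if "e > 0" for e
  proof -
    have "e / 2 > 0" using that by simp
    from Vac[OF this] obtain d where d: "d > 0" "\<forall>(I :: nat set) u v. finite I \<longrightarrow> (\<forall>i\<in>I. 0 \<le> u i \<and> u i \<le> v i \<and> v i \<le> 1) \<longrightarrow>
       disjoint_family_on (\<lambda>i. {u i<..<v i}) I \<longrightarrow> (\<Sum>i\<in>I. v i - u i) < d \<longrightarrow>
       (\<Sum>i\<in>I. V (v i) - V (u i)) \<le> e / 2" by (elim exE conjE)
    show ?thesis
    proof (intro exI[of _ d] conjI d(1) allI impI)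
      fix I :: "nat set" and u v
      assume I: "finite I" "\<forall>i\<in>I. 0 \<le> u i \<and> u i \<le> v i \<and> v i \<le> 1"
        "disjoint_family_on (\<lambda>i. {u i<..<v i}) I" "(\<Sum>i\<in>I. v i - u i) < d"
      have "(\<Sum>i\<in>I. (V (v i) - f (v i)) - (V (u i) - f (u i))) \<le> (\<Sum>i\<in>I. 2 * (V (v i) - V (u i)))"
      proof (rule sum_mono)
        fix i assume "i \<in> I"
        then have "\<bar>f (v i) - f (u i)\<bar> \<le> V (v i) - V (u i)" using I(2) by (intro V) auto
        then have "f (u i) - f (v i) \<le> V (v i) - V (u i)" by (simp add: abs_le_iff)
        then show "(V (v i) - f (v i)) - (V (u i) - f (u i)) \<le> 2 * (V (v i) - V (u i))"
          by (simp add: algebra_simps)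
      qed
      also have "\<dots> = 2 * (\<Sum>i\<in>I. V (v i) - V (u i))" by (simp add: sum_distrib_left)
      also have "\<dots> \<le> e" using d(2)[rule_format, OF I(1) _ I(3,4)] I(2) by simp
      finally show "(\<Sum>i\<in>I. (V (v i) - f (v i)) - (V (u i) - f (u i))) \<le> e" .
    qed
  qed
  obtain g2 where g2: "integrable lborel g2"
    "\<And>s t. 0 \<le> s \<Longrightarrow> s \<le> t \<Longrightarrow> t \<le> 1 \<Longrightarrow> (V t - f t) - (V s - f s) = (LINT x:{s..t}|lborel. g2 x)"
    using monotone_absolutely_continuous_density[OF W_mono Wac] by blast
  have gi: "integrable lborel (\<lambda>x. g1 x - g2 x)" using g1(1) g2(1) by simp
  have fg: "f t - f s = (LINT x:{s..t}|lborel. g1 x - g2 x)" if "0 \<le> s" "s \<le> t" "t \<le> 1" for s t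
  proof -
    have "set_integrable lborel {s..t} g1"
      unfolding set_integrable_def by (rule integrable_mult_indicator[OF _ g1(1)]) simp
    moreover have "set_integrable lborel {s..t} g2"
      unfolding set_integrable_def by (rule integrable_mult_indicator[OF _ g2(1)]) simp
    ultimately show ?thesis using g1(2)[OF that] g2(2)[OF that] by (simp add: set_integral_diff)
  qed
  show ?thesis by (rule that[OF gi fg lebesgue_differentiation[OF gi fg]])
qed

section \<open>Exponential moments of the Levy measure\<close>

text \<open>The left side is the sum of the absolute Taylor terms from order two on, the right side
  is twice what \<open>holomorphic_exponential_integral\<close> takes to be integrable. They differ
  by \<open>exp (- \<bar>u\<bar>) - 1 + \<bar>u\<bar>\<close>.\<close>

lemma exp_taylor2_abs_le: "exp \<bar>u\<bar> - 1 - \<bar>u\<bar> \<le> 2 * (cosh u - 1)" for u :: real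
proof -
  have "cosh u = cosh \<bar>u\<bar>" by simp
  moreover have "1 + (- \<bar>u\<bar>) \<le> exp (- \<bar>u\<bar>)" by (rule exp_ge_add_one_self)
  ultimately show ?thesis by (simp add: cosh_def)
qed

text \<open>The coefficients of the power series are the moments of \<open>Y\<close> under \<open>N\<close>.\<close>

lemma holomorphic_exponential_integral:
  fixes N :: "'b measure" and Y :: "'b \<Rightarrow> real"
  assumes Y [measurable]: "Y \<in> borel_measurable N"
    and fin: "\<And>\<theta>. (\<integral>\<^sup>+x. ennreal (cosh (\<theta> * Y x) - 1) \<partial>N) < \<infinity>"
  shows "(\<lambda>z. \<integral>x. exp (z * of_real (Y x)) - 1 - z * of_real (Y x) \<partial>N) holomorphic_on UNIV" (is "?g holomorphic_on _")
    and "\<And>z :: complex. integrable N (\<lambda>x. exp (z * of_real (Y x)) - 1 - z * of_real (Y x))"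
proof -
  \<comment> \<open>The series starts at order two because \<open>N\<close> may be an infinite
    measure such as \<open>\<nu>\<close>, for which neither constants nor \<open>Y\<close> need be
    integrable.\<close>
  define a where "a k x = (of_real (Y x) :: complex) ^ (k + 2) / fact (k + 2)" for k x
  have sums: "(\<lambda>k. a k x * z ^ (k + 2)) sums (exp (z * of_real (Y x)) - 1 - z * of_real (Y x))" for x z
  proof -
    have "(\<lambda>k. (z * of_real (Y x)) ^ k / fact k) sums exp (z * of_real (Y x))"
      using exp_converges[of "z * of_real (Y x)"] by (simp add: scaleR_conv_of_real field_simps)
    from sums_split_initial_segment[OF this, of 2] show ?thesis
      by (simp add: a_def power_mult_distrib mult.commute numeral_2_eq_2 algebra_simps)
  qed
  have nsums: "(\<lambda>k. norm (a k x * z ^ (k + 2))) sums (exp \<bar>cmod z * Y x\<bar> - 1 - \<bar>cmod z * Y x\<bar>)" for x z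
  proof -
    let ?u = "\<bar>cmod z * Y x\<bar>"
    have "(\<lambda>k. ?u ^ k / fact k) sums exp ?u"
      using exp_converges[of ?u] by (simp add: field_simps)
    from sums_split_initial_segment[OF this, of 2]
    have "(\<lambda>k. ?u ^ (k + 2) / fact (k + 2)) sums (exp ?u - 1 - ?u)"
      by (simp add: numeral_2_eq_2 algebra_simps)
    moreover have "norm (a k x * z ^ (k + 2)) = ?u ^ (k + 2) / fact (k + 2)" for k
      unfolding a_def norm_mult norm_divide norm_power
      by (simp add: abs_mult power_mult_distrib del: power_Suc fact_Suc)
    ultimately show ?thesis by simp
  qed
  have am[measurable]: "a k \<in> borel_measurable N" for k unfolding a_def by measurable
  \<comment> \<open>One bound for the absolute terms gives both the integrability of every
    coefficient and the exchange of sum and integral.\<close>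
  have tot: "(\<integral>\<^sup>+x. (\<Sum>k. ennreal (norm (a k x * z ^ (k + 2)))) \<partial>N) < \<infinity>" for z
  proof -
    have "(\<integral>\<^sup>+x. (\<Sum>k. ennreal (norm (a k x * z ^ (k + 2)))) \<partial>N)
      \<le> (\<integral>\<^sup>+x. 2 * ennreal (cosh (cmod z * Y x) - 1) \<partial>N)"
    proof (rule nn_integral_mono)
      fix x
      have "(\<Sum>k. ennreal (norm (a k x * z ^ (k + 2)))) = ennreal (\<Sum>k. norm (a k x * z ^ (k + 2)))"
        by (rule suminf_ennreal2) (use nsums sums_summable in auto)
      also have "\<dots> = ennreal (exp \<bar>cmod z * Y x\<bar> - 1 - \<bar>cmod z * Y x\<bar>)"
        using sums_unique[OF nsums] by simp
      also have "\<dots> \<le> ennreal (2 * (cosh (cmod z * Y x) - 1))"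
        by (rule ennreal_leI) (rule exp_taylor2_abs_le)
      also have "\<dots> = 2 * ennreal (cosh (cmod z * Y x) - 1)"
        by (subst ennreal_mult) (auto simp: cosh_real_ge_1)
      finally show "(\<Sum>k. ennreal (norm (a k x * z ^ (k + 2)))) \<le> 2 * ennreal (cosh (cmod z * Y x) - 1)" .
    qed
    also have "\<dots> = 2 * (\<integral>\<^sup>+x. ennreal (cosh (cmod z * Y x) - 1) \<partial>N)"
      by (rule nn_integral_cmult) (auto simp: cosh_def)
    also have "\<dots> < \<infinity>" using fin[of "cmod z"] by (simp add: ennreal_mult_less_top)
    finally show ?thesis .
  qed
  have tot': "(\<Sum>k. \<integral>\<^sup>+x. ennreal (norm (a k x * z ^ (k + 2))) \<partial>N) < \<infinity>" for z
    using tot[of z] by (subst nn_integral_suminf[symmetric]) auto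
  have int: "integrable N (\<lambda>x. a k x * z ^ (k + 2))" for k z
  proof (rule integrableI_bounded)
    have "(\<integral>\<^sup>+x. ennreal (norm (a k x * z ^ (k + 2))) \<partial>N) \<le> (\<Sum>k. \<integral>\<^sup>+x. ennreal (norm (a k x * z ^ (k + 2))) \<partial>N)"
      using sum_le_suminf[of "\<lambda>k. \<integral>\<^sup>+x. ennreal (norm (a k x * z ^ (k + 2))) \<partial>N" "{k}"] by simp
    then show "(\<integral>\<^sup>+x. ennreal (norm (a k x * z ^ (k + 2))) \<partial>N) < \<infinity>" using tot'[of z] by (rule le_less_trans)
  qed simp
  have summ: "summable (\<lambda>k. \<integral>x. norm (a k x * z ^ (k + 2)) \<partial>N)" for z
  proof (rule summable_suminf_not_top)
    have "(\<Sum>k. ennreal (\<integral>x. norm (a k x * z ^ (k + 2)) \<partial>N)) = (\<Sum>k. \<integral>\<^sup>+x. ennreal (norm (a k x * z ^ (k + 2))) \<partial>N)"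
      by (intro suminf_cong nn_integral_eq_integral[symmetric] integrable_norm int) auto
    then show "(\<Sum>k. ennreal (\<integral>x. norm (a k x * z ^ (k + 2)) \<partial>N)) \<noteq> \<top>" using tot'[of z] by (simp add: less_top)
  qed (simp add: integral_nonneg_AE)
  have *: "integrable N (\<lambda>x. \<Sum>k. a k x * z ^ (k + 2))"
    "(\<lambda>k. \<integral>x. a k x * z ^ (k + 2) \<partial>N) sums (\<integral>x. (\<Sum>k. a k x * z ^ (k + 2)) \<partial>N)" for z
  proof -
    have s: "AE x in N. summable (\<lambda>k. norm (a k x * z ^ (k + 2)))"
      by (rule AE_I2) (rule sums_summable[OF nsums])
    show "integrable N (\<lambda>x. \<Sum>k. a k x * z ^ (k + 2))" by (rule integrable_suminf[OF int s summ])
    show "(\<lambda>k. \<integral>x. a k x * z ^ (k + 2) \<partial>N) sums (\<integral>x. (\<Sum>k. a k x * z ^ (k + 2)) \<partial>N)"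
      by (rule sums_integral[OF int s summ])
  qed
  have eq: "(\<Sum>k. a k x * z ^ (k + 2)) = exp (z * of_real (Y x)) - 1 - z * of_real (Y x)" for x z
    using sums_unique[OF sums] by simp
  show "\<And>z :: complex. integrable N (\<lambda>x. exp (z * of_real (Y x)) - 1 - z * of_real (Y x))"
    using *(1) unfolding eq .
  \<comment> \<open>Two vanishing coefficients in front turn the shifted series into a power series
    in \<open>z\<close>.\<close>
  have ps: "(\<lambda>k. (if k < 2 then 0 else \<integral>x. a (k - 2) x \<partial>N) * (z - 0) ^ k) sums ?g z" for z
  proof -
    have "(\<lambda>k. (\<integral>x. a k x \<partial>N) * z ^ (k + 2)) sums ?g z"
      using *(2)[of z] unfolding eq by simp
    then show ?thesis
      using sums_iff_shift'[of "\<lambda>k. (if k < 2 then 0 else \<integral>x. a (k - 2) x \<partial>N) * (z - 0) ^ k" 2]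
      by (simp add: numeral_2_eq_2)
  qed
  have "?g holomorphic_on ball 0 r" for r
    using ps by (rule power_series_holomorphic)
  then have "?g holomorphic_on (\<Union>n::nat. ball 0 (real n))"
    by (intro holomorphic_on_UN_open) auto
  moreover have "(\<Union>n::nat. ball (0::complex) (real n)) = UNIV"
    using reals_Archimedean2 by (auto simp: set_eq_iff)
  ultimately show "?g holomorphic_on UNIV" by simp
qed

section \<open>Exponential moments of the process\<close>

context levy_process
begin

lemma nn_integral_increment:
  assumes f [measurable]: "f \<in> borel_measurable borel" and "s \<ge> 0" "h \<ge> 0"
  shows "(\<integral>\<^sup>+\<omega>. f (L (s + h) \<omega> - L s \<omega>) \<partial>M) = (\<integral>\<^sup>+\<omega>. f (L h \<omega>) \<partial>M)"
proof -
  have [measurable]: "L (s + h) \<in> borel_measurable M" "L s \<in> borel_measurable M"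
    "L h \<in> borel_measurable M" "L 0 \<in> borel_measurable M"
    using assms by (auto intro!: random_variable_L)
  have "(\<integral>\<^sup>+\<omega>. f (L (s + h) \<omega> - L s \<omega>) \<partial>M) = (\<integral>\<^sup>+x. f x \<partial>distr M borel (\<lambda>\<omega>. L (s + h) \<omega> - L s \<omega>))"
    by (simp add: nn_integral_distr)
  also have "\<dots> = (\<integral>\<^sup>+x. f x \<partial>distr M borel (\<lambda>\<omega>. L h \<omega> - L 0 \<omega>))"
    by (simp only: stationary_increments[OF assms(2,3)])
  also have "\<dots> = (\<integral>\<^sup>+\<omega>. f (L h \<omega> - L 0 \<omega>) \<partial>M)" by (simp add: nn_integral_distr)
  also have "\<dots> = (\<integral>\<^sup>+\<omega>. f (L h \<omega>) \<partial>M)"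
    by (rule nn_integral_cong_AE) (use start_0 in eventually_elim, simp)
  finally show ?thesis .
qed

text \<open>Stated for \<open>ennreal\<close>-valued integrals, since finiteness at times other than
  1 is deduced from it.\<close>

lemma nn_mgf_add:
  assumes "s \<ge> 0" "h \<ge> 0"
  shows "(\<integral>\<^sup>+\<omega>. ennreal (exp (\<theta> * L (s + h) \<omega>)) \<partial>M) =
    (\<integral>\<^sup>+\<omega>. ennreal (exp (\<theta> * L s \<omega>)) \<partial>M) * (\<integral>\<^sup>+\<omega>. ennreal (exp (\<theta> * L h \<omega>)) \<partial>M)"
proof -
  define u where "u i = (if i = 0 then 0 else if i = 1 then s else s + h)" for i :: nat
  have "indep_vars (\<lambda>_. borel) (\<lambda>i \<omega>. L (u (Suc i)) \<omega> - L (u i) \<omega>) {..<2}"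
    by (rule independent_increments) (use assms in \<open>auto simp: u_def\<close>)
  then have "indep_vars (\<lambda>_. borel) (\<lambda>i \<omega>. ennreal (exp (\<theta> * (L (u (Suc i)) \<omega> - L (u i) \<omega>)))) {..<2}"
    by (rule indep_vars_compose2) auto
  then have "(\<integral>\<^sup>+\<omega>. (\<Prod>i<2. ennreal (exp (\<theta> * (L (u (Suc i)) \<omega> - L (u i) \<omega>)))) \<partial>M) =
      (\<Prod>i<2. \<integral>\<^sup>+\<omega>. ennreal (exp (\<theta> * (L (u (Suc i)) \<omega> - L (u i) \<omega>))) \<partial>M)"
    by (intro indep_vars_nn_integral) auto
  also have "\<dots> = (\<integral>\<^sup>+\<omega>. ennreal (exp (\<theta> * (L (0 + s) \<omega> - L 0 \<omega>))) \<partial>M) * (\<integral>\<^sup>+\<omega>. ennreal (exp (\<theta> * (L (s + h) \<omega> - L s \<omega>))) \<partial>M)"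
    by (simp add: u_def numeral_2_eq_2)
  also have "\<dots> = (\<integral>\<^sup>+\<omega>. ennreal (exp (\<theta> * L s \<omega>)) \<partial>M) * (\<integral>\<^sup>+\<omega>. ennreal (exp (\<theta> * L h \<omega>)) \<partial>M)"
    using nn_integral_increment[of "\<lambda>x. ennreal (exp (\<theta> * x))" 0 s] nn_integral_increment[of "\<lambda>x. ennreal (exp (\<theta> * x))" s h] assms
    by simp
  also have "(\<integral>\<^sup>+\<omega>. (\<Prod>i<2. ennreal (exp (\<theta> * (L (u (Suc i)) \<omega> - L (u i) \<omega>)))) \<partial>M) =
      (\<integral>\<^sup>+\<omega>. ennreal (exp (\<theta> * L (s + h) \<omega>)) \<partial>M)"
  proof (rule nn_integral_cong_AE, use start_0 in eventually_elim)
    case (elim \<omega>)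
    then show ?case
      by (simp add: u_def numeral_2_eq_2 flip: ennreal_mult exp_add) (simp add: algebra_simps)
  qed
  finally show ?thesis .
qed

lemma nn_mgf_mult:
  assumes "t \<ge> 0"
  shows "(\<integral>\<^sup>+\<omega>. ennreal (exp (\<theta> * L (real n * t) \<omega>)) \<partial>M) = (\<integral>\<^sup>+\<omega>. ennreal (exp (\<theta> * L t \<omega>)) \<partial>M) ^ n"
proof (induction n)
  case 0
  have "(\<integral>\<^sup>+\<omega>. ennreal (exp (\<theta> * L 0 \<omega>)) \<partial>M) = (\<integral>\<^sup>+\<omega>. 1 \<partial>M)"
    by (rule nn_integral_cong_AE) (use start_0 in eventually_elim, simp)
  then show ?case by (simp add: emeasure_space_1)
next
  case (Suc n)
  have "real (Suc n) * t = real n * t + t" by (simp add: algebra_simps)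
  then show ?case using nn_mgf_add[of "real n * t" t \<theta>] Suc assms by (simp add: mult.commute)
qed

end

locale exponential_levy_process = levy_process M L for M :: "'w measure" and L +
  fixes a \<sigma> :: real and \<nu> :: "real measure"
  assumes triplet: "has_levy_triplet M L a \<sigma> \<nu>"
    and exp_moments: "\<And>\<theta>. \<theta> \<ge> 0 \<Longrightarrow> (\<integral>\<^sup>+ \<omega>. ennreal (exp (\<theta> * \<bar>L 1 \<omega>\<bar>)) \<partial>M) < \<infinity>"
begin

definition nn_mgf :: "real \<Rightarrow> real \<Rightarrow> ennreal" where
  "nn_mgf \<theta> t = (\<integral>\<^sup>+\<omega>. ennreal (exp (\<theta> * L t \<omega>)) \<partial>M)"

lemma nn_mgf_pos:
  assumes "t \<ge> 0"
  shows "nn_mgf \<theta> t > 0"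
proof -
  have [measurable]: "L t \<in> borel_measurable M" by (rule random_variable_L[OF assms])
  have "nn_mgf \<theta> t \<noteq> 0"
  proof
    assume "nn_mgf \<theta> t = 0"
    then have "AE \<omega> in M. ennreal (exp (\<theta> * L t \<omega>)) = 0"
      unfolding nn_mgf_def by (subst (asm) nn_integral_0_iff_AE) auto
    then have "AE \<omega> in M. False" by simp
    then show False by simp
  qed
  then show ?thesis by (simp add: zero_less_iff_neq_zero)
qed

text \<open>For \<open>t \<le> n\<close> the moment generating functions at \<open>t\<close> and
  \<open>n - t\<close> multiply to a finite power of the one at time 1, and the second factor does
  not vanish.\<close>

lemma nn_mgf_finite:
  assumes t: "t \<ge> 0"
  shows "nn_mgf \<theta> t < \<infinity>"
proof -
  have 1: "nn_mgf \<theta> 1 < \<infinity>"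
  proof -
    have "nn_mgf \<theta> 1 \<le> (\<integral>\<^sup>+ \<omega>. ennreal (exp (\<bar>\<theta>\<bar> * \<bar>L 1 \<omega>\<bar>)) \<partial>M)"
      unfolding nn_mgf_def by (intro nn_integral_mono ennreal_leI) (simp flip: abs_mult)
    also have "\<dots> < \<infinity>" by (rule exp_moments) simp
    finally show ?thesis .
  qed
  obtain n :: nat where n: "t \<le> real n" using real_arch_simple by blast
  have "nn_mgf \<theta> t * nn_mgf \<theta> (real n - t) = nn_mgf \<theta> 1 ^ n"
    using nn_mgf_add[of t "real n - t" \<theta>] nn_mgf_mult[of 1 \<theta> n] n t by (simp add: nn_mgf_def)
  moreover have "nn_mgf \<theta> 1 ^ n < \<infinity>" using 1 by (simp add: power_less_top_ennreal)
  moreover have "nn_mgf \<theta> (real n - t) > 0" using n by (intro nn_mgf_pos) simp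
  ultimately have "nn_mgf \<theta> t * nn_mgf \<theta> (real n - t) \<noteq> \<top>" "nn_mgf \<theta> (real n - t) \<noteq> 0"
    by auto
  then have "nn_mgf \<theta> t \<noteq> \<top>" by (auto simp: ennreal_mult_eq_top_iff)
  then show ?thesis by (simp add: less_top)
qed

lemma nn_cosh_finite:
  assumes t: "t \<ge> 0"
  shows "(\<integral>\<^sup>+\<omega>. ennreal (cosh (\<theta> * L t \<omega>) - 1) \<partial>M) < \<infinity>"
proof -
  have [measurable]: "L t \<in> borel_measurable M" by (rule random_variable_L[OF t])
  have "(\<integral>\<^sup>+\<omega>. ennreal (cosh (\<theta> * L t \<omega>) - 1) \<partial>M) \<le>
      (\<integral>\<^sup>+\<omega>. ennreal (exp (\<theta> * L t \<omega>)) + ennreal (exp ((- \<theta>) * L t \<omega>)) \<partial>M)"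
  proof (rule nn_integral_mono)
    fix \<omega>
    have "cosh (\<theta> * L t \<omega>) - 1 = (exp (\<theta> * L t \<omega>) + exp ((- \<theta>) * L t \<omega>)) / 2 - 1"
      by (simp add: cosh_def)
    then have "cosh (\<theta> * L t \<omega>) - 1 \<le> exp (\<theta> * L t \<omega>) + exp ((- \<theta>) * L t \<omega>)"
    proof -
      have "x \<le> A + B" if "x = (A + B) / 2 - 1" "0 < A" "0 < B" for x A B :: real using that by argo
      from this[OF \<open>cosh (\<theta> * L t \<omega>) - 1 = (exp (\<theta> * L t \<omega>) + exp ((- \<theta>) * L t \<omega>)) / 2 - 1\<close>]
      show ?thesis by simp
    qed
    then show "ennreal (cosh (\<theta> * L t \<omega>) - 1) \<le> ennreal (exp (\<theta> * L t \<omega>)) + ennreal (exp ((- \<theta>) * L t \<omega>))"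
      by (simp add: ennreal_leI flip: ennreal_plus)
  qed
  also have "\<dots> = nn_mgf \<theta> t + nn_mgf (- \<theta>) t"
    unfolding nn_mgf_def by (intro nn_integral_add) auto
  also have "\<dots> < \<infinity>" using nn_mgf_finite[OF t] by (simp add: less_top)
  finally show ?thesis .
qed

lemma integrable_exp_L:
  assumes "t \<ge> 0"
  shows "integrable M (\<lambda>\<omega>. exp (\<theta> * L t \<omega>))"
proof (rule integrableI_bounded)
  show "(\<integral>\<^sup>+\<omega>. ennreal (norm (exp (\<theta> * L t \<omega>))) \<partial>M) < \<infinity>"
    using nn_mgf_finite[OF assms, of \<theta>] by (simp add: nn_mgf_def)
qed (use random_variable_L[OF assms] in measurable)

end

section \<open>Limits of integrals and second differences of characters\<close>

lemma nn_integral_le_limit: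
  fixes u :: "nat \<Rightarrow> 'b \<Rightarrow> ennreal"
  assumes "\<And>n. u n \<in> borel_measurable N" "\<And>n. (\<integral>\<^sup>+x. u n x \<partial>N) \<le> B" "\<And>x. (\<lambda>n. u n x) \<longlonglongrightarrow> f x"
  shows "(\<integral>\<^sup>+x. f x \<partial>N) \<le> B"
proof -
  have "(\<integral>\<^sup>+x. f x \<partial>N) = (\<integral>\<^sup>+x. liminf (\<lambda>n. u n x) \<partial>N)"
    by (intro nn_integral_cong lim_imp_Liminf[symmetric] assms) simp
  also have "\<dots> \<le> liminf (\<lambda>n. \<integral>\<^sup>+x. u n x \<partial>N)" by (rule nn_integral_liminf) (rule assms)
  also have "\<dots> \<le> B" by (rule Liminf_le) (auto intro!: always_eventually assms(2))
  finally show ?thesis .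
qed

lemma of_real_cos_iexp: "complex_of_real (cos r) = (iexp r + iexp (- r)) / 2"
  by (simp add: complex_eq_iff Re_exp Im_exp)

text \<open>Multiplication by \<open>1 - cos (h * x)\<close> is, up to the factor -1/2, a second
  difference in \<xi> of step \<open>h\<close>. By iteration the integrals of characters determine
  those against all powers of \<open>1 - cos (h * x)\<close>.\<close>

lemma iexp_times_one_minus_cos:
  "iexp (\<xi> * x) * of_real (1 - cos (h * x)) = iexp (\<xi> * x) - (iexp ((\<xi> + h) * x) + iexp ((\<xi> - h) * x)) / 2"
proof -
  have "iexp ((\<xi> + h) * x) = iexp (\<xi> * x) * iexp (h * x)" "iexp ((\<xi> - h) * x) = iexp (\<xi> * x) * iexp (- (h * x))"
    by (simp_all add: exp_add[symmetric] algebra_simps)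
  then show ?thesis by (simp only: of_real_diff of_real_1 of_real_cos_iexp) (simp add: algebra_simps add_divide_distrib)
qed

lemma one_minus_cos_le: "1 - cos u \<le> u\<^sup>2 / 2" for u :: real
proof -
  have "1 - cos u = 2 * (sin (u / 2))\<^sup>2" using cos_double_sin[of "u / 2"] by simp
  also have "\<dots> \<le> 2 * (u / 2)\<^sup>2"
  proof -
    have "(sin (u / 2))\<^sup>2 \<le> (u / 2)\<^sup>2"
      using abs_sin_x_le_abs_x[of "u / 2"] by (simp only: abs_le_square_iff)
    then show ?thesis by simp
  qed
  finally show ?thesis by (simp add: power2_eq_square)
qed

lemma cosh_minus_one_sums: "(\<lambda>k. x ^ (2 * k + 2) / fact (2 * k + 2)) sums (cosh x - 1)" for x :: real
proof -
  have "(\<lambda>n. if even n then x ^ n / fact n else 0) sums cosh x"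
    using cosh_converges[of x] by (simp add: field_simps cong: if_cong)
  then have "(\<lambda>k. (if even (2 * k) then x ^ (2 * k) / fact (2 * k) else 0)) sums cosh x"
    by (subst sums_mono_reindex[of "\<lambda>k. 2 * k"]) (auto simp: strict_mono_def elim!: evenE)
  then have "(\<lambda>k. x ^ (2 * k) / fact (2 * k)) sums cosh x" by simp
  from sums_split_initial_segment[OF this, of 1] show ?thesis by (simp add: algebra_simps)
qed

text \<open>Difference quotients of \<open>\<lambda>z. exp (z * p)\<close> at 0, along
  \<open>z = 1 / (n + 1)\<close>. For \<open>p\<close> the characteristic exponent, the exponential
  is the characteristic function of \<open>L (1 / (n + 1))\<close>.\<close>

lemma power_mean_LIMSEQ: "(\<lambda>n. of_nat (Suc n) * (exp (p / of_nat (Suc n)) - 1)) \<longlonglongrightarrow> p" for p :: complex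
proof -
  have "((\<lambda>z. exp (z * p)) has_field_derivative p) (at 0)"
    by (auto intro!: derivative_eq_intros)
  then have d: "((\<lambda>z. (exp (z * p) - 1) / z) \<longlongrightarrow> p) (at 0)" by (simp add: DERIV_def)
  have "filterlim (\<lambda>n. inverse (of_nat (Suc n)) :: complex) (at 0) sequentially"
    unfolding filterlim_at
  proof (intro conjI always_eventually allI)
    show "(\<lambda>n. inverse (of_nat (Suc n)) :: complex) \<longlonglongrightarrow> 0"
      using LIMSEQ_inverse_real_of_nat[THEN tendsto_of_real, where 'a=complex] by simp
    show "inverse (of_nat (Suc n)) \<noteq> (0 :: complex)" for n
      by (simp del: of_nat_Suc)
    show "inverse (of_nat (Suc n)) \<in> (UNIV :: complex set)" for n by simp
  qed
  from filterlim_compose[OF d this] show ?thesis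
    by (simp add: divide_inverse mult.commute del: of_nat_Suc)
qed

lemma
  fixes f g h :: "'b \<Rightarrow> complex"
  assumes "integrable N f" "integrable N g" "integrable N h"
  shows integral_second_difference:
      "(\<integral>x. f x - (g x + h x) / 2 \<partial>N) = (\<integral>x. f x \<partial>N) - ((\<integral>x. g x \<partial>N) + (\<integral>x. h x \<partial>N)) / 2"
    and integrable_second_difference: "integrable N (\<lambda>x. f x - (g x + h x) / 2)"
  using assms by simp_all

lemma second_difference_mult:
  "(x - (y + z) / 2) * w = x * w - (y * w + z * w) / 2" "w * (x - (y + z) / 2) = w * x - (w * y + w * z) / 2"
  for w x y z :: complex
  by (simp_all add: field_simps)

section \<open>From small increments to the Levy measure\<close>

context exponential_levy_process
begin

abbreviation "char_exponent \<equiv> characteristic_exponent a \<sigma> \<nu>"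

definition levy_kernel :: "real \<Rightarrow> real \<Rightarrow> complex" where
  "levy_kernel \<xi> y = iexp (\<xi> * y) - 1 - \<i> * of_real (\<xi> * y * indicator {y. \<bar>y\<bar> \<le> 1} y)"

lemma levy_measure_nu: "levy_measure \<nu>"
  and char_function: "t \<ge> 0 \<Longrightarrow> (CLINT \<omega>|M. iexp (\<xi> * L t \<omega>)) = exp (of_real t * char_exponent \<xi>)"
  using triplet by (auto simp: has_levy_triplet_def)

lemma sets_nu [measurable_cong]: "sets \<nu> = sets (restrict_space borel (- {0}))"
  using levy_measure_nu by (simp add: levy_measure_def)

lemma measurable_nu:
  assumes "f \<in> measurable borel K"
  shows "f \<in> measurable \<nu> K"
  using measurable_restrict_space1[OF assms] measurable_cong_sets[OF sets_nu refl] by blast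

lemma integrable_nu_bound:
  fixes f :: "real \<Rightarrow> 'b :: {banach, second_countable_topology}"
  assumes f: "f \<in> borel_measurable borel" and le: "\<And>y. norm (f y) \<le> C * min (y\<^sup>2) 1"
  shows "integrable \<nu> f"
proof (rule integrableI_bounded)
  have C: "C \<ge> 0" using order_trans[OF norm_ge_zero le[of 1]] by simp
  have "(\<integral>\<^sup>+y. ennreal (norm (f y)) \<partial>\<nu>) \<le> (\<integral>\<^sup>+y. ennreal C * ennreal (min (y\<^sup>2) 1) \<partial>\<nu>)"
    using C by (intro nn_integral_mono) (simp add: ennreal_leI le flip: ennreal_mult)
  also have "\<dots> = ennreal C * (\<integral>\<^sup>+y. ennreal (min (y\<^sup>2) 1) \<partial>\<nu>)"
    by (intro nn_integral_cmult measurable_nu) measurable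
  also have "\<dots> < \<infinity>" using levy_measure_nu by (simp add: levy_measure_def ennreal_mult_less_top)
  finally show "(\<integral>\<^sup>+y. ennreal (norm (f y)) \<partial>\<nu>) < \<infinity>" .
qed (rule measurable_nu[OF f])

text \<open>For small jumps the kernel is a Taylor remainder of second order, for large jumps a
  difference of two numbers of modulus one.\<close>

lemma levy_kernel_bound: "norm (levy_kernel \<xi> y) \<le> (\<xi>\<^sup>2 / 2 + 2) * min (y\<^sup>2) 1"
proof (cases "\<bar>y\<bar> \<le> 1")
  case True
  then have y2: "y\<^sup>2 \<le> 1" by (simp add: abs_square_le_1)
  have "levy_kernel \<xi> y = iexp (\<xi> * y) - (\<Sum>k\<le>1. (\<i> * complex_of_real (\<xi> * y)) ^ k / fact k)"
    using True by (simp add: levy_kernel_def)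
  also have "norm \<dots> \<le> \<bar>\<xi> * y\<bar> ^ Suc 1 / fact (Suc 1)" by (rule iexp_approx1)
  also have "\<dots> = \<xi>\<^sup>2 / 2 * y\<^sup>2" by (simp add: power2_eq_square abs_mult field_simps)
  also have "\<dots> \<le> (\<xi>\<^sup>2 / 2 + 2) * min (y\<^sup>2) 1" using y2 by (simp add: algebra_simps)
  finally show ?thesis .
next
  case False
  then have "1 < y\<^sup>2" by (simp add: abs_square_less_1[symmetric] not_le flip: abs_square_le_1)
  then have "min (y\<^sup>2) 1 = 1" by simp
  moreover have "norm (levy_kernel \<xi> y) \<le> norm (iexp (\<xi> * y)) + norm (1 :: complex)"
    using False norm_triangle_ineq4[of "iexp (\<xi> * y)" 1] by (simp add: levy_kernel_def)
  then have "norm (levy_kernel \<xi> y) \<le> 2" by simp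
  moreover have "2 \<le> \<xi>\<^sup>2 / 2 + 2" by simp
  ultimately show ?thesis by (metis mult_1_right order_trans)
qed

lemma levy_kernel_measurable [measurable]: "levy_kernel \<xi> \<in> borel_measurable borel"
  unfolding levy_kernel_def by measurable

lemma integrable_levy_kernel: "integrable \<nu> (levy_kernel \<xi>)"
  by (rule integrable_nu_bound[OF levy_kernel_measurable levy_kernel_bound])

lemma char_exponent_eq: "char_exponent \<xi> = \<i> * of_real (a * \<xi>) - of_real (\<sigma>\<^sup>2 * \<xi>\<^sup>2 / 2) + (\<integral>y. levy_kernel \<xi> y \<partial>\<nu>)"
  by (simp add: characteristic_exponent_def levy_kernel_def)

definition small_increment :: "nat \<Rightarrow> 'w \<Rightarrow> real" where
  "small_increment n = L (1 / real (Suc n))"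

lemma small_increment_measurable [measurable]: "small_increment n \<in> borel_measurable M"
  unfolding small_increment_def by (rule random_variable_L) simp

lemma small_increment_char:
  "(\<lambda>n. of_nat (Suc n) * ((CLINT \<omega>|M. iexp (\<xi> * small_increment n \<omega>)) - 1)) \<longlonglongrightarrow> char_exponent \<xi>"
proof -
  have "(CLINT \<omega>|M. iexp (\<xi> * small_increment n \<omega>)) = exp (char_exponent \<xi> / of_nat (Suc n))" for n
    unfolding small_increment_def by (subst char_function) (simp_all add: divide_inverse mult.commute del: of_nat_Suc)
  then show ?thesis using power_mean_LIMSEQ[of "char_exponent \<xi>"] by (simp only:)
qed

text \<open>The weighted laws \<open>n * P(L (1/n) \<in> dy)\<close> converge to \<open>\<nu>\<close> away from \<open>0\<close>. Testing only against
  powers of \<open>1 - cos (h y)\<close>, this needs nothing but the shift of \<open>\<xi>\<close> by \<open>h\<close> and \<open>- h\<close>.\<close>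

lemma small_increment_cos_power:
  "integrable \<nu> (\<lambda>y. iexp (\<xi> * y) * of_real ((1 - cos (h * y)) ^ Suc k)) \<and>
   (\<lambda>n. of_nat (Suc n) * (CLINT \<omega>|M. iexp (\<xi> * small_increment n \<omega>) * of_real ((1 - cos (h * small_increment n \<omega>)) ^ Suc k)))
     \<longlonglongrightarrow> (CLINT y|\<nu>. iexp (\<xi> * y) * of_real ((1 - cos (h * y)) ^ Suc k)) + (if k = 0 then of_real (\<sigma>\<^sup>2 * h\<^sup>2 / 2) else 0)"
proof (induction k arbitrary: \<xi>)
  case 0
  let ?X = small_increment
  have ptw: "iexp (\<xi> * y) * of_real ((1 - cos (h * y)) ^ Suc 0) =
      levy_kernel \<xi> y - (levy_kernel (\<xi> + h) y + levy_kernel (\<xi> - h) y) / 2" for y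
    unfolding power_Suc0_right iexp_times_one_minus_cos
    by (simp add: levy_kernel_def field_simps indicator_def)
  have int: "integrable \<nu> (\<lambda>y. iexp (\<xi> * y) * of_real ((1 - cos (h * y)) ^ Suc 0))"
    unfolding ptw by (intro integrable_second_difference integrable_levy_kernel)
  have bi: "integrable M (\<lambda>\<omega>. iexp (\<zeta> * ?X n \<omega>))" for \<zeta> n
    by (rule integrable_const_bound[where B=1]) (auto simp: norm_exp_i_times)
  have "(\<lambda>n. of_nat (Suc n) * (CLINT \<omega>|M. iexp (\<xi> * ?X n \<omega>) * of_real ((1 - cos (h * ?X n \<omega>)) ^ Suc 0))) =
     (\<lambda>n. of_nat (Suc n) * ((CLINT \<omega>|M. iexp (\<xi> * ?X n \<omega>)) - 1)
       - (of_nat (Suc n) * ((CLINT \<omega>|M. iexp ((\<xi> + h) * ?X n \<omega>)) - 1) + of_nat (Suc n) * ((CLINT \<omega>|M. iexp ((\<xi> - h) * ?X n \<omega>)) - 1)) / 2)"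
    unfolding power_Suc0_right iexp_times_one_minus_cos integral_second_difference[OF bi bi bi]
    by (intro ext) (simp add: field_simps del: of_nat_Suc)
  also have "\<dots> \<longlonglongrightarrow> char_exponent \<xi> - (char_exponent (\<xi> + h) + char_exponent (\<xi> - h)) / 2"
    by (intro tendsto_diff tendsto_divide tendsto_add small_increment_char tendsto_const) simp
  \<comment> \<open>The drift is linear and drops out of the second difference; the Gaussian part
    leaves \<open>\<sigma>\<^sup>2 * h\<^sup>2 / 2\<close>.\<close>
  also have "char_exponent \<xi> - (char_exponent (\<xi> + h) + char_exponent (\<xi> - h)) / 2 =
     (CLINT y|\<nu>. iexp (\<xi> * y) * of_real ((1 - cos (h * y)) ^ Suc 0)) + of_real (\<sigma>\<^sup>2 * h\<^sup>2 / 2)"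
  proof -
    have eqI: "(CLINT y|\<nu>. iexp (\<xi> * y) * of_real ((1 - cos (h * y)) ^ Suc 0)) =
       (\<integral>y. levy_kernel \<xi> y \<partial>\<nu>) - ((\<integral>y. levy_kernel (\<xi> + h) y \<partial>\<nu>) + (\<integral>y. levy_kernel (\<xi> - h) y \<partial>\<nu>)) / 2"
      unfolding ptw by (intro integral_second_difference integrable_levy_kernel)
    show ?thesis unfolding eqI char_exponent_eq by (simp add: field_simps power2_eq_square)
  qed
  finally show ?case using int by simp
next
  case (Suc k)
  let ?X = small_increment
  let ?f = "\<lambda>\<xi> y. iexp (\<xi> * y) * complex_of_real ((1 - cos (h * y)) ^ Suc k)"
  have ptw: "iexp (\<xi> * y) * of_real ((1 - cos (h * y)) ^ Suc (Suc k)) = ?f \<xi> y - (?f (\<xi> + h) y + ?f (\<xi> - h) y) / 2" for y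
  proof -
    have "iexp (\<xi> * y) * of_real ((1 - cos (h * y)) ^ Suc (Suc k)) =
       (iexp (\<xi> * y) * of_real (1 - cos (h * y))) * of_real ((1 - cos (h * y)) ^ Suc k)"
      by (simp only: power_Suc[of _ "Suc k"] of_real_mult mult.assoc)
    then show ?thesis unfolding iexp_times_one_minus_cos second_difference_mult .
  qed
  have bi: "integrable M (\<lambda>\<omega>. ?f \<zeta> (?X n \<omega>))" for \<zeta> n
  proof (rule integrable_const_bound[where B="2 ^ Suc k"])
    have "\<bar>1 - cos u\<bar> ^ Suc k \<le> 2 ^ Suc k" for u :: real
      by (rule power_mono) (use cos_le_one[of u] cos_ge_minus_one[of u] in auto)
    then show "AE \<omega> in M. norm (?f \<zeta> (?X n \<omega>)) \<le> 2 ^ Suc k"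
      by (simp only: norm_mult norm_exp_i_times norm_of_real power_abs mult_1_left AE_I2)
  qed measurable
  have int: "integrable \<nu> (\<lambda>y. iexp (\<xi> * y) * of_real ((1 - cos (h * y)) ^ Suc (Suc k)))"
    unfolding ptw by (intro integrable_second_difference Suc[THEN conjunct1])
  have "(\<lambda>n. of_nat (Suc n) * (CLINT \<omega>|M. iexp (\<xi> * ?X n \<omega>) * of_real ((1 - cos (h * ?X n \<omega>)) ^ Suc (Suc k)))) =
     (\<lambda>n. of_nat (Suc n) * (CLINT \<omega>|M. ?f \<xi> (?X n \<omega>))
       - (of_nat (Suc n) * (CLINT \<omega>|M. ?f (\<xi> + h) (?X n \<omega>)) + of_nat (Suc n) * (CLINT \<omega>|M. ?f (\<xi> - h) (?X n \<omega>))) / 2)"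
  proof
    fix n
    have "(CLINT \<omega>|M. iexp (\<xi> * ?X n \<omega>) * of_real ((1 - cos (h * ?X n \<omega>)) ^ Suc (Suc k))) =
      (CLINT \<omega>|M. ?f \<xi> (?X n \<omega>)) - ((CLINT \<omega>|M. ?f (\<xi> + h) (?X n \<omega>)) + (CLINT \<omega>|M. ?f (\<xi> - h) (?X n \<omega>))) / 2"
      unfolding ptw by (intro integral_second_difference bi)
    then show "of_nat (Suc n) * (CLINT \<omega>|M. iexp (\<xi> * ?X n \<omega>) * of_real ((1 - cos (h * ?X n \<omega>)) ^ Suc (Suc k))) =
        of_nat (Suc n) * (CLINT \<omega>|M. ?f \<xi> (?X n \<omega>))
       - (of_nat (Suc n) * (CLINT \<omega>|M. ?f (\<xi> + h) (?X n \<omega>)) + of_nat (Suc n) * (CLINT \<omega>|M. ?f (\<xi> - h) (?X n \<omega>))) / 2"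
      by (simp only: second_difference_mult)
  qed
  also have "\<dots> \<longlonglongrightarrow> ((\<integral>y. ?f \<xi> y \<partial>\<nu>) + (if k = 0 then of_real (\<sigma>\<^sup>2 * h\<^sup>2 / 2) else 0)) -
      (((\<integral>y. ?f (\<xi> + h) y \<partial>\<nu>) + (if k = 0 then of_real (\<sigma>\<^sup>2 * h\<^sup>2 / 2) else 0)) + ((\<integral>y. ?f (\<xi> - h) y \<partial>\<nu>) + (if k = 0 then of_real (\<sigma>\<^sup>2 * h\<^sup>2 / 2) else 0))) / 2"
    by (intro tendsto_diff tendsto_divide tendsto_add Suc[THEN conjunct2] tendsto_const) simp
  \<comment> \<open>The Gaussian contribution does not depend on \<xi> and cancels in the next
    second difference, so it is present for the first power only.\<close>
  also have "((\<integral>y. ?f \<xi> y \<partial>\<nu>) + (if k = 0 then of_real (\<sigma>\<^sup>2 * h\<^sup>2 / 2) else 0)) -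
      (((\<integral>y. ?f (\<xi> + h) y \<partial>\<nu>) + (if k = 0 then of_real (\<sigma>\<^sup>2 * h\<^sup>2 / 2) else 0)) + ((\<integral>y. ?f (\<xi> - h) y \<partial>\<nu>) + (if k = 0 then of_real (\<sigma>\<^sup>2 * h\<^sup>2 / 2) else 0))) / 2 =
    (CLINT y|\<nu>. iexp (\<xi> * y) * of_real ((1 - cos (h * y)) ^ Suc (Suc k)))"
  proof -
    have fi: "integrable \<nu> (?f \<zeta>)" for \<zeta> by (rule Suc[THEN conjunct1])
    have "(CLINT y|\<nu>. iexp (\<xi> * y) * of_real ((1 - cos (h * y)) ^ Suc (Suc k))) =
       (\<integral>y. ?f \<xi> y \<partial>\<nu>) - ((\<integral>y. ?f (\<xi> + h) y \<partial>\<nu>) + (\<integral>y. ?f (\<xi> - h) y \<partial>\<nu>)) / 2"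
      unfolding ptw by (intro integral_second_difference fi)
    moreover have "(x + d) - ((y + d) + (z + d)) / 2 = x - (y + z) / 2" for x y z d :: complex
      by (simp add: field_simps)
    ultimately show ?thesis by (simp only:)
  qed
  finally show ?case using int by simp
qed

lemma small_increment_cos_power_real:
  shows "integrable \<nu> (\<lambda>y. (1 - cos (h * y)) ^ Suc k)"
    and "(\<lambda>n. real (Suc n) * expectation (\<lambda>\<omega>. (1 - cos (h * small_increment n \<omega>)) ^ Suc k))
     \<longlonglongrightarrow> (\<integral>y. (1 - cos (h * y)) ^ Suc k \<partial>\<nu>) + (if k = 0 then \<sigma>\<^sup>2 * h\<^sup>2 / 2 else 0)"
proof -
  from small_increment_cos_power[of 0 h k]
  have "integrable \<nu> (\<lambda>y. complex_of_real ((1 - cos (h * y)) ^ Suc k))"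
    "(\<lambda>n. complex_of_real (real (Suc n)) * (\<integral>\<omega>. complex_of_real ((1 - cos (h * small_increment n \<omega>)) ^ Suc k) \<partial>M))
     \<longlonglongrightarrow> (\<integral>y. complex_of_real ((1 - cos (h * y)) ^ Suc k) \<partial>\<nu>) + (if k = 0 then of_real (\<sigma>\<^sup>2 * h\<^sup>2 / 2) else 0)"
    by (simp_all only: mult_zero_left of_real_0 mult_zero_right exp_zero mult_1_left of_real_of_nat_eq)
  then have 1: "integrable \<nu> (\<lambda>y. complex_of_real ((1 - cos (h * y)) ^ Suc k))"
    and 2: "(\<lambda>n. complex_of_real (real (Suc n) * (\<integral>\<omega>. (1 - cos (h * small_increment n \<omega>)) ^ Suc k \<partial>M)))
     \<longlonglongrightarrow> complex_of_real ((\<integral>y. (1 - cos (h * y)) ^ Suc k \<partial>\<nu>) + (if k = 0 then \<sigma>\<^sup>2 * h\<^sup>2 / 2 else 0))"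
    by (simp_all only: integral_complex_of_real of_real_mult of_real_add if_distrib[of complex_of_real] of_real_0)
  show "integrable \<nu> (\<lambda>y. (1 - cos (h * y)) ^ Suc k)" using integrable_Re[OF 1] by (simp only: Re_complex_of_real)
  show "(\<lambda>n. real (Suc n) * expectation (\<lambda>\<omega>. (1 - cos (h * small_increment n \<omega>)) ^ Suc k))
     \<longlonglongrightarrow> (\<integral>y. (1 - cos (h * y)) ^ Suc k \<partial>\<nu>) + (if k = 0 then \<sigma>\<^sup>2 * h\<^sup>2 / 2 else 0)"
    using tendsto_Re[OF 2] by (simp only: Re_complex_of_real)
qed

definition mgf :: "real \<Rightarrow> real \<Rightarrow> real" where
  "mgf \<theta> t = expectation (\<lambda>\<omega>. exp (\<theta> * L t \<omega>))"

lemma nn_mgf_eq: "t \<ge> 0 \<Longrightarrow> nn_mgf \<theta> t = ennreal (mgf \<theta> t)"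
  unfolding nn_mgf_def mgf_def by (intro nn_integral_eq_integral integrable_exp_L) auto

lemma mgf_nonneg: "mgf \<theta> t \<ge> 0"
  unfolding mgf_def by (intro integral_nonneg_AE) simp

lemma mgf_small_increment_power: "mgf \<theta> (1 / real (Suc n)) ^ Suc n = mgf \<theta> 1"
proof -
  have "ennreal (mgf \<theta> (1 / real (Suc n)) ^ Suc n) = ennreal (mgf \<theta> 1)"
    using nn_mgf_mult[of "1 / real (Suc n)" \<theta> "Suc n"] mgf_nonneg
    by (simp add: nn_mgf_eq[symmetric] nn_mgf_def[symmetric] ennreal_power[symmetric] del: of_nat_Suc power_Suc)
  then show ?thesis using mgf_nonneg by (simp del: power_Suc)
qed

text \<open>Bernoulli's inequality for the power \<open>n + 1\<close> of the moment generating
  function at time \<open>1 / (n + 1)\<close>, which is the one at time 1. The resulting bound is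
  uniform in \<open>n\<close>.\<close>

lemma small_increment_cosh_le:
  "real (Suc n) * expectation (\<lambda>\<omega>. cosh (\<theta> * small_increment n \<omega>) - 1) \<le> (mgf \<theta> 1 + mgf (- \<theta>) 1) / 2 - 1"
proof -
  have *: "real (Suc n) * (mgf \<zeta> (1 / real (Suc n)) - 1) \<le> mgf \<zeta> 1 - 1" for \<zeta>
    using Bernoulli_inequality[of "mgf \<zeta> (1 / real (Suc n)) - 1" "Suc n"] mgf_small_increment_power[of \<zeta> n] mgf_nonneg
    by (simp del: power_Suc of_nat_Suc)
  have "expectation (\<lambda>\<omega>. cosh (\<theta> * small_increment n \<omega>) - 1) =
     expectation (\<lambda>\<omega>. (exp (\<theta> * small_increment n \<omega>) + exp ((- \<theta>) * small_increment n \<omega>)) / 2 - 1)"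
    by (simp add: cosh_def)
  also have "\<dots> = (mgf \<theta> (1 / real (Suc n)) + mgf (- \<theta>) (1 / real (Suc n))) / 2 - 1"
    unfolding small_increment_def mgf_def
    using integrable_exp_L[of "1 / real (Suc n)" \<theta>] integrable_exp_L[of "1 / real (Suc n)" "- \<theta>"]
    by (simp add: prob_space del: of_nat_Suc)
  finally have Eeq: "expectation (\<lambda>\<omega>. cosh (\<theta> * small_increment n \<omega>) - 1) = (mgf \<theta> (1 / real (Suc n)) + mgf (- \<theta>) (1 / real (Suc n))) / 2 - 1" .
  then have "real (Suc n) * expectation (\<lambda>\<omega>. cosh (\<theta> * small_increment n \<omega>) - 1) =
     (real (Suc n) * (mgf \<theta> (1 / real (Suc n)) - 1) + real (Suc n) * (mgf (- \<theta>) (1 / real (Suc n)) - 1)) / 2"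
  proof -
    have "N * E = (N * (u - 1) + N * (v - 1)) / 2" if "E = (u + v) / 2 - 1" for N E u v :: real
      unfolding that by (simp add: field_simps)
    from this[OF Eeq] show ?thesis .
  qed
  moreover have "x \<le> (u + v) / 2 - 1" if "x = (p + q) / 2" "p \<le> u - 1" "q \<le> v - 1" for x p q u v :: real
    using that by argo
  ultimately show ?thesis using *[of \<theta>] *[of "- \<theta>"] by blast
qed

text \<open>In a partial sum of the series of \<open>cosh (\<theta> * y) - 1\<close> the square of
  \<open>y\<close> is replaced by the bounded function \<open>q h y\<close>. Three limits follow:
  \<open>n\<close> to infinity passes from small increments to \<open>\<nu>\<close>,
  \<open>h\<close> to 0 restores the square, \<open>K\<close> to infinity completes the series. The
  last two use Fatou, and the bound \<open>B\<close> never changes.\<close>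

lemma nu_cosh_finite: "(\<integral>\<^sup>+y. ennreal (cosh (\<theta> * y) - 1) \<partial>\<nu>) < \<infinity>"
proof -
  define B where "B = (mgf \<theta> 1 + mgf (- \<theta>) 1) / 2 - 1"
  define c where "c k = \<theta> ^ (2 * k + 2) / fact (2 * k + 2)" for k
  have c0: "c k \<ge> 0" for k
    unfolding c_def by (intro divide_nonneg_pos zero_le_even_power) simp_all
  \<comment> \<open>\<open>q h y\<close> is at most \<open>y\<^sup>2\<close> and tends to it as
    \<open>h\<close> tends to 0, and its powers are multiples of the test functions of
    \<open>small_increment_cos_power\<close>.\<close>
  define q where "q h y = 2 / h\<^sup>2 * (1 - cos (h * y))" for h y :: real
  have q0: "q h y \<ge> 0" for h y unfolding q_def by simp
  have qle: "q h y \<le> y\<^sup>2" if "h \<noteq> 0" for h y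
    using one_minus_cos_le[of "h * y"] that unfolding q_def by (simp add: field_simps power_mult_distrib)
  have part: "(\<Sum>k<K. c k * x ^ (2 * k + 2)) \<le> cosh (\<theta> * x) - 1" for K x
  proof -
    have eq: "c k * x ^ (2 * k + 2) = (\<theta> * x) ^ (2 * k + 2) / fact (2 * k + 2)" for k
      by (simp only: c_def power_mult_distrib times_divide_eq_left)
    have nn: "c k * x ^ (2 * k + 2) \<ge> 0" for k using c0 by (intro mult_nonneg_nonneg zero_le_even_power) simp_all
    have s: "(\<lambda>k. c k * x ^ (2 * k + 2)) sums (cosh (\<theta> * x) - 1)"
      unfolding eq by (rule cosh_minus_one_sums)
    show ?thesis
      using sum_le_suminf[OF sums_summable[OF s], of "{..<K}"] nn sums_unique[OF s] by simp
  qed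
  have 1: "(\<integral>\<^sup>+y. ennreal (\<Sum>k<K. c k * q h y ^ Suc k) \<partial>\<nu>) \<le> ennreal B" if h: "h \<noteq> 0" for K h
  proof -
    have eq: "c k * q h y ^ Suc k = (c k * (2 / h\<^sup>2) ^ Suc k) * (1 - cos (h * y)) ^ Suc k" for k y
      unfolding q_def power_mult_distrib by simp
    have int: "integrable \<nu> (\<lambda>y. \<Sum>k<K. c k * q h y ^ Suc k)"
      unfolding eq by (intro Bochner_Integration.integrable_sum integrable_mult_right small_increment_cos_power_real(1))
    have bM: "integrable M (\<lambda>\<omega>. (1 - cos (h * small_increment n \<omega>)) ^ Suc k)" for n k
    proof (rule integrable_const_bound[where B="2 ^ Suc k"])
      have "\<bar>1 - cos u\<bar> ^ Suc k \<le> 2 ^ Suc k" for u :: real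
        by (rule power_mono) (use cos_le_one[of u] cos_ge_minus_one[of u] in auto)
      then show "AE \<omega> in M. norm ((1 - cos (h * small_increment n \<omega>)) ^ Suc k) \<le> 2 ^ Suc k"
        by (auto simp: norm_power simp del: power_Suc)
    qed measurable
    have intM: "integrable M (\<lambda>\<omega>. \<Sum>k<K. c k * q h (small_increment n \<omega>) ^ Suc k)" for n
      unfolding eq by (intro Bochner_Integration.integrable_sum integrable_mult_right bM)
    let ?r = "\<lambda>k. (\<integral>y. (1 - cos (h * y)) ^ Suc k \<partial>\<nu>) + (if k = 0 then \<sigma>\<^sup>2 * h\<^sup>2 / 2 else 0)"
    have limK: "(\<lambda>n. \<Sum>k<K. (c k * (2 / h\<^sup>2) ^ Suc k) * (real (Suc n) * expectation (\<lambda>\<omega>. (1 - cos (h * small_increment n \<omega>)) ^ Suc k)))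
       \<longlonglongrightarrow> (\<Sum>k<K. (c k * (2 / h\<^sup>2) ^ Suc k) * ?r k)"
      by (intro tendsto_sum tendsto_mult tendsto_const small_increment_cos_power_real(2))
    have leB: "(\<Sum>k<K. (c k * (2 / h\<^sup>2) ^ Suc k) * (real (Suc n) * expectation (\<lambda>\<omega>. (1 - cos (h * small_increment n \<omega>)) ^ Suc k))) \<le> B" for n
    proof -
      have "(\<Sum>k<K. (c k * (2 / h\<^sup>2) ^ Suc k) * (real (Suc n) * expectation (\<lambda>\<omega>. (1 - cos (h * small_increment n \<omega>)) ^ Suc k))) =
        real (Suc n) * (\<Sum>k<K. (c k * (2 / h\<^sup>2) ^ Suc k) * expectation (\<lambda>\<omega>. (1 - cos (h * small_increment n \<omega>)) ^ Suc k))"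
        unfolding sum_distrib_left by (intro sum.cong refl) (simp only: mult.left_commute)
      also have "(\<Sum>k<K. (c k * (2 / h\<^sup>2) ^ Suc k) * expectation (\<lambda>\<omega>. (1 - cos (h * small_increment n \<omega>)) ^ Suc k)) =
        expectation (\<lambda>\<omega>. \<Sum>k<K. c k * q h (small_increment n \<omega>) ^ Suc k)"
        unfolding eq
        by (subst Bochner_Integration.integral_sum, intro integrable_mult_right bM) (simp only: integral_mult_right_zero)
      also have "\<dots> \<le> expectation (\<lambda>\<omega>. cosh (\<theta> * small_increment n \<omega>) - 1)"
      proof (rule integral_mono[OF intM])
        show "integrable M (\<lambda>\<omega>. cosh (\<theta> * small_increment n \<omega>) - 1)"
          using integrable_exp_L[of "1 / real (Suc n)" \<theta>] integrable_exp_L[of "1 / real (Suc n)" "- \<theta>"]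
          unfolding cosh_def small_increment_def by (simp del: of_nat_Suc)
        fix \<omega>
        have "(\<Sum>k<K. c k * q h (small_increment n \<omega>) ^ Suc k) \<le> (\<Sum>k<K. c k * ((small_increment n \<omega>)\<^sup>2) ^ Suc k)"
          by (intro sum_mono mult_left_mono power_mono qle h q0 c0)
        also have "\<dots> = (\<Sum>k<K. c k * (small_increment n \<omega>) ^ (2 * k + 2))"
          by (simp only: power_mult[symmetric] mult_Suc_right add.commute)
        also have "\<dots> \<le> cosh (\<theta> * small_increment n \<omega>) - 1" by (rule part)
        finally show "(\<Sum>k<K. c k * q h (small_increment n \<omega>) ^ Suc k) \<le> cosh (\<theta> * small_increment n \<omega>) - 1" .
      qed
      finally have "(\<Sum>k<K. (c k * (2 / h\<^sup>2) ^ Suc k) * (real (Suc n) * expectation (\<lambda>\<omega>. (1 - cos (h * small_increment n \<omega>)) ^ Suc k))) \<le>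
        real (Suc n) * expectation (\<lambda>\<omega>. cosh (\<theta> * small_increment n \<omega>) - 1)"
        by (simp add: mult_left_mono del: of_nat_Suc)
      also have "\<dots> \<le> B" unfolding B_def by (rule small_increment_cosh_le)
      finally show ?thesis .
    qed
    have lim: "(\<Sum>k<K. (c k * (2 / h\<^sup>2) ^ Suc k) * ?r k) \<le> B"
      by (rule LIMSEQ_le_const2[OF limK]) (use leB in blast)
    have "(\<integral>y. (\<Sum>k<K. c k * q h y ^ Suc k) \<partial>\<nu>) = (\<Sum>k<K. (c k * (2 / h\<^sup>2) ^ Suc k) * (\<integral>y. (1 - cos (h * y)) ^ Suc k \<partial>\<nu>))"
      unfolding eq
      by (subst Bochner_Integration.integral_sum, intro integrable_mult_right small_increment_cos_power_real(1)) (simp only: integral_mult_right_zero)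
    \<comment> \<open>The Gaussian term in \<open>?r\<close> is nonnegative and may be
      added.\<close>
    also have "\<dots> \<le> (\<Sum>k<K. (c k * (2 / h\<^sup>2) ^ Suc k) * ?r k)"
      by (intro sum_mono mult_left_mono) (use c0 in auto)
    finally have "(\<integral>y. (\<Sum>k<K. c k * q h y ^ Suc k) \<partial>\<nu>) \<le> B" using lim by simp
    moreover have "(\<integral>\<^sup>+y. ennreal (\<Sum>k<K. c k * q h y ^ Suc k) \<partial>\<nu>) = ennreal (\<integral>y. (\<Sum>k<K. c k * q h y ^ Suc k) \<partial>\<nu>)"
      by (rule nn_integral_eq_integral[OF int]) (use c0 q0 in \<open>auto intro!: sum_nonneg\<close>)
    ultimately show ?thesis by (simp add: ennreal_leI)
  qed
  have 2: "(\<integral>\<^sup>+y. ennreal (\<Sum>k<K. c k * (y\<^sup>2) ^ Suc k) \<partial>\<nu>) \<le> ennreal B" for K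
  proof (rule nn_integral_le_limit)
    show "(\<integral>\<^sup>+y. ennreal (\<Sum>k<K. c k * q (1 / real (Suc n)) y ^ Suc k) \<partial>\<nu>) \<le> ennreal B" for n
      by (rule 1) simp
    show "(\<lambda>y. ennreal (\<Sum>k<K. c k * q (1 / real (Suc n)) y ^ Suc k)) \<in> borel_measurable \<nu>" for n
      unfolding q_def by (intro measurable_nu) measurable
    have "(\<lambda>n. q (1 / real (Suc n)) y) \<longlonglongrightarrow> y\<^sup>2" for y
      unfolding q_def by (real_asymp) (simp add: power2_eq_square)
    then show "(\<lambda>n. ennreal (\<Sum>k<K. c k * q (1 / real (Suc n)) y ^ Suc k)) \<longlonglongrightarrow> ennreal (\<Sum>k<K. c k * (y\<^sup>2) ^ Suc k)" for y
      by (intro tendsto_ennrealI tendsto_sum tendsto_mult tendsto_const tendsto_power)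
  qed
  have "(\<integral>\<^sup>+y. ennreal (cosh (\<theta> * y) - 1) \<partial>\<nu>) \<le> ennreal B"
  proof (rule nn_integral_le_limit[OF _ 2])
    show "(\<lambda>y. ennreal (\<Sum>k<K. c k * (y\<^sup>2) ^ Suc k)) \<in> borel_measurable \<nu>" for K
      by (intro measurable_nu) measurable
    fix y
    have "c k * (y\<^sup>2) ^ Suc k = (\<theta> * y) ^ (2 * k + 2) / fact (2 * k + 2)" for k
      by (simp only: c_def power_mult_distrib times_divide_eq_left power_mult[symmetric] mult_Suc_right add.commute)
    then have "(\<lambda>k. c k * (y\<^sup>2) ^ Suc k) sums (cosh (\<theta> * y) - 1)"
      using cosh_minus_one_sums[of "\<theta> * y"] by simp
    then show "(\<lambda>K. ennreal (\<Sum>k<K. c k * (y\<^sup>2) ^ Suc k)) \<longlonglongrightarrow> ennreal (cosh (\<theta> * y) - 1)"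
      unfolding sums_def by (intro tendsto_ennrealI)
  qed
  then show ?thesis by (rule le_less_trans) simp
qed

end

section \<open>The logarithmic moment generating function\<close>

context exponential_levy_process
begin

abbreviation "Psi \<equiv> log_mgf a \<sigma> \<nu>"

definition large_jump_mean :: real where
  "large_jump_mean = (\<integral>y. y * indicator {y. \<not> \<bar>y\<bar> \<le> 1} y \<partial>\<nu>)"

text \<open>The entire function that extends both exponents. Compensating jumps of every size, not
  only the small ones, gives an integrand whose power series starts at order two;
  \<open>large_jump_mean\<close> corrects the difference.\<close>

definition exponent_C :: "complex \<Rightarrow> complex" where
  "exponent_C z = of_real a * z + of_real (\<sigma>\<^sup>2 / 2) * z\<^sup>2 + z * of_real large_jump_mean +
     (\<integral>y. exp (z * of_real y) - 1 - z * of_real y \<partial>\<nu>)"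

lemma square_le_cosh: "y\<^sup>2 \<le> 2 * (cosh y - 1)" for y :: real
proof -
  have nn: "0 \<le> y ^ (2 * k + 2) / fact (2 * k + 2)" for k
    by (intro divide_nonneg_pos zero_le_even_power) simp_all
  have "y\<^sup>2 / 2 = (\<Sum>k\<in>{0::nat}. y ^ (2 * k + 2) / fact (2 * k + 2))"
    by (simp add: power2_eq_square)
  also have "(\<Sum>k\<in>{0}. y ^ (2 * k + 2) / fact (2 * k + 2)) \<le> (\<Sum>k. y ^ (2 * k + 2) / fact (2 * k + 2))"
    by (rule sum_le_suminf) (use sums_summable[OF cosh_minus_one_sums[of y]] nn in blast)+
  also have "\<dots> = cosh y - 1" by (rule sums_unique[OF cosh_minus_one_sums, symmetric])
  finally show ?thesis by simp
qed

lemma integrable_large_jump: "integrable \<nu> (\<lambda>y. y * indicator {y. \<not> \<bar>y\<bar> \<le> 1} y)"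
proof (rule integrableI_bounded)
  show "(\<lambda>y. y * indicator {y. \<not> \<bar>y\<bar> \<le> 1} y) \<in> borel_measurable \<nu>"
    by (intro measurable_nu) measurable
  have "(\<integral>\<^sup>+y. ennreal (norm (y * indicator {y. \<not> \<bar>y\<bar> \<le> 1} y)) \<partial>\<nu>) \<le> (\<integral>\<^sup>+y. 2 * ennreal (cosh (1 * y) - 1) \<partial>\<nu>)"
  proof (rule nn_integral_mono)
    fix y :: real
    have "norm (y * indicator {y. \<not> \<bar>y\<bar> \<le> 1} y) \<le> y\<^sup>2"
    proof (cases "\<bar>y\<bar> \<le> 1")
      case False
      then have "1 * \<bar>y\<bar> \<le> \<bar>y\<bar> * \<bar>y\<bar>" by (intro mult_right_mono) auto
      then show ?thesis using False by (simp add: power2_eq_square)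
    qed simp
    also have "\<dots> \<le> 2 * (cosh y - 1)" by (rule square_le_cosh)
    finally have "ennreal (norm (y * indicator {y. \<not> \<bar>y\<bar> \<le> 1} y)) \<le> ennreal (2 * (cosh y - 1))"
      by (rule ennreal_leI)
    also have "\<dots> = 2 * ennreal (cosh (1 * y) - 1)"
      by (subst ennreal_mult) (auto simp: cosh_real_ge_1)
    finally show "ennreal (norm (y * indicator {y. \<not> \<bar>y\<bar> \<le> 1} y)) \<le> 2 * ennreal (cosh (1 * y) - 1)" .
  qed
  also have "\<dots> = 2 * (\<integral>\<^sup>+y. ennreal (cosh (1 * y) - 1) \<partial>\<nu>)"
    by (intro nn_integral_cmult measurable_nu) (simp add: cosh_def)
  also have "\<dots> < \<infinity>" using nu_cosh_finite[of 1] by (simp add: ennreal_mult_less_top)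
  finally show "(\<integral>\<^sup>+y. ennreal (norm (y * indicator {y. \<not> \<bar>y\<bar> \<le> 1} y)) \<partial>\<nu>) < \<infinity>" .
qed

lemma id_measurable_nu: "(\<lambda>y. y) \<in> borel_measurable \<nu>"
  by (intro measurable_nu) simp

lemmas nu_exp_integral = holomorphic_exponential_integral[OF id_measurable_nu nu_cosh_finite]

lemma exponent_C_holomorphic: "exponent_C holomorphic_on UNIV"
  unfolding exponent_C_def by (intro holomorphic_intros nu_exp_integral(1))

lemma exponent_C_imaginary: "exponent_C (\<i> * of_real \<xi>) = char_exponent \<xi>"
proof -
  let ?z = "\<i> * complex_of_real \<xi>"
  have "(\<integral>y. levy_kernel \<xi> y \<partial>\<nu>) =
     (\<integral>y. (exp (?z * of_real y) - 1 - ?z * of_real y) + ?z * of_real (y * indicator {y. \<not> \<bar>y\<bar> \<le> 1} y) \<partial>\<nu>)"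
    by (rule Bochner_Integration.integral_cong) (auto simp: levy_kernel_def indicator_def mult.assoc)
  also have "\<dots> = (\<integral>y. exp (?z * of_real y) - 1 - ?z * of_real y \<partial>\<nu>) + (\<integral>y. ?z * of_real (y * indicator {y. \<not> \<bar>y\<bar> \<le> 1} y) \<partial>\<nu>)"
    by (rule Bochner_Integration.integral_add[OF nu_exp_integral(2)])
       (intro integrable_mult_right integrable_of_real integrable_large_jump)
  also have "(\<integral>y. ?z * of_real (y * indicator {y. \<not> \<bar>y\<bar> \<le> 1} y) \<partial>\<nu>) = ?z * of_real large_jump_mean"
    unfolding large_jump_mean_def by (simp only: integral_mult_right_zero integral_complex_of_real)
  finally show ?thesis
    unfolding exponent_C_def char_exponent_eq by (simp add: power_mult_distrib algebra_simps)
qed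

lemma
  shows integrable_real_kernel: "integrable \<nu> (\<lambda>y. exp (\<xi> * y) - 1 - \<xi> * y * indicator {y. \<bar>y\<bar> \<le> 1} y)"
    and exponent_C_real: "exponent_C (of_real \<xi>) = of_real (Psi \<xi>)"
proof -
  have eq: "exp (of_real \<xi> * complex_of_real y) - 1 - of_real \<xi> * of_real y = of_real (exp (\<xi> * y) - 1 - \<xi> * y)" for y
    by (simp add: exp_of_real[symmetric])
  have "integrable \<nu> (\<lambda>y. complex_of_real (exp (\<xi> * y) - 1 - \<xi> * y))"
    using nu_exp_integral(2)[of "of_real \<xi>"] unfolding eq .
  from integrable_Re[OF this] have i1: "integrable \<nu> (\<lambda>y. exp (\<xi> * y) - 1 - \<xi> * y)"
    by (simp only: Re_complex_of_real)
  have k: "exp (\<xi> * y) - 1 - \<xi> * y * indicator {y. \<bar>y\<bar> \<le> 1} y =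
     (exp (\<xi> * y) - 1 - \<xi> * y) + \<xi> * (y * indicator {y. \<not> \<bar>y\<bar> \<le> 1} y)" for y
    by (simp add: indicator_def)
  show "integrable \<nu> (\<lambda>y. exp (\<xi> * y) - 1 - \<xi> * y * indicator {y. \<bar>y\<bar> \<le> 1} y)"
    unfolding k by (intro Bochner_Integration.integrable_add i1 integrable_mult_right integrable_large_jump)
  have "(LINT y|\<nu>. exp (\<xi> * y) - 1 - \<xi> * y * indicator {y. \<bar>y\<bar> \<le> 1} y) =
     (LINT y|\<nu>. exp (\<xi> * y) - 1 - \<xi> * y) + \<xi> * large_jump_mean"
    unfolding k large_jump_mean_def
    by (subst Bochner_Integration.integral_add[OF i1 integrable_mult_right[OF integrable_large_jump]])
       (simp only: integral_mult_right_zero)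
  then show "exponent_C (of_real \<xi>) = of_real (Psi \<xi>)"
    unfolding exponent_C_def log_mgf_def eq integral_complex_of_real by simp
qed

lemma mgf_eq_exp_Psi:
  assumes t: "t \<ge> 0"
  shows "mgf \<xi> t = exp (t * Psi \<xi>)"
proof -
  have Lm [measurable]: "L t \<in> borel_measurable M" by (rule random_variable_L[OF t])
  note LE = holomorphic_exponential_integral[OF Lm nn_cosh_finite[OF t]]
  have iL: "integrable M (L t)"
  proof (rule Bochner_Integration.integrable_bound)
    show "integrable M (\<lambda>\<omega>. exp (1 * L t \<omega>) + exp ((- 1) * L t \<omega>))"
      by (intro Bochner_Integration.integrable_add integrable_exp_L t)
    have "\<bar>x\<bar> \<le> exp x + exp (- x)" for x :: real
      using exp_ge_add_one_self[of x] exp_ge_add_one_self[of "- x"] exp_gt_zero[of x] exp_gt_zero[of "- x"]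
      by linarith
    then show "AE \<omega> in M. norm (L t \<omega>) \<le> norm (exp (1 * L t \<omega>) + exp ((- 1) * L t \<omega>))"
      by (intro AE_I2) (simp add: add_nonneg_nonneg order_trans[OF _ abs_ge_self])
  qed simp
  \<comment> \<open>Orders zero and one are split off because the holomorphy lemma covers only the
    remainder; under \<open>M\<close> both are integrable.\<close>
  define F where "F z = 1 + z * of_real (expectation (L t)) + (\<integral>\<omega>. exp (z * of_real (L t \<omega>)) - 1 - z * of_real (L t \<omega>) \<partial>M)"
    for z :: complex
  have Feq: "F z = (\<integral>\<omega>. exp (z * of_real (L t \<omega>)) \<partial>M)" for z
  proof -
    have "(\<integral>\<omega>. exp (z * of_real (L t \<omega>)) \<partial>M) =
       (\<integral>\<omega>. (exp (z * of_real (L t \<omega>)) - 1 - z * of_real (L t \<omega>)) + (1 + z * of_real (L t \<omega>)) \<partial>M)"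
      by (rule Bochner_Integration.integral_cong) simp_all
    also have "\<dots> = (\<integral>\<omega>. exp (z * of_real (L t \<omega>)) - 1 - z * of_real (L t \<omega>) \<partial>M) + (\<integral>\<omega>. 1 + z * of_real (L t \<omega>) \<partial>M)"
      by (rule Bochner_Integration.integral_add[OF LE(2)]) (use iL in simp)
    also have "(\<integral>\<omega>. 1 + z * of_real (L t \<omega>) \<partial>M) = 1 + z * of_real (expectation (L t))"
      using iL by (simp add: prob_space)
    finally show ?thesis by (simp add: F_def)
  qed
  have hol: "(\<lambda>z. F z - exp (of_real t * exponent_C z)) holomorphic_on UNIV"
    unfolding F_def by (intro holomorphic_intros LE(1) exponent_C_holomorphic)
  have zero: "F z - exp (of_real t * exponent_C z) = 0" if "z \<in> {z. Re z = 0}" for z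
  proof -
    have z: "z = \<i> * of_real (Im z)" using that by (simp add: complex_eq_iff)
    have "exp (\<i> * of_real (Im z) * of_real (L t \<omega>)) = iexp (Im z * L t \<omega>)" for \<omega>
      by (simp add: mult.assoc)
    then have "F z = exp (of_real t * char_exponent (Im z))"
      unfolding Feq char_function[OF t, symmetric] by (subst z) (simp only:)
    also have "char_exponent (Im z) = exponent_C z" using exponent_C_imaginary[of "Im z"] z by simp
    finally show ?thesis by simp
  qed
  have lim: "0 islimpt {z. Re z = 0}"
    unfolding islimpt_approachable
  proof (intro allI impI)
    fix e :: real assume "0 < e"
    then show "\<exists>x'\<in>{z. Re z = 0}. x' \<noteq> 0 \<and> dist x' 0 < e"
      by (intro bexI[of _ "\<i> * of_real (e / 2)"]) (auto simp: norm_mult)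
  qed
  have "F (of_real \<xi>) - exp (of_real t * exponent_C (of_real \<xi>)) = 0"
    by (rule analytic_continuation[OF hol open_UNIV connected_UNIV _ _ lim zero]) auto
  then have "(\<integral>\<omega>. exp (of_real \<xi> * of_real (L t \<omega>)) \<partial>M) = exp (of_real t * exponent_C (of_real \<xi>))"
    unfolding Feq by simp
  moreover have "(\<integral>\<omega>. exp (of_real \<xi> * complex_of_real (L t \<omega>)) \<partial>M) = of_real (mgf \<xi> t)"
    unfolding mgf_def integral_complex_of_real[symmetric] by (simp add: exp_of_real[symmetric])
  ultimately have "complex_of_real (mgf \<xi> t) = of_real (exp (t * Psi \<xi>))"
    by (simp add: exponent_C_real exp_of_real[symmetric])
  then show ?thesis using of_real_eq_iff by blast
qed

text \<open>Taken from the entire extension, so that nothing has to be differentiated under the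
  integral sign.\<close>

definition Psi_deriv :: "real \<Rightarrow> real" where
  "Psi_deriv \<xi> = Re (deriv exponent_C (of_real \<xi>))"

lemma Psi_has_derivative: "(Psi has_real_derivative Psi_deriv \<xi>) (at \<xi>)"
proof -
  have "(exponent_C has_field_derivative deriv exponent_C (of_real \<xi>)) (at (of_real \<xi>))"
    using holomorphic_derivI[OF exponent_C_holomorphic open_UNIV] by simp
  from has_vector_derivative_real_field[OF this]
  have "((\<lambda>x. Re (exponent_C (of_real x))) has_vector_derivative Psi_deriv \<xi>) (at \<xi>)"
    unfolding Psi_deriv_def by (rule bounded_linear.has_vector_derivative[OF bounded_linear_Re])
  then show ?thesis by (simp add: exponent_C_real has_real_derivative_iff_has_vector_derivative)
qed

lemma Psi_0 [simp]: "Psi 0 = 0"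
  by (simp add: log_mgf_def)

lemma Psi_continuous: "continuous_on UNIV Psi"
  by (intro continuous_at_imp_continuous_on ballI DERIV_isCont[OF Psi_has_derivative])

text \<open>The exponential is convex under the integral, the square is convex, and drift and
  compensator are linear in \<xi>.\<close>

lemma Psi_convex: "convex_on UNIV Psi"
proof (rule convex_onI)
  fix t x y :: real assume t: "0 < t" "t < 1"
  let ?c = "(1 - t) * x + t * y"
  let ?k = "\<lambda>\<xi> y. exp (\<xi> * y) - 1 - \<xi> * y * indicator {y. \<bar>y\<bar> \<le> 1} y :: real"
  have "(\<integral>u. ?k ?c u \<partial>\<nu>) \<le> (\<integral>u. (1 - t) * ?k x u + t * ?k y u \<partial>\<nu>)"
  proof (rule integral_mono)
    fix u
    have "exp (?c * u) \<le> (1 - t) * exp (x * u) + t * exp (y * u)"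
      using convex_onD[OF exp_convex, of t "x * u" "y * u"] t by (simp add: algebra_simps)
    then show "?k ?c u \<le> (1 - t) * ?k x u + t * ?k y u"
      by (simp add: algebra_simps)
  qed (intro integrable_real_kernel Bochner_Integration.integrable_add integrable_mult_right)+
  also have "\<dots> = (1 - t) * (\<integral>u. ?k x u \<partial>\<nu>) + t * (\<integral>u. ?k y u \<partial>\<nu>)"
    by (subst Bochner_Integration.integral_add, (intro integrable_mult_right integrable_real_kernel)+)
       (simp only: integral_mult_right_zero)
  finally have 1: "(\<integral>u. ?k ?c u \<partial>\<nu>) \<le> (1 - t) * (\<integral>u. ?k x u \<partial>\<nu>) + t * (\<integral>u. ?k y u \<partial>\<nu>)" .
  have "(1 - t) * x\<^sup>2 + t * y\<^sup>2 - ?c\<^sup>2 = t * (1 - t) * (x - y)\<^sup>2"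
    by (simp add: power2_eq_square algebra_simps)
  moreover have "\<dots> \<ge> 0" using t by simp
  ultimately have "?c\<^sup>2 \<le> (1 - t) * x\<^sup>2 + t * y\<^sup>2" by linarith
  then have "\<sigma>\<^sup>2 / 2 * ?c\<^sup>2 \<le> \<sigma>\<^sup>2 / 2 * ((1 - t) * x\<^sup>2 + t * y\<^sup>2)"
    by (rule mult_left_mono) simp
  moreover
  define I where "I \<xi> = (\<integral>u. ?k \<xi> u \<partial>\<nu>)" for \<xi>
  ultimately have "a * ?c + \<sigma>\<^sup>2 / 2 * ?c\<^sup>2 + I ?c \<le> a * ?c + \<sigma>\<^sup>2 / 2 * ((1 - t) * x\<^sup>2 + t * y\<^sup>2) + ((1 - t) * I x + t * I y)"
    using 1 by (intro add_mono) simp_all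
  also have "\<dots> = (1 - t) * (a * x + \<sigma>\<^sup>2 / 2 * x\<^sup>2 + I x) + t * (a * y + \<sigma>\<^sup>2 / 2 * y\<^sup>2 + I y)"
    by (simp only: distrib_left left_diff_distrib right_diff_distrib mult_1_left add_ac mult_ac diff_conv_add_uminus minus_add_distrib)
  finally show "Psi ((1 - t) *\<^sub>R x + t *\<^sub>R y) \<le> (1 - t) * Psi x + t * Psi y"
    unfolding log_mgf_def I_def by simp
qed simp

text \<open>Says that the exponential of a multiple of an increment, tilted by \<xi> and centred
  with slope \<open>Psi_deriv \<xi>\<close>, has mean at least one. This is the submartingale
  hypothesis of the maximal inequality.\<close>

lemma Psi_tangent: "Psi \<xi> + (\<eta> - \<xi>) * Psi_deriv \<xi> \<le> Psi \<eta>"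
proof -
  have "Psi_deriv \<xi> * (\<eta> - \<xi>) \<le> Psi \<eta> - Psi \<xi>"
    by (rule convex_on_imp_above_tangent[OF Psi_convex]) (auto intro: Psi_has_derivative)
  then show ?thesis by (simp add: mult.commute)
qed

lemma nn_integral_exp_increment:
  assumes "s \<ge> 0" "h \<ge> 0"
  shows "(\<integral>\<^sup>+\<omega>. ennreal (exp (\<theta> * (L (s + h) \<omega> - L s \<omega>))) \<partial>M) = ennreal (exp (h * Psi \<theta>))"
  using nn_integral_increment[of "\<lambda>x. ennreal (exp (\<theta> * x))" s h] nn_mgf_eq[of h \<theta>] mgf_eq_exp_Psi[of h \<theta>] assms
  by (simp add: nn_mgf_def)

end

section \<open>A maximal inequality under block-wise tilting\<close>

context prob_space
begin

lemma indep_var_nn_integral: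
  fixes X Y :: "'a \<Rightarrow> ennreal"
  assumes "indep_var borel X borel Y"
  shows "(\<integral>\<^sup>+\<omega>. X \<omega> * Y \<omega> \<partial>M) = (\<integral>\<^sup>+\<omega>. X \<omega> \<partial>M) * (\<integral>\<^sup>+\<omega>. Y \<omega> \<partial>M)"
proof -
  have b: "(\<lambda>_. borel) = case_bool borel borel" by (auto split: bool.split)
  have "indep_vars (\<lambda>_. borel) (case_bool X Y) UNIV"
    using assms unfolding indep_var_def b .
  from indep_vars_nn_integral[OF _ this] show ?thesis
    by (simp add: UNIV_bool mult.commute)
qed

text \<open>Plays the part of conditioning on the first \<open>k\<close> increments: the maximal
  inequality works with this factorisation instead of a filtration.\<close>

lemma indep_vars_nn_integral_prefix:
  fixes X :: "nat \<Rightarrow> 'a \<Rightarrow> real" and F :: "(nat \<Rightarrow> real) \<Rightarrow> ennreal"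
  assumes X: "indep_vars (\<lambda>_. borel) X {..<n}" and k: "k < n"
    and F: "F \<in> borel_measurable (PiM {..<k} (\<lambda>_. borel))" and h: "h \<in> borel_measurable borel"
  shows "(\<integral>\<^sup>+\<omega>. F (\<lambda>i\<in>{..<k}. X i \<omega>) * h (X k \<omega>) \<partial>M) =
    (\<integral>\<^sup>+\<omega>. F (\<lambda>i\<in>{..<k}. X i \<omega>) \<partial>M) * (\<integral>\<^sup>+\<omega>. h (X k \<omega>) \<partial>M)"
proof -
  have "indep_var (PiM {..<k} (\<lambda>_. borel)) (\<lambda>\<omega>. restrict (\<lambda>i. X i \<omega>) {..<k})
      (PiM {k} (\<lambda>_. borel)) (\<lambda>\<omega>. restrict (\<lambda>i. X i \<omega>) {k})"
    by (rule indep_var_restrict[OF X]) (use k in auto)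
  moreover have "(\<lambda>x. h (x k)) \<in> borel_measurable (PiM {k} (\<lambda>_. borel))"
    by (rule measurable_compose[where f="\<lambda>x. x k", OF _ h])
       (use measurable_component_singleton[of k "{k}" "\<lambda>_. borel"] in simp)
  ultimately have "indep_var borel (F \<circ> (\<lambda>\<omega>. restrict (\<lambda>i. X i \<omega>) {..<k})) borel
      ((\<lambda>x. h (x k)) \<circ> (\<lambda>\<omega>. restrict (\<lambda>i. X i \<omega>) {k}))"
    using F by (intro indep_var_compose)
  from indep_var_nn_integral[OF this] show ?thesis by (simp add: comp_def)
qed

text \<open>Doob's maximal inequality for the product martingale, under the tilted law with density
  \<open>\<Prod>i. w i (X i)\<close>. Tilting inside the integral avoids a change of the underlying measure.\<close>

lemma weighted_maximal_inequality:
  fixes X :: "nat \<Rightarrow> 'a \<Rightarrow> real" and w g :: "nat \<Rightarrow> real \<Rightarrow> ennreal"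
  assumes X: "indep_vars (\<lambda>_. borel) X {..<n}"
    and wm [measurable]: "\<And>i. w i \<in> borel_measurable borel"
    and gm [measurable]: "\<And>i. g i \<in> borel_measurable borel"
    and w1: "\<And>i. i < n \<Longrightarrow> (\<integral>\<^sup>+\<omega>. w i (X i \<omega>) \<partial>M) = 1"
    and wg: "\<And>i. i < n \<Longrightarrow> (\<integral>\<^sup>+\<omega>. w i (X i \<omega>) * g i (X i \<omega>) \<partial>M) \<ge> 1"
  shows "y * (\<integral>\<^sup>+\<omega>. (\<Prod>i<n. w i (X i \<omega>)) * indicator {\<omega> \<in> space M. \<exists>j\<le>n. y \<le> (\<Prod>i<j. g i (X i \<omega>))} \<omega> \<partial>M)
    \<le> (\<Prod>i<n. \<integral>\<^sup>+\<omega>. w i (X i \<omega>) * g i (X i \<omega>) \<partial>M)"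
proof -
  have Xm [measurable]: "X i \<in> borel_measurable M" if "i < n" for i
    using X that by (auto simp: indep_vars_def)
  define W where "W k x = (\<Prod>i<k. w i (x i))" for k and x :: "nat \<Rightarrow> real"
  define G where "G k x = (\<Prod>i<k. g i (x i))" for k and x :: "nat \<Rightarrow> real"
  define A where "A k = {x. \<exists>j\<le>k. y \<le> G j x}" for k
  define Z where "Z \<omega> i = X i \<omega>" for \<omega> i
  have cm: "(\<lambda>x. f (x i)) \<in> borel_measurable (PiM {..<k} (\<lambda>_. borel))"
    if "i < k" "f \<in> borel_measurable borel" for f :: "real \<Rightarrow> ennreal" and i k
    by (rule measurable_compose[where f="\<lambda>x. x i", OF _ that(2)])
       (use measurable_component_singleton[of i "{..<k}" "\<lambda>_. borel"] that(1) in simp)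
  have Wm: "W j \<in> borel_measurable (PiM {..<k} (\<lambda>_. borel))" if "j \<le> k" for j k
    unfolding W_def by (intro borel_measurable_prod_ennreal cm wm) (use that in auto)
  have Gm: "G j \<in> borel_measurable (PiM {..<k} (\<lambda>_. borel))" if "j \<le> k" for j k
    unfolding G_def by (intro borel_measurable_prod_ennreal cm gm) (use that in auto)
  have Am: "(indicator (A k) :: (nat \<Rightarrow> real) \<Rightarrow> ennreal) \<in> borel_measurable (PiM {..<k} (\<lambda>_. borel))" for k
  proof -
    have "{x \<in> space (PiM {..<k} (\<lambda>_. borel)). x \<in> A k} = (\<Union>j\<in>{..k}. {x \<in> space (PiM {..<k} (\<lambda>_. borel)). y \<le> G j x})"
      by (auto simp: A_def)
    also have "\<dots> \<in> sets (PiM {..<k} (\<lambda>_. borel))"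
      using Gm by (intro sets.finite_UN borel_measurable_le) auto
    finally show ?thesis by (subst borel_measurable_indicator_iff) (simp add: Int_def conj_commute)
  qed
  \<comment> \<open>\<open>W\<close>, \<open>G\<close> and \<open>A\<close> look only at the first
    \<open>k\<close> coordinates, so the restricted family, for which independence and measurability
    are stated, may be exchanged for \<open>Z \<omega>\<close>.\<close>
  have res: "W k (\<lambda>i\<in>{..<k}. X i \<omega>) = W k (Z \<omega>)" "G k (\<lambda>i\<in>{..<k}. X i \<omega>) = G k (Z \<omega>)"
    "indicator (A k) (\<lambda>i\<in>{..<k}. X i \<omega>) = (indicator (A k) (Z \<omega>) :: ennreal)" for k \<omega>
  proof -
    have "G j (\<lambda>i\<in>{..<k}. X i \<omega>) = G j (Z \<omega>)" if "j \<le> k" for j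
      unfolding G_def Z_def using that by (intro prod.cong) auto
    then show "G k (\<lambda>i\<in>{..<k}. X i \<omega>) = G k (Z \<omega>)"
      "indicator (A k) (\<lambda>i\<in>{..<k}. X i \<omega>) = (indicator (A k) (Z \<omega>) :: ennreal)"
      by (auto simp: indicator_def A_def)
    show "W k (\<lambda>i\<in>{..<k}. X i \<omega>) = W k (Z \<omega>)"
      unfolding W_def Z_def by (intro prod.cong) auto
  qed
  have pre: "(\<lambda>\<omega>. F (\<lambda>i\<in>{..<k}. X i \<omega>)) \<in> borel_measurable M"
    if "k \<le> n" "F \<in> borel_measurable (PiM {..<k} (\<lambda>_. borel))" for k and F :: "(nat \<Rightarrow> real) \<Rightarrow> ennreal"
    by (rule measurable_compose[OF measurable_restrict that(2)]) (use that(1) in \<open>auto intro!: Xm\<close>)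
  have mW: "(\<lambda>\<omega>. W k (Z \<omega>)) \<in> borel_measurable M" and mG: "(\<lambda>\<omega>. G k (Z \<omega>)) \<in> borel_measurable M"
    and mA: "(\<lambda>\<omega>. indicator (A k) (Z \<omega>) :: ennreal) \<in> borel_measurable M" if "k \<le> n" for k
    using pre[OF that Wm[OF order_refl]] pre[OF that Gm[OF order_refl]] pre[OF that Am] by (simp_all only: res)
  have split: "(\<integral>\<^sup>+\<omega>. F (Z \<omega>) * h (X k \<omega>) \<partial>M) = (\<integral>\<^sup>+\<omega>. F (Z \<omega>) \<partial>M) * (\<integral>\<^sup>+\<omega>. h (X k \<omega>) \<partial>M)"
    if "k < n" "F \<in> borel_measurable (PiM {..<k} (\<lambda>_. borel))" "h \<in> borel_measurable borel"
      "\<And>\<omega>. F (\<lambda>i\<in>{..<k}. X i \<omega>) = F (Z \<omega>)" for F :: "(nat \<Rightarrow> real) \<Rightarrow> ennreal" and h k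
    using indep_vars_nn_integral_prefix[OF X that(1-3)] by (simp only: that(4))
  \<comment> \<open>Optional stopping as an induction: points already above the level gain a factor
    of weighted mean at least one, and points that reach it in the current step satisfy
    \<open>y \<le> G\<close> by definition.\<close>
  have claim: "y * (\<integral>\<^sup>+\<omega>. W k (Z \<omega>) * indicator (A k) (Z \<omega>) \<partial>M) \<le> (\<integral>\<^sup>+\<omega>. W k (Z \<omega>) * G k (Z \<omega>) * indicator (A k) (Z \<omega>) \<partial>M)"
    if "k \<le> n" for k
    using that
  proof (induction k)
    case 0
    show ?case by (simp add: W_def G_def A_def indicator_def emeasure_space_1)
  next
    case (Suc k)
    then have k: "k < n" "k \<le> n" by auto
    let ?new = "\<lambda>\<omega>. indicator {x. x \<notin> A k \<and> y \<le> G (Suc k) x} (Z \<omega>) :: ennreal"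
    have Wk: "W (Suc k) (Z \<omega>) = W k (Z \<omega>) * w k (X k \<omega>)" and Gk: "G (Suc k) (Z \<omega>) = G k (Z \<omega>) * g k (X k \<omega>)" for \<omega>
      by (simp_all add: W_def G_def Z_def)
    have Ak: "indicator (A (Suc k)) (Z \<omega>) = indicator (A k) (Z \<omega>) + ?new \<omega>" for \<omega>
      by (auto simp: A_def indicator_def le_Suc_eq)
    have new_m: "?new \<in> borel_measurable M"
    proof -
      \<comment> \<open>As a difference of two indicators already known to be measurable,
        \<open>?new\<close> needs no description in the product space.\<close>
      have "?new = (\<lambda>\<omega>. indicator (A (Suc k)) (Z \<omega>) - indicator (A k) (Z \<omega>))"
      proof
        fix \<omega>
        show "?new \<omega> = indicator (A (Suc k)) (Z \<omega>) - indicator (A k) (Z \<omega>)"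
          by (cases "\<exists>j\<le>k. y \<le> G j (Z \<omega>)"; cases "y \<le> G (Suc k) (Z \<omega>)")
             (auto simp: A_def indicator_def le_Suc_eq)
      qed
      then show ?thesis using mA[OF Suc.prems] mA[OF k(2)] by (simp only: borel_measurable_minus_ennreal)
    qed
    note [measurable] = mW[OF k(2)] mG[OF k(2)] mA[OF k(2)] mW[OF Suc.prems] mG[OF Suc.prems] new_m Xm[OF k(1)]
    have "y * (\<integral>\<^sup>+\<omega>. W (Suc k) (Z \<omega>) * indicator (A k) (Z \<omega>) \<partial>M) =
        y * (\<integral>\<^sup>+\<omega>. (W k (Z \<omega>) * indicator (A k) (Z \<omega>)) * w k (X k \<omega>) \<partial>M)"
      by (simp add: Wk ac_simps)
    also have "\<dots> = y * ((\<integral>\<^sup>+\<omega>. W k (Z \<omega>) * indicator (A k) (Z \<omega>) \<partial>M) * (\<integral>\<^sup>+\<omega>. w k (X k \<omega>) \<partial>M))"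
      by (subst split[of k "\<lambda>x. W k x * indicator (A k) x" "w k"])
         (use k(1) Wm Am res in \<open>auto intro!: borel_measurable_times_ennreal\<close>)
    also have "\<dots> \<le> (\<integral>\<^sup>+\<omega>. W k (Z \<omega>) * G k (Z \<omega>) * indicator (A k) (Z \<omega>) \<partial>M)"
      using Suc.IH k w1[OF k(1)] by simp
    also have "\<dots> \<le> (\<integral>\<^sup>+\<omega>. W k (Z \<omega>) * G k (Z \<omega>) * indicator (A k) (Z \<omega>) \<partial>M) * (\<integral>\<^sup>+\<omega>. w k (X k \<omega>) * g k (X k \<omega>) \<partial>M)"
      using mult_left_mono[OF wg[OF k(1)]] by fastforce
    also have "\<dots> = (\<integral>\<^sup>+\<omega>. (W k (Z \<omega>) * G k (Z \<omega>) * indicator (A k) (Z \<omega>)) * (w k (X k \<omega>) * g k (X k \<omega>)) \<partial>M)"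
      by (subst split[of k "\<lambda>x. W k x * G k x * indicator (A k) x" "\<lambda>x. w k x * g k x"])
         (use k(1) Wm Gm Am res in \<open>auto intro!: borel_measurable_times_ennreal\<close>)
    also have "\<dots> = (\<integral>\<^sup>+\<omega>. W (Suc k) (Z \<omega>) * G (Suc k) (Z \<omega>) * indicator (A k) (Z \<omega>) \<partial>M)"
      by (simp add: Wk Gk ac_simps)
    finally have old: "y * (\<integral>\<^sup>+\<omega>. W (Suc k) (Z \<omega>) * indicator (A k) (Z \<omega>) \<partial>M) \<le>
       (\<integral>\<^sup>+\<omega>. W (Suc k) (Z \<omega>) * G (Suc k) (Z \<omega>) * indicator (A k) (Z \<omega>) \<partial>M)" .
    have new: "y * (\<integral>\<^sup>+\<omega>. W (Suc k) (Z \<omega>) * ?new \<omega> \<partial>M) \<le> (\<integral>\<^sup>+\<omega>. W (Suc k) (Z \<omega>) * G (Suc k) (Z \<omega>) * ?new \<omega> \<partial>M)"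
    proof -
      have "y * (\<integral>\<^sup>+\<omega>. W (Suc k) (Z \<omega>) * ?new \<omega> \<partial>M) = (\<integral>\<^sup>+\<omega>. y * (W (Suc k) (Z \<omega>) * ?new \<omega>) \<partial>M)"
        by (rule nn_integral_cmult[symmetric]) measurable
      also have "\<dots> \<le> (\<integral>\<^sup>+\<omega>. W (Suc k) (Z \<omega>) * G (Suc k) (Z \<omega>) * ?new \<omega> \<partial>M)"
      proof (rule nn_integral_mono)
        fix \<omega>
        show "y * (W (Suc k) (Z \<omega>) * ?new \<omega>) \<le> W (Suc k) (Z \<omega>) * G (Suc k) (Z \<omega>) * ?new \<omega>"
        proof (cases "Z \<omega> \<notin> A k \<and> y \<le> G (Suc k) (Z \<omega>)")
          case True
          then have "W (Suc k) (Z \<omega>) * y \<le> W (Suc k) (Z \<omega>) * G (Suc k) (Z \<omega>)"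
            by (intro mult_left_mono) auto
          then show ?thesis using True by (simp add: mult.commute)
        next
          case False
          then have "?new \<omega> = 0" by (simp add: indicator_def)
          then show ?thesis by simp
        qed
      qed
      finally show ?thesis .
    qed
    have "y * (\<integral>\<^sup>+\<omega>. W (Suc k) (Z \<omega>) * indicator (A (Suc k)) (Z \<omega>) \<partial>M) =
       y * (\<integral>\<^sup>+\<omega>. W (Suc k) (Z \<omega>) * indicator (A k) (Z \<omega>) \<partial>M) + y * (\<integral>\<^sup>+\<omega>. W (Suc k) (Z \<omega>) * ?new \<omega> \<partial>M)"
      unfolding Ak distrib_left by (subst nn_integral_add) (auto simp: distrib_left)
    also have "\<dots> \<le> (\<integral>\<^sup>+\<omega>. W (Suc k) (Z \<omega>) * G (Suc k) (Z \<omega>) * indicator (A k) (Z \<omega>) \<partial>M) +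
        (\<integral>\<^sup>+\<omega>. W (Suc k) (Z \<omega>) * G (Suc k) (Z \<omega>) * ?new \<omega> \<partial>M)"
      by (intro add_mono old new)
    also have "\<dots> = (\<integral>\<^sup>+\<omega>. W (Suc k) (Z \<omega>) * G (Suc k) (Z \<omega>) * indicator (A (Suc k)) (Z \<omega>) \<partial>M)"
      unfolding Ak distrib_left by (subst nn_integral_add) auto
    finally show ?case .
  qed
  have ind: "indicator {\<omega> \<in> space M. \<exists>j\<le>n. y \<le> (\<Prod>i<j. g i (X i \<omega>))} \<omega> = (indicator (A n) (Z \<omega>) :: ennreal)"
    if "\<omega> \<in> space M" for \<omega>
    using that by (simp add: indicator_def A_def G_def Z_def)
  have "(\<integral>\<^sup>+\<omega>. (\<Prod>i<n. w i (X i \<omega>)) * indicator {\<omega> \<in> space M. \<exists>j\<le>n. y \<le> (\<Prod>i<j. g i (X i \<omega>))} \<omega> \<partial>M) =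
     (\<integral>\<^sup>+\<omega>. W n (Z \<omega>) * indicator (A n) (Z \<omega>) \<partial>M)"
    by (rule nn_integral_cong) (simp add: ind W_def Z_def)
  then have "y * (\<integral>\<^sup>+\<omega>. (\<Prod>i<n. w i (X i \<omega>)) * indicator {\<omega> \<in> space M. \<exists>j\<le>n. y \<le> (\<Prod>i<j. g i (X i \<omega>))} \<omega> \<partial>M)
     \<le> (\<integral>\<^sup>+\<omega>. W n (Z \<omega>) * G n (Z \<omega>) * indicator (A n) (Z \<omega>) \<partial>M)"
    using claim[of n] by simp
  also have "\<dots> \<le> (\<integral>\<^sup>+\<omega>. (\<Prod>i<n. w i (X i \<omega>) * g i (X i \<omega>)) \<partial>M)"
    by (rule nn_integral_mono) (simp add: W_def G_def Z_def prod.distrib indicator_def)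
  also have "\<dots> = (\<Prod>i<n. \<integral>\<^sup>+\<omega>. w i (X i \<omega>) * g i (X i \<omega>) \<partial>M)"
  proof (rule indep_vars_nn_integral)
    show "indep_vars (\<lambda>_. borel) (\<lambda>i \<omega>. w i (X i \<omega>) * g i (X i \<omega>)) {..<n}"
      by (rule indep_vars_compose2[OF X]) measurable
  qed auto
  finally show ?thesis .
qed

end

section \<open>Polygons on equal blocks\<close>

text \<open>For \<open>T \<ge> 0\<close>, \<open>min T (max 0 (u - real b * T))\<close> is the time
  spent in block \<open>b\<close> up to \<open>u\<close>. In this form continuity and the Lipschitz
  bound need no case distinction over blocks, and the path is constant after the last one.\<close>

definition polygon :: "nat \<Rightarrow> real \<Rightarrow> (nat \<Rightarrow> real) \<Rightarrow> real \<Rightarrow> real" where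
  "polygon m T p u = (\<Sum>b<m. p b * min T (max 0 (u - real b * T)))"

lemma polygon_isCont: "isCont (polygon m T p) u"
  unfolding polygon_def by (intro continuous_intros)

lemma polygon_0 [simp]: "0 \<le> T \<Longrightarrow> polygon m T p 0 = 0"
  by (auto simp: polygon_def intro!: sum.neutral)

text \<open>The grid refines the blocks, so no step crosses a vertex and only the summand of block
  \<open>j div N\<close> moves.\<close>

lemma polygon_step:
  assumes T: "0 < T" and N: "0 < N" and j: "j < m * N"
  shows "polygon m T p (real (Suc j) * (T / real N)) - polygon m T p (real j * (T / real N)) = (T / real N) * p (j div N)"
proof -
  define h where "h = T / real N"
  have h: "h > 0" "T = real N * h" using T N by (auto simp: h_def)
  have one: "min T (max 0 (real (Suc j) * h - real b * T)) - min T (max 0 (real j * h - real b * T)) =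
      (if b = j div N then h else 0)" for b
  proof -
    have e: "real i * h - real b * T = (real i - real (b * N)) * h" for i
      using h by (simp add: algebra_simps)
    consider "b < j div N" | "b = j div N" | "j div N < b" by linarith
    then show ?thesis
    proof cases
      case 1
      then have "Suc b * N \<le> (j div N) * N" by (intro mult_right_mono) auto
      also have "\<dots> \<le> j" by simp
      finally have "b * N + N \<le> j" by simp
      then have "real N \<le> real j - real (b * N)" by linarith
      then have "T \<le> (real j - real (b * N)) * h" "T \<le> (real (Suc j) - real (b * N)) * h"
        using h by (auto intro!: mult_right_mono)
      then show ?thesis unfolding e using 1 T by (simp add: min_absorb1 max_absorb2)
    next
      case 2
      define r where "r = j mod N"
      have "b * N + r = j" using 2 by (simp add: r_def)
      then have "real (b * N) + real r = real j" by (metis of_nat_add)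
      then have r: "r < N" "real j - real (b * N) = real r" using N by (auto simp: r_def)
      have r': "real (Suc j) - real (b * N) = real r + 1" using r(2) by simp
      have "real r * h \<le> T" "(real r + 1) * h \<le> T" using r(1) h by (auto intro!: mult_right_mono)
      then show ?thesis unfolding e r(2) r' using 2 h by (simp add: min_absorb2 max_absorb2 algebra_simps)
    next
      case 3
      have "j < Suc (j div N) * N" using dividend_less_div_times[OF N, of j] by simp
      also have "\<dots> \<le> b * N" using 3 by (intro mult_right_mono) auto
      finally have "Suc j \<le> b * N" by simp
      then have "real (Suc j) \<le> real (b * N)" by (simp only: of_nat_le_iff)
      then have "(real j - real (b * N)) * h \<le> 0" "(real (Suc j) - real (b * N)) * h \<le> 0"
        using h by (auto intro!: mult_nonpos_nonneg)
      then show ?thesis unfolding e using 3 T by (simp add: max_absorb1 min_absorb2)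
    qed
  qed
  have "polygon m T p (real (Suc j) * h) - polygon m T p (real j * h) =
      (\<Sum>b<m. p b * (min T (max 0 (real (Suc j) * h - real b * T)) - min T (max 0 (real j * h - real b * T))))"
    unfolding polygon_def by (simp add: sum_subtractf right_diff_distrib)
  also have "\<dots> = (\<Sum>b<m. if b = j div N then p b * h else 0)"
    unfolding one by (intro sum.cong) auto
  also have "\<dots> = p (j div N) * h"
    using j N by (simp add: sum.delta less_mult_imp_div_less)
  finally show ?thesis by (simp add: h_def mult.commute)
qed

lemma sum_blocks: "(\<Sum>i<m * N. f i) = (\<Sum>b<m. \<Sum>i=b * N..<b * N + N. f i)" for f :: "nat \<Rightarrow> real"
  by (rule sum.nat_group[symmetric])

lemma sum_blocks_div:
  fixes f g :: "nat \<Rightarrow> real"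
  assumes "0 < (N :: nat)"
  shows "(\<Sum>i<m * N. f (i div N) * g i) = (\<Sum>b<m. f b * (\<Sum>i=b * N..<b * N + N. g i))"
  unfolding sum_blocks sum_distrib_left
proof (intro sum.cong refl)
  fix b i assume "i \<in> {b * N..<b * N + N}"
  then have "i div N = b" using assms by (intro div_nat_eqI) (auto simp: mult.commute)
  then show "f (i div N) * g i = f b * g i" by simp
qed

lemma prod_ennreal_exp: "(\<Prod>i\<in>I. ennreal (exp (f i))) = ennreal (exp (\<Sum>i\<in>I. f i))" if "finite I"
  using that by (simp add: prod_ennreal exp_sum)

context exponential_levy_process
begin

lemma nn_integral_exp_increment_affine:
  assumes "s \<ge> 0" "h \<ge> 0"
  shows "(\<integral>\<^sup>+\<omega>. ennreal (exp (\<theta> * (L (s + h) \<omega> - L s \<omega>) + c)) \<partial>M) = ennreal (exp (h * Psi \<theta> + c))"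
proof -
  have [measurable]: "L (s + h) \<in> borel_measurable M" "L s \<in> borel_measurable M"
    using assms by (auto intro!: random_variable_L)
  have "(\<integral>\<^sup>+\<omega>. ennreal (exp (\<theta> * (L (s + h) \<omega> - L s \<omega>) + c)) \<partial>M) =
     (\<integral>\<^sup>+\<omega>. ennreal (exp (\<theta> * (L (s + h) \<omega> - L s \<omega>))) * ennreal (exp c) \<partial>M)"
    by (simp add: exp_add ennreal_mult)
  also have "\<dots> = ennreal (exp (h * Psi \<theta>)) * ennreal (exp c)"
    by (subst nn_integral_multc) (simp_all add: nn_integral_exp_increment[OF assms])
  finally show ?thesis by (simp add: exp_add ennreal_mult)
qed

text \<open>The density of the law tilted by \<open>\<xi> b\<close> on the \<open>b\<close>-th block of length \<open>T\<close>.\<close>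

definition tilt :: "real \<Rightarrow> real \<Rightarrow> nat \<Rightarrow> (nat \<Rightarrow> real) \<Rightarrow> 'w \<Rightarrow> ennreal" where
  "tilt s T m \<xi> \<omega> = ennreal (exp (\<Sum>b<m. \<xi> b * (L (s + real (Suc b) * T) \<omega> - L (s + real b * T) \<omega>) - T * Psi (\<xi> b)))"

lemma indep_grid_increments:
  assumes "s \<ge> 0" "h \<ge> 0"
  shows "indep_vars (\<lambda>_. borel) (\<lambda>i \<omega>. L (s + real (Suc i) * h) \<omega> - L (s + real i * h) \<omega>) {..<n}"
  using independent_increments[of "\<lambda>i. s + real i * h" n] assms by (simp add: mult_right_mono)

text \<open>Inside a block the increments telescope, so the product of the one-step densities is the
  same for every \<open>N\<close>. The grid can therefore be refined under a fixed density.\<close>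

lemma tilt_grid:
  assumes N: "0 < N"
  shows "(\<Prod>i<m * N. ennreal (exp (\<xi> (i div N) * (L (s + real (Suc i) * (T / N)) \<omega> - L (s + real i * (T / N)) \<omega>)
      - T / N * Psi (\<xi> (i div N))))) = tilt s T m \<xi> \<omega>"
proof -
  let ?l = "\<lambda>i. L (s + real i * (T / N)) \<omega>"
  have "(\<Sum>i<m * N. \<xi> (i div N) * (?l (Suc i) - ?l i) - T / N * Psi (\<xi> (i div N))) =
     (\<Sum>i<m * N. \<xi> (i div N) * (?l (Suc i) - ?l i)) - (\<Sum>i<m * N. Psi (\<xi> (i div N)) * (T / N))"
    by (simp add: sum_subtractf mult.commute)
  also have "\<dots> = (\<Sum>b<m. \<xi> b * (\<Sum>i=b * N..<b * N + N. ?l (Suc i) - ?l i)) - (\<Sum>b<m. Psi (\<xi> b) * (\<Sum>i=b * N..<b * N + N. T / N))"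
    by (simp only: sum_blocks_div[OF N, of \<xi>] sum_blocks_div[OF N, of "\<lambda>b. Psi (\<xi> b)"])
  also have "(\<Sum>b<m. \<xi> b * (\<Sum>i=b * N..<b * N + N. ?l (Suc i) - ?l i)) =
     (\<Sum>b<m. \<xi> b * (L (s + real (Suc b) * T) \<omega> - L (s + real b * T) \<omega>))"
  proof (intro sum.cong refl)
    fix b
    have "(\<Sum>i=b * N..<b * N + N. ?l (Suc i) - ?l i) = ?l (b * N + N) - ?l (b * N)"
      by (rule sum_Suc_diff') simp
    moreover have "real (b * N + N) * (T / N) = real (Suc b) * T" "real (b * N) * (T / N) = real b * T"
      using N by (auto simp: field_simps)
    ultimately show "\<xi> b * (\<Sum>i=b * N..<b * N + N. ?l (Suc i) - ?l i) = \<xi> b * (L (s + real (Suc b) * T) \<omega> - L (s + real b * T) \<omega>)"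
      by simp
  qed
  also have "(\<Sum>b<m. Psi (\<xi> b) * (\<Sum>i=b * N..<b * N + N. T / N)) = (\<Sum>b<m. T * Psi (\<xi> b))"
    using N by (intro sum.cong refl) simp
  finally show ?thesis
    unfolding tilt_def by (subst prod_ennreal_exp) (simp_all add: sum_subtractf)
qed

text \<open>By \<open>kappa\<close> each factor of \<open>exp (\<theta> * (L - polygon))\<close> has
  tilted mean at least one, so this process is a submartingale along the grid. An inequality
  suffices here, which later admits an artificial slope for the untilted process.\<close>

lemma
  assumes s: "s \<ge> 0" and T: "T > 0" and N: "0 < N"
    and kappa: "\<And>b. b < m \<Longrightarrow> Psi (\<xi> b) + \<theta> * p b \<le> Psi (\<xi> b + \<theta>)"
  shows tilt_measurable: "tilt s T m \<xi> \<in> borel_measurable M"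
    and nn_integral_tilt: "(\<integral>\<^sup>+\<omega>. tilt s T m \<xi> \<omega> \<partial>M) = 1"
    and grid_maximal: "(\<integral>\<^sup>+\<omega>. tilt s T m \<xi> \<omega> * indicator {\<omega> \<in> space M. \<exists>j\<le>m * N.
        x \<le> \<theta> * (L (s + real j * (T / N)) \<omega> - L s \<omega> - polygon m T p (real j * (T / N)))} \<omega> \<partial>M)
      \<le> ennreal (exp (T * (\<Sum>b<m. Psi (\<xi> b + \<theta>) - Psi (\<xi> b) - \<theta> * p b) - x))"
proof -
  define h where "h = T / real N"
  have h: "h > 0" using T N by (simp add: h_def)
  define X where "X i \<omega> = L (s + real (Suc i) * h) \<omega> - L (s + real i * h) \<omega>" for i \<omega>
  have Xeq: "X i = (\<lambda>\<omega>. L (s + real i * h + h) \<omega> - L (s + real i * h) \<omega>)" for i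
    by (auto simp: X_def algebra_simps)
  have ind: "indep_vars (\<lambda>_. borel) X {..<m * N}"
    unfolding X_def by (rule indep_grid_increments[OF s]) (use h in simp)
  have div: "i div N < m" if "i < m * N" for i using that by (rule less_mult_imp_div_less)
  define w where "w i x = ennreal (exp (\<xi> (i div N) * x - h * Psi (\<xi> (i div N))))" for i x
  define g where "g i x = ennreal (exp (\<theta> * (x - h * p (i div N))))" for i x
  have wm [measurable]: "w i \<in> borel_measurable borel" and gm [measurable]: "g i \<in> borel_measurable borel" for i
    unfolding w_def g_def by measurable
  have pos: "s + real i * h \<ge> 0" for i using s h by simp
  have W1: "(\<integral>\<^sup>+\<omega>. w i (X i \<omega>) \<partial>M) = 1" for i
    using nn_integral_exp_increment_affine[OF pos[of i], of h "\<xi> (i div N)" "- (h * Psi (\<xi> (i div N)))"] h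
    by (simp add: w_def Xeq)
  have WG: "(\<integral>\<^sup>+\<omega>. w i (X i \<omega>) * g i (X i \<omega>) \<partial>M) =
      ennreal (exp (h * (Psi (\<xi> (i div N) + \<theta>) - Psi (\<xi> (i div N)) - \<theta> * p (i div N))))" for i
  proof -
    have "w i x * g i x = ennreal (exp ((\<xi> (i div N) + \<theta>) * x + (- (h * Psi (\<xi> (i div N))) - \<theta> * h * p (i div N))))" for x
      unfolding w_def g_def by (simp add: ennreal_mult'[symmetric] exp_add[symmetric] algebra_simps)
    then have "(\<integral>\<^sup>+\<omega>. w i (X i \<omega>) * g i (X i \<omega>) \<partial>M) =
      (\<integral>\<^sup>+\<omega>. ennreal (exp ((\<xi> (i div N) + \<theta>) * (L (s + real i * h + h) \<omega> - L (s + real i * h) \<omega>)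
        + (- (h * Psi (\<xi> (i div N))) - \<theta> * h * p (i div N)))) \<partial>M)"
      by (simp only: Xeq)
    also have "\<dots> = ennreal (exp (h * Psi (\<xi> (i div N) + \<theta>) + (- (h * Psi (\<xi> (i div N))) - \<theta> * h * p (i div N))))"
      by (rule nn_integral_exp_increment_affine[OF pos less_imp_le[OF h]])
    finally show ?thesis by (simp add: algebra_simps)
  qed
  have tilt: "(\<Prod>i<m * N. w i (X i \<omega>)) = tilt s T m \<xi> \<omega>" for \<omega>
    unfolding w_def X_def h_def by (rule tilt_grid[OF N])
  have Xm: "X i \<in> borel_measurable M" if "i < m * N" for i using ind that by (auto simp: indep_vars_def)
  have "(\<lambda>\<omega>. \<Prod>i<m * N. w i (X i \<omega>)) \<in> borel_measurable M"
    by (intro borel_measurable_prod_ennreal measurable_compose[OF Xm wm]) simp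
  then show tm: "tilt s T m \<xi> \<in> borel_measurable M" unfolding tilt .
  have "(\<integral>\<^sup>+\<omega>. (\<Prod>i<m * N. w i (X i \<omega>)) \<partial>M) = (\<Prod>i<m * N. \<integral>\<^sup>+\<omega>. w i (X i \<omega>) \<partial>M)"
    by (rule indep_vars_nn_integral[OF _ indep_vars_compose2[OF ind]]) auto
  then show "(\<integral>\<^sup>+\<omega>. tilt s T m \<xi> \<omega> \<partial>M) = 1" unfolding tilt W1 by simp
  have G: "(\<Prod>i<j. g i (X i \<omega>)) = ennreal (exp (\<theta> * (L (s + real j * h) \<omega> - L s \<omega> - polygon m T p (real j * h))))"
    if "j \<le> m * N" for j \<omega>
    using that
  proof (induction j)
    case 0
    then show ?case using T by simp
  next
    case (Suc j)
    have st: "polygon m T p (real (Suc j) * h) = polygon m T p (real j * h) + h * p (j div N)"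
      using polygon_step[OF T N, of j m p] Suc.prems unfolding h_def by simp
    have "(\<Prod>i<Suc j. g i (X i \<omega>)) =
        ennreal (exp (\<theta> * (L (s + real j * h) \<omega> - L s \<omega> - polygon m T p (real j * h)))) * g j (X j \<omega>)"
      using Suc by simp
    also have "\<dots> = ennreal (exp (\<theta> * (L (s + real j * h) \<omega> - L s \<omega> - polygon m T p (real j * h)) + \<theta> * (X j \<omega> - h * p (j div N))))"
      unfolding g_def exp_add by (subst ennreal_mult) simp_all
    also have "\<theta> * (L (s + real j * h) \<omega> - L s \<omega> - polygon m T p (real j * h)) + \<theta> * (X j \<omega> - h * p (j div N)) =
        \<theta> * (L (s + real (Suc j) * h) \<omega> - L s \<omega> - polygon m T p (real (Suc j) * h))"
      unfolding X_def st by (simp add: right_diff_distrib distrib_left)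
    finally show ?case .
  qed
  have "ennreal (exp x) * (\<integral>\<^sup>+\<omega>. (\<Prod>i<m * N. w i (X i \<omega>)) * indicator {\<omega> \<in> space M. \<exists>j\<le>m * N. ennreal (exp x) \<le> (\<Prod>i<j. g i (X i \<omega>))} \<omega> \<partial>M)
    \<le> (\<Prod>i<m * N. \<integral>\<^sup>+\<omega>. w i (X i \<omega>) * g i (X i \<omega>) \<partial>M)"
  proof (rule weighted_maximal_inequality[OF ind wm gm W1])
    fix i assume i: "i < m * N"
    show "1 \<le> (\<integral>\<^sup>+\<omega>. w i (X i \<omega>) * g i (X i \<omega>) \<partial>M)"
    proof -
      have "0 \<le> h * (Psi (\<xi> (i div N) + \<theta>) - Psi (\<xi> (i div N)) - \<theta> * p (i div N))"
        by (rule mult_nonneg_nonneg) (use kappa[OF div[OF i]] h in simp_all)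
      then show ?thesis unfolding WG by (simp only: ennreal_ge_1 one_le_exp_iff)
    qed
  qed
  also have "\<dots> = ennreal (exp (\<Sum>i<m * N. h * (Psi (\<xi> (i div N) + \<theta>) - Psi (\<xi> (i div N)) - \<theta> * p (i div N))))"
    unfolding WG by (rule prod_ennreal_exp) simp
  also have "(\<Sum>i<m * N. h * (Psi (\<xi> (i div N) + \<theta>) - Psi (\<xi> (i div N)) - \<theta> * p (i div N))) =
     T * (\<Sum>b<m. Psi (\<xi> b + \<theta>) - Psi (\<xi> b) - \<theta> * p b)"
    using sum_blocks_div[OF N, where f="\<lambda>b. Psi (\<xi> b + \<theta>) - Psi (\<xi> b) - \<theta> * p b" and g="\<lambda>_. h" and m=m] N
    by (simp add: h_def sum_distrib_left mult.commute)
  finally have main: "ennreal (exp x) * (\<integral>\<^sup>+\<omega>. tilt s T m \<xi> \<omega> * indicator {\<omega> \<in> space M. \<exists>j\<le>m * N. ennreal (exp x) \<le> (\<Prod>i<j. g i (X i \<omega>))} \<omega> \<partial>M)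
     \<le> ennreal (exp (T * (\<Sum>b<m. Psi (\<xi> b + \<theta>) - Psi (\<xi> b) - \<theta> * p b)))"
    unfolding tilt .
  have ev: "{\<omega> \<in> space M. \<exists>j\<le>m * N. ennreal (exp x) \<le> (\<Prod>i<j. g i (X i \<omega>))} =
     {\<omega> \<in> space M. \<exists>j\<le>m * N. x \<le> \<theta> * (L (s + real j * (T / N)) \<omega> - L s \<omega> - polygon m T p (real j * (T / N)))}"
    using G by (auto simp: h_def)
  let ?I = "\<integral>\<^sup>+\<omega>. tilt s T m \<xi> \<omega> * indicator {\<omega> \<in> space M. \<exists>j\<le>m * N. x \<le> \<theta> * (L (s + real j * (T / N)) \<omega> - L s \<omega> - polygon m T p (real j * (T / N)))} \<omega> \<partial>M"
  have "ennreal (exp (- x)) * ennreal (exp x) = 1"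
    by (subst ennreal_mult[symmetric]) (simp_all add: exp_add[symmetric])
  then have "?I = ennreal (exp (- x)) * (ennreal (exp x) * ?I)"
    by (simp only: mult.assoc[symmetric] mult_1_left)
  also have "\<dots> \<le> ennreal (exp (- x)) * ennreal (exp (T * (\<Sum>b<m. Psi (\<xi> b + \<theta>) - Psi (\<xi> b) - \<theta> * p b)))"
    using main unfolding ev by (rule mult_left_mono) simp
  also have "\<dots> = ennreal (exp (T * (\<Sum>b<m. Psi (\<xi> b + \<theta>) - Psi (\<xi> b) - \<theta> * p b) - x))"
    by (subst ennreal_mult[symmetric]) (simp_all add: exp_add[symmetric])
  finally show "?I \<le> ennreal (exp (T * (\<Sum>b<m. Psi (\<xi> b + \<theta>) - Psi (\<xi> b) - \<theta> * p b) - x))" .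
qed

text \<open>Since the inequality is strict and paths are right-continuous, an excursion at
  \<open>u\<close> persists at dyadic points shortly after \<open>u\<close>. The event is thus an
  increasing union of grid events, which gives its measurability and, by Fatou, the bound.\<close>

lemma
  assumes s: "s \<ge> 0" and T: "T > 0"
    and kappa: "\<And>b. b < m \<Longrightarrow> Psi (\<xi> b) + \<theta> * p b \<le> Psi (\<xi> b + \<theta>)"
  shows path_excursion_measurable:
      "{\<omega> \<in> space M. \<exists>u\<in>{0..real m * T}. x < \<theta> * (L (s + u) \<omega> - L s \<omega> - polygon m T p u)} \<in> sets M" (is "?E \<in> _")
    and path_maximal: "(\<integral>\<^sup>+\<omega>. tilt s T m \<xi> \<omega> * indicator
        {\<omega> \<in> space M. \<exists>u\<in>{0..real m * T}. x < \<theta> * (L (s + u) \<omega> - L s \<omega> - polygon m T p u)} \<omega> \<partial>M)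
      \<le> ennreal (exp (T * (\<Sum>b<m. Psi (\<xi> b + \<theta>) - Psi (\<xi> b) - \<theta> * p b) - x))"
proof -
  define D where "D \<omega> u = \<theta> * (L (s + u) \<omega> - L s \<omega> - polygon m T p u)" for \<omega> u
  define E where "E n = {\<omega> \<in> space M. \<exists>j\<le>m * 2 ^ n. x < D \<omega> (real j * (T / real (2 ^ n)))}" for n
  have Em [measurable]: "E n \<in> sets M" for n
  proof -
    have Dm: "(\<lambda>\<omega>. D \<omega> (real j * (T / real (2 ^ n)))) \<in> borel_measurable M" for j
      unfolding D_def using s T
      by (intro borel_measurable_times borel_measurable_diff random_variable_L borel_measurable_const) simp_all
    have "E n = (\<Union>j\<in>{..m * 2 ^ n}. {\<omega> \<in> space M. x < D \<omega> (real j * (T / real (2 ^ n)))})"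
      by (auto simp: E_def)
    also have "\<dots> \<in> sets M" by (intro sets.finite_UN finite_atMost borel_measurable_less borel_measurable_const Dm)
    finally show ?thesis .
  qed
  have Einc: "E n \<subseteq> E (Suc n)" for n
  proof
    fix \<omega> assume "\<omega> \<in> E n"
    then obtain j where j: "\<omega> \<in> space M" "j \<le> m * 2 ^ n" "x < D \<omega> (real j * (T / real (2 ^ n)))" by (auto simp: E_def)
    have "real j * (T / real (2 ^ n)) = real (2 * j) * (T / real (2 ^ Suc n))" by simp
    then show "\<omega> \<in> E (Suc n)" unfolding E_def using j by (auto intro!: exI[of _ "2 * j"])
  qed
  have EE: "?E = (\<Union>n. E n)"
  proof (intro set_eqI iffI)
    fix \<omega> assume "\<omega> \<in> (\<Union>n. E n)"
    then obtain n j where j: "\<omega> \<in> space M" "j \<le> m * 2 ^ n" "x < D \<omega> (real j * (T / real (2 ^ n)))" by (auto simp: E_def)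
    have "real j \<le> real m * real (2 ^ n)" using j(2) by (simp flip: of_nat_mult of_nat_power)
    then have "real j * (T / real (2 ^ n)) \<le> (real m * real (2 ^ n)) * (T / real (2 ^ n))"
      using T by (intro mult_right_mono) auto
    then have "real j * (T / real (2 ^ n)) \<in> {0..real m * T}" using T by simp
    then show "\<omega> \<in> ?E" using j unfolding D_def by blast
  next
    fix \<omega> assume "\<omega> \<in> ?E"
    then obtain u where w: "\<omega> \<in> space M" and u: "0 \<le> u" "u \<le> real m * T" "x < D \<omega> u" by (auto simp: D_def)
    show "\<omega> \<in> (\<Union>n. E n)"
    proof (cases "u = real m * T")
      \<comment> \<open>No later time is available at the right endpoint, but the endpoint itself
        lies on every grid.\<close>
      case True
      then have "\<omega> \<in> E 0" unfolding E_def using w u by (auto intro!: exI[of _ m])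
      then show ?thesis by blast
    next
      case False
      then have um: "u < real m * T" using u by simp
      have "((\<lambda>t. L t \<omega>) \<longlongrightarrow> L (s + u) \<omega>) (at (s + u) within {0..} \<inter> {s + u<..})"
        using cadlag_paths[OF w] s u by (auto simp: cadlag_on_def)
      moreover have "{0..} \<inter> {s + u<..} = {s + u<..}" using s u by auto
      ultimately have l: "((\<lambda>t. L t \<omega>) \<longlongrightarrow> L (s + u) \<omega>) (at_right (s + u))" by simp
      have "filterlim (\<lambda>v. s + v) (at_right (s + u)) (at_right u)"
        unfolding filterlim_at by (auto intro!: tendsto_intros simp: eventually_at_filter)
      from filterlim_compose[OF l this] have "((\<lambda>v. L (s + v) \<omega>) \<longlongrightarrow> L (s + u) \<omega>) (at_right u)" .
      moreover have "(polygon m T p \<longlongrightarrow> polygon m T p u) (at_right u)"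
      proof -
        have "isCont (polygon m T p) u" by (rule polygon_isCont)
        then show ?thesis by (simp add: isCont_def filterlim_at_split)
      qed
      ultimately have "(D \<omega> \<longlongrightarrow> D \<omega> u) (at_right u)"
        unfolding D_def by (intro tendsto_intros)
      then have "\<forall>\<^sub>F v in at_right u. x < D \<omega> v" using u(3) by (rule order_tendstoD)
      then obtain d where d: "d > u" "\<And>v. u < v \<Longrightarrow> v < d \<Longrightarrow> x < D \<omega> v"
        unfolding eventually_at_right_field by blast
      define r where "r = min (d - u) (real m * T - u)"
      have "r > 0" using d(1) um by (simp add: r_def)
      then obtain n where n: "(1/2) ^ n < r / T" using real_arch_pow_inv[of "r / T" "1/2"] T by auto
      define h where "h = T / real (2 ^ n)"
      have h: "0 < h" "h < r" using n T by (auto simp: h_def power_one_over field_simps)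
      \<comment> \<open>The first grid point strictly after \<open>u\<close>. The choice of
        \<open>n\<close> puts it within \<open>r\<close> of \<open>u\<close>, hence inside the
        interval.\<close>
      define j where "j = nat \<lfloor>u / h\<rfloor> + 1"
      have "real (nat \<lfloor>u / h\<rfloor>) = of_int \<lfloor>u / h\<rfloor>" using u h by (simp add: of_nat_nat)
      then have "real j = of_int \<lfloor>u / h\<rfloor> + 1" by (simp add: j_def)
      then have "u / h < real j" "real j \<le> u / h + 1" by linarith+
      then have v: "u < real j * h" "real j * h \<le> u + h" using h by (auto simp: field_simps)
      have "real j * h \<le> real m * T" using v(2) h(2) by (simp add: r_def)
      also have "\<dots> = real (m * 2 ^ n) * h" using T by (simp add: h_def)
      finally have "real j \<le> real (m * 2 ^ n)" using h by (simp only: mult_le_cancel_right_pos)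
      then have "j \<le> m * 2 ^ n" by (simp only: of_nat_le_iff)
      moreover have "x < D \<omega> (real j * h)" by (rule d(2)) (use v h in \<open>auto simp: r_def\<close>)
      ultimately have "\<omega> \<in> E n" using w unfolding E_def h_def by blast
      then show ?thesis by blast
    qed
  qed
  show "?E \<in> sets M" unfolding EE by (intro sets.countable_UN) auto
  show "(\<integral>\<^sup>+\<omega>. tilt s T m \<xi> \<omega> * indicator ?E \<omega> \<partial>M) \<le> ennreal (exp (T * (\<Sum>b<m. Psi (\<xi> b + \<theta>) - Psi (\<xi> b) - \<theta> * p b) - x))"
    unfolding EE
  proof (rule nn_integral_le_limit)
    fix n :: nat
    have N: "0 < (2 :: nat) ^ n" by simp
    show "(\<lambda>\<omega>. tilt s T m \<xi> \<omega> * indicator (E n) \<omega>) \<in> borel_measurable M"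
      using tilt_measurable[OF s T N kappa] by measurable
    have "(\<integral>\<^sup>+\<omega>. tilt s T m \<xi> \<omega> * indicator (E n) \<omega> \<partial>M) \<le> (\<integral>\<^sup>+\<omega>. tilt s T m \<xi> \<omega> * indicator {\<omega> \<in> space M. \<exists>j\<le>m * 2 ^ n.
        x \<le> \<theta> * (L (s + real j * (T / real (2 ^ n))) \<omega> - L s \<omega> - polygon m T p (real j * (T / real (2 ^ n))))} \<omega> \<partial>M)"
      by (intro nn_integral_mono mult_left_mono) (auto simp: indicator_def E_def D_def intro: less_imp_le)
    also have "\<dots> \<le> ennreal (exp (T * (\<Sum>b<m. Psi (\<xi> b + \<theta>) - Psi (\<xi> b) - \<theta> * p b) - x))"
      by (rule grid_maximal[OF s T N kappa])
    finally show "(\<integral>\<^sup>+\<omega>. tilt s T m \<xi> \<omega> * indicator (E n) \<omega> \<partial>M) \<le> ennreal (exp (T * (\<Sum>b<m. Psi (\<xi> b + \<theta>) - Psi (\<xi> b) - \<theta> * p b) - x))" .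
  next
    fix \<omega>
    have "incseq E" by (rule incseq_SucI) (rule Einc)
    then have "(\<lambda>n. indicator (E n) \<omega> :: ennreal) \<longlonglongrightarrow> indicator (\<Union>n. E n) \<omega>"
      by (rule LIMSEQ_indicator_incseq)
    then show "(\<lambda>n. tilt s T m \<xi> \<omega> * indicator (E n) \<omega>) \<longlonglongrightarrow> tilt s T m \<xi> \<omega> * indicator (\<Union>n. E n) \<omega>"
      by (rule ennreal_tendsto_cmult[rotated]) (simp add: tilt_def)
  qed
qed

end

section \<open>The action functional\<close>

text \<open>Fatou in an almost-everywhere form, for integrands that are controlled only where a
  derivative exists.\<close>

lemma nn_integral_le_liminf:
  fixes u :: "nat \<Rightarrow> 'b \<Rightarrow> ennreal"
  assumes "\<And>n. u n \<in> borel_measurable N" "\<And>n. (\<integral>\<^sup>+x. u n x \<partial>N) \<le> B"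
    "AE x in N. f x \<le> liminf (\<lambda>n. u n x)"
  shows "(\<integral>\<^sup>+x. f x \<partial>N) \<le> B"
proof -
  have "(\<integral>\<^sup>+x. f x \<partial>N) \<le> (\<integral>\<^sup>+x. liminf (\<lambda>n. u n x) \<partial>N)"
    by (rule nn_integral_mono_AE[OF assms(3)])
  also have "\<dots> \<le> liminf (\<lambda>n. \<integral>\<^sup>+x. u n x \<partial>N)" by (rule nn_integral_liminf) (rule assms(1))
  also have "\<dots> \<le> B" by (rule Liminf_le) (auto intro!: always_eventually assms(2))
  finally show ?thesis .
qed

lemma ennreal_integral_le_nn_integral:
  assumes "integrable N f"
  shows "ennreal (\<integral>x. f x \<partial>N) \<le> (\<integral>\<^sup>+x. ennreal (f x) \<partial>N)"
proof -
  have m: "integrable N (\<lambda>x. max 0 (f x))" using assms by (intro integrable_max) auto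
  have "ennreal (\<integral>x. f x \<partial>N) \<le> ennreal (\<integral>x. max 0 (f x) \<partial>N)"
    by (intro ennreal_leI integral_mono assms m) auto
  also have "\<dots> = (\<integral>\<^sup>+x. ennreal (max 0 (f x)) \<partial>N)"
    by (rule nn_integral_eq_integral[OF m, symmetric]) auto
  also have "\<dots> = (\<integral>\<^sup>+x. ennreal (f x) \<partial>N)"
    by (intro nn_integral_cong) (simp add: max_def ennreal_neg)
  finally show ?thesis .
qed

section \<open>Uniform grids and difference quotients\<close>

definition cell :: "nat \<Rightarrow> nat \<Rightarrow> real set" where
  "cell m b = {real b / real m<..real (Suc b) / real m}"

text \<open>Ceiling minus one because cells are closed on the right; they partition (0,1], and 0
  lies in none of them.\<close>

definition cell_index :: "nat \<Rightarrow> real \<Rightarrow> nat" where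
  "cell_index m t = nat (\<lceil>t * real m\<rceil> - 1)"

lemma cell_sets [measurable]: "cell m b \<in> sets borel"
  by (simp add: cell_def)

lemma cell_iff:
  assumes "0 < m" "0 < t"
  shows "t \<in> cell m b \<longleftrightarrow> b = cell_index m t"
proof -
  have "t \<in> cell m b \<longleftrightarrow> real b < t * real m \<and> t * real m \<le> real (Suc b)"
    using assms(1) by (simp add: cell_def pos_divide_less_eq pos_le_divide_eq del: of_nat_Suc)
  also have "\<dots> \<longleftrightarrow> \<lceil>t * real m\<rceil> = int b + 1"
    by (simp add: ceiling_eq_iff add.commute)
  also have "\<dots> \<longleftrightarrow> b = cell_index m t"
  proof -
    have "\<lceil>t * real m\<rceil> \<ge> 1" using assms by (simp add: le_ceiling_iff)
    then show ?thesis unfolding cell_index_def by linarith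
  qed
  finally show ?thesis .
qed

lemma cell_index_less:
  assumes "0 < m" "0 < t" "t \<le> 1"
  shows "cell_index m t < m"
proof -
  have "t * real m \<le> real m" using assms by simp
  then have "\<lceil>t * real m\<rceil> \<le> int m" by (simp add: ceiling_le_iff)
  then show ?thesis unfolding cell_index_def using assms(1) by linarith
qed

lemma indicator_cells:
  assumes "0 < m"
  shows "(indicator {0<..1} t :: ennreal) = (\<Sum>b<m. indicator (cell m b) t)"
proof (cases "t \<in> {0<..1}")
  case True
  have "(\<Sum>b<m. indicator (cell m b) t :: ennreal) = (\<Sum>b<m. if b = cell_index m t then 1 else 0)"
    by (intro sum.cong refl) (use cell_iff[OF assms] True in \<open>auto simp: indicator_def\<close>)
  also have "\<dots> = 1" using cell_index_less[OF assms] True by simp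
  finally show ?thesis using True by simp
next
  case False
  have "t \<notin> cell m b" if "b < m" for b
  proof
    assume t: "t \<in> cell m b"
    have "0 \<le> real b / real m" "real (Suc b) / real m \<le> 1" using that by (auto simp: divide_le_eq_1)
    then have "0 < t" "t \<le> 1" using t unfolding cell_def greaterThanAtMost_iff by linarith+
    then show False using False by simp
  qed
  then show ?thesis using False by simp
qed

lemma nn_integral_cells:
  assumes "0 < m" "F \<in> borel_measurable borel"
  shows "(\<integral>\<^sup>+t. F t * indicator {0<..1} t \<partial>lborel) = (\<Sum>b<m. \<integral>\<^sup>+t. F t * indicator (cell m b) t \<partial>lborel)"
  unfolding indicator_cells[OF assms(1)] sum_distrib_left
  by (rule nn_integral_sum) (use assms(2) in measurable)

lemma emeasure_cell: "0 < m \<Longrightarrow> emeasure lborel (cell m b) = ennreal (1 / real m)"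
  unfolding cell_def by (subst emeasure_lborel_Ioc) (auto simp: divide_right_mono field_simps)

lemma nn_integral_cell_const:
  assumes m: "0 < m"
  shows "(\<integral>\<^sup>+t. f (cell_index m t) * indicator (cell m b) t \<partial>lborel) = ennreal (1 / real m) * f b"
proof -
  have "(\<integral>\<^sup>+t. f (cell_index m t) * indicator (cell m b) t \<partial>lborel) = (\<integral>\<^sup>+t. f b * indicator (cell m b) t \<partial>lborel)"
  proof (intro nn_integral_cong)
    fix t :: real
    have "cell_index m t = b" if "t \<in> cell m b"
    proof -
      have "0 \<le> real b / real m" by simp
      then have "0 < t" using that unfolding cell_def greaterThanAtMost_iff by linarith
      then show ?thesis using cell_iff[OF m] that by auto
    qed
    then show "f (cell_index m t) * indicator (cell m b) t = f b * indicator (cell m b) t"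
      by (auto simp: indicator_def)
  qed
  then show ?thesis by (simp add: nn_integral_cmult_indicator emeasure_cell[OF m] mult.commute)
qed

lemma cell_index_measurable [measurable]: "cell_index m \<in> measurable borel (count_space UNIV)"
  unfolding cell_index_def by measurable

definition cell_slope :: "nat \<Rightarrow> (real \<Rightarrow> real) \<Rightarrow> nat \<Rightarrow> real" where
  "cell_slope m f b = real m * (f (real (Suc b) / real m) - f (real b / real m))"

text \<open>The cell straddles \<open>t\<close>, so the errors of the first-order expansion at its
  two ends add up to at most \<open>e'\<close> times its length.\<close>

lemma cell_slope_LIMSEQ:
  assumes f: "(f has_real_derivative D) (at t)" and t: "0 < t"
  shows "(\<lambda>n. cell_slope (Suc n) f (cell_index (Suc n) t)) \<longlonglongrightarrow> D"
proof (rule LIMSEQ_I)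
  fix e :: real assume "0 < e"
  define e' where "e' = e / 2"
  have e': "0 < e'" "e' < e" using \<open>0 < e\<close> by (auto simp: e'_def)
  from f have "((\<lambda>h. (f (t + h) - f t) / h) \<longlongrightarrow> D) (at 0)" by (simp add: DERIV_def)
  from LIM_D[OF this e'(1)] obtain d where d: "d > 0" "\<And>h. h \<noteq> 0 \<Longrightarrow> \<bar>h\<bar> < d \<Longrightarrow> \<bar>(f (t + h) - f t) / h - D\<bar> < e'"
    by auto
  have app: "\<bar>f (t + h) - f t - D * h\<bar> \<le> e' * \<bar>h\<bar>" if "\<bar>h\<bar> < d" for h
  proof (cases "h = 0")
    case False
    have "\<bar>f (t + h) - f t - D * h\<bar> = \<bar>(f (t + h) - f t) / h - D\<bar> * \<bar>h\<bar>"
      using False by (simp add: abs_mult[symmetric] field_simps)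
    also have "\<dots> \<le> e' * \<bar>h\<bar>" using d(2)[OF False that] by (intro mult_right_mono) auto
    finally show ?thesis .
  qed simp
  obtain N where N: "1 / real (Suc N) < d" using nat_approx_posE[OF d(1)] by blast
  show "\<exists>no. \<forall>n\<ge>no. norm (cell_slope (Suc n) f (cell_index (Suc n) t) - D) < e"
  proof (intro exI[of _ N] allI impI)
    fix n assume n: "N \<le> n"
    define m where "m = Suc n"
    have m: "0 < m" by (simp add: m_def)
    have "1 / real m \<le> 1 / real (Suc N)" using n by (intro divide_left_mono) (auto simp: m_def)
    with N have small: "1 / real m < d" by linarith
    define b where "b = cell_index m t"
    have "t \<in> cell m b" using cell_iff[OF m t] by (simp add: b_def)
    then have bt: "real b / real m < t" "t \<le> real (Suc b) / real m" by (auto simp: cell_def)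
    have len: "real (Suc b) / real m - real b / real m = 1 / real m" by (simp add: add_divide_distrib)
    define u v where "u = real b / real m - t" and "v = real (Suc b) / real m - t"
    have uv: "u < 0" "0 \<le> v" "v - u = 1 / real m" using bt len by (auto simp: u_def v_def)
    then have "\<bar>u\<bar> < d" "\<bar>v\<bar> < d" using small by linarith+
    from app[OF this(1)] app[OF this(2)]
    have "\<bar>f (t + v) - f (t + u) - D * (v - u)\<bar> \<le> e' * (v - u)"
      using uv by (simp add: abs_le_iff algebra_simps)
    then have "\<bar>f (t + v) - f (t + u) - D / real m\<bar> * real m \<le> (e' / real m) * real m"
      unfolding uv(3) by (intro mult_right_mono) auto
    then have "\<bar>f (t + v) - f (t + u) - D / real m\<bar> * real m \<le> e'"
      using m by simp
    moreover have "cell_slope m f b - D = (f (t + v) - f (t + u) - D / real m) * real m"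
      using m by (simp add: cell_slope_def u_def v_def field_simps)
    ultimately have "\<bar>cell_slope m f b - D\<bar> \<le> e'" by (simp add: abs_mult)
    then show "norm (cell_slope (Suc n) f (cell_index (Suc n) t) - D) < e"
      using e'(2) by (simp add: m_def b_def)
  qed
qed

section \<open>The Legendre transform as a rate\<close>

context exponential_levy_process
begin

definition rate :: "real \<Rightarrow> ennreal" where
  "rate p = e2ennreal (legendre_transform Psi p)"

lemma legendre_le_rate: "ennreal (\<xi> * p - Psi \<xi>) \<le> rate p"
proof -
  have "ereal (\<xi> * p - Psi \<xi>) \<le> legendre_transform Psi p"
    unfolding legendre_transform_def by (rule SUP_upper) simp
  then have "e2ennreal (ereal (\<xi> * p - Psi \<xi>)) \<le> rate p" unfolding rate_def by (rule e2ennreal_mono)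
  then show ?thesis by simp
qed

lemma rate_le: "(\<And>\<xi>. ennreal (\<xi> * p - Psi \<xi>) \<le> c) \<Longrightarrow> rate p \<le> c"
proof -
  assume c: "\<And>\<xi>. ennreal (\<xi> * p - Psi \<xi>) \<le> c"
  have "legendre_transform Psi p \<le> enn2ereal c"
    unfolding legendre_transform_def
  proof (rule SUP_least)
    fix \<xi>
    have "ereal (\<xi> * p - Psi \<xi>) \<le> enn2ereal (ennreal (\<xi> * p - Psi \<xi>))"
      by (cases "0 \<le> \<xi> * p - Psi \<xi>") (simp_all add: enn2ereal_ennreal ennreal_neg zero_ennreal.rep_eq)
    also have "\<dots> \<le> enn2ereal c" using c[of \<xi>] by (simp add: less_eq_ennreal.rep_eq)
    finally show "ereal (\<xi> * p - Psi \<xi>) \<le> enn2ereal c" .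
  qed
  then have "rate p \<le> e2ennreal (enn2ereal c)" unfolding rate_def by (rule e2ennreal_mono)
  then show "rate p \<le> c" by simp
qed

lemma rate_eq_SUP: "rate p = (SUP \<xi>. ennreal (\<xi> * p - Psi \<xi>))"
  by (intro antisym rate_le SUP_least SUP_upper legendre_le_rate) simp

text \<open>Sublevel sets are intersections of closed sets, so the uncountable supremum over \<xi>
  does no harm.\<close>

lemma rate_measurable [measurable]: "rate \<in> borel_measurable borel"
proof (rule borel_measurableI_le)
  fix c
  have "{p \<in> space borel. rate p \<le> c} = (\<Inter>\<xi>. {p. ennreal (\<xi> * p - Psi \<xi>) \<le> c})"
  proof (intro set_eqI)
    fix p
    show "p \<in> {p \<in> space borel. rate p \<le> c} \<longleftrightarrow> p \<in> (\<Inter>\<xi>. {p. ennreal (\<xi> * p - Psi \<xi>) \<le> c})"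
      using order_trans[OF legendre_le_rate, of p c] rate_le[of p c] by simp blast
  qed
  also have "closed \<dots>"
    by (intro closed_INT ballI closed_Collect_le continuous_intros continuous_on_ennreal)
  finally show "{p \<in> space borel. rate p \<le> c} \<in> sets borel" by simp
qed

lemma rate_lsc:
  assumes "p \<longlonglongrightarrow> q"
  shows "rate q \<le> liminf (\<lambda>n. rate (p n))"
proof (rule rate_le)
  fix \<xi>
  have "(\<lambda>n. ennreal (\<xi> * p n - Psi \<xi>)) \<longlonglongrightarrow> ennreal (\<xi> * q - Psi \<xi>)"
    by (intro tendsto_intros tendsto_ennrealI assms)
  then have "ennreal (\<xi> * q - Psi \<xi>) = liminf (\<lambda>n. ennreal (\<xi> * p n - Psi \<xi>))"
    by (rule lim_imp_Liminf[symmetric, rotated]) simp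
  also have "\<dots> \<le> liminf (\<lambda>n. rate (p n))"
    by (intro Liminf_mono always_eventually allI legendre_le_rate)
  finally show "ennreal (\<xi> * q - Psi \<xi>) \<le> liminf (\<lambda>n. rate (p n))" .
qed

definition growth_const :: "real \<Rightarrow> real" where
  "growth_const C = max 0 (max (Psi C) (Psi (- C)))"

lemma growth_const_nonneg [simp]: "0 \<le> growth_const C"
  by (simp add: growth_const_def)

text \<open>Fenchel's inequality at \<open>\<xi> = C\<close> and \<open>\<xi> = - C\<close>. The
  constant stands on the right because subtraction in \<open>ennreal\<close> is truncated. As
  \<open>C\<close> is free, this is superlinear growth.\<close>

lemma rate_superlinear: "ennreal (C * \<bar>p\<bar>) \<le> rate p + ennreal (growth_const C)"
proof -
  have *: "ennreal x \<le> ennreal (x - k) + ennreal (growth_const C)" if "k \<le> growth_const C" for x k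
  proof -
    have "ennreal x \<le> ennreal (max 0 (x - k) + growth_const C)"
      using that by (intro ennreal_leI) (simp add: max_def)
    also have "\<dots> = ennreal (max 0 (x - k)) + ennreal (growth_const C)" by (rule ennreal_plus) simp_all
    also have "ennreal (max 0 (x - k)) = ennreal (x - k)" by (simp add: max_def ennreal_neg)
    finally show ?thesis .
  qed
  show ?thesis
  proof (cases "0 \<le> p")
    case True
    then have "ennreal (C * \<bar>p\<bar>) \<le> ennreal (C * p - Psi C) + ennreal (growth_const C)"
      using *[of "Psi C" "C * \<bar>p\<bar>"] by (simp add: growth_const_def)
    also have "\<dots> \<le> rate p + ennreal (growth_const C)" by (intro add_right_mono legendre_le_rate)
    finally show ?thesis .
  next
    case False
    then have "ennreal (C * \<bar>p\<bar>) \<le> ennreal ((- C) * p - Psi (- C)) + ennreal (growth_const C)"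
      using *[of "Psi (- C)" "C * \<bar>p\<bar>"] by (simp add: growth_const_def)
    also have "\<dots> \<le> rate p + ennreal (growth_const C)" by (intro add_right_mono legendre_le_rate)
    finally show ?thesis .
  qed
qed

abbreviation "action \<equiv> levy_action a \<sigma> \<nu>"

text \<open>Frees the action from \<open>deriv\<close> and moves it to the half-open interval that
  the cells partition.\<close>

lemma action_eq:
  assumes "\<phi> \<in> AC01"
    and "AE t in lborel. t \<in> {0<..<1} \<longrightarrow> (\<phi> has_real_derivative g t) (at t)"
  shows "action \<phi> = (\<integral>\<^sup>+t. rate (g t) * indicator {0<..1} t \<partial>lborel)"
proof -
  have "action \<phi> = (\<integral>\<^sup>+t\<in>{0..1}. rate (deriv \<phi> t) \<partial>lborel)"
    using assms(1) by (auto simp: levy_action_def AC01_def rate_def)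
  also have "\<dots> = (\<integral>\<^sup>+t. rate (g t) * indicator {0<..1} t \<partial>lborel)"
  proof (rule nn_integral_cong_AE)
    show "AE t in lborel. rate (deriv \<phi> t) * indicator {0..1} t = rate (g t) * indicator {0<..1} t"
      using assms(2) AE_lborel_singleton[of 0] AE_lborel_singleton[of 1]
      by eventually_elim (auto simp: indicator_def DERIV_imp_deriv)
  qed
  finally show ?thesis .
qed

lemma AC01_density:
  assumes "\<phi> \<in> AC01"
  obtains g where "integrable lborel g"
    "\<And>s t. 0 \<le> s \<Longrightarrow> s \<le> t \<Longrightarrow> t \<le> 1 \<Longrightarrow> \<phi> t - \<phi> s = (LINT x:{s..t}|lborel. g x)"
    "action \<phi> = (\<integral>\<^sup>+t. rate (g t) * indicator {0<..1} t \<partial>lborel)"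
proof -
  have "absolutely_continuous_fun 0 1 \<phi>" using assms by (simp add: AC01_def)
  from absolutely_continuous_fun_FTC[OF this] obtain g where g: "integrable lborel g"
    "\<And>s t. 0 \<le> s \<Longrightarrow> s \<le> t \<Longrightarrow> t \<le> 1 \<Longrightarrow> \<phi> t - \<phi> s = (LINT x:{s..t}|lborel. g x)"
    "AE t in lborel. t \<in> {0<..<1} \<longrightarrow> (\<phi> has_real_derivative g t) (at t)" by blast
  show ?thesis by (rule that[OF g(1) g(2) action_eq[OF assms g(3)]])
qed

text \<open>\<open>rate\<close> is the supremum of the positive parts of affine functions. Each
  affine function commutes with the average, its integral is at most that of \<open>rate\<close>,
  and the supremum is taken afterwards.\<close>

lemma rate_jensen:
  assumes g: "integrable lborel g" and st: "s < t"
  shows "ennreal (t - s) * rate ((LINT x:{s..t}|lborel. g x) / (t - s)) \<le> (\<integral>\<^sup>+x. rate (g x) * indicator {s<..t} x \<partial>lborel)"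
proof -
  let ?I = "LINT x:{s..t}|lborel. g x"
  have si: "set_integrable lborel {s..t} g"
    unfolding set_integrable_def by (rule integrable_mult_indicator[OF _ g]) simp
  have "ennreal (t - s) * ennreal (\<xi> * (?I / (t - s)) - Psi \<xi>) \<le> (\<integral>\<^sup>+x. rate (g x) * indicator {s<..t} x \<partial>lborel)" for \<xi>
  proof -
    have ci: "set_integrable lborel {s..t} (\<lambda>_. Psi \<xi>)"
      unfolding set_integrable_def using st by (simp add: integrable_mult_left)
    have int: "set_integrable lborel {s..t} (\<lambda>x. \<xi> * g x - Psi \<xi>)"
      by (intro set_integral_diff(1) set_integrable_mult_right si ci)
    have val: "(LINT x:{s..t}|lborel. \<xi> * g x - Psi \<xi>) = \<xi> * ?I - (t - s) * Psi \<xi>"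
    proof -
      have "(LINT x:{s..t}|lborel. \<xi> * g x - Psi \<xi>) = (LINT x:{s..t}|lborel. \<xi> * g x) - (LINT x:{s..t}|lborel. Psi \<xi>)"
        by (intro set_integral_diff(2) set_integrable_mult_right si ci)
      moreover have "(LINT x:{s..t}|lborel. Psi \<xi>) = (t - s) * Psi \<xi>"
        using st by (simp add: set_lebesgue_integral_def)
      ultimately show ?thesis by simp
    qed
    have "ennreal (t - s) * ennreal (\<xi> * (?I / (t - s)) - Psi \<xi>) = ennreal ((t - s) * (\<xi> * (?I / (t - s)) - Psi \<xi>))"
      using st by (simp add: ennreal_mult')
    also have "(t - s) * (\<xi> * (?I / (t - s)) - Psi \<xi>) = \<xi> * ?I - (t - s) * Psi \<xi>"
      using st by (simp add: field_simps)
    also have "ennreal (\<xi> * ?I - (t - s) * Psi \<xi>) = ennreal (LINT x:{s..t}|lborel. \<xi> * g x - Psi \<xi>)"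
      by (simp only: val)
    also have "\<dots> \<le> (\<integral>\<^sup>+x. ennreal (indicator {s..t} x *\<^sub>R (\<xi> * g x - Psi \<xi>)) \<partial>lborel)"
      unfolding set_lebesgue_integral_def
      by (rule ennreal_integral_le_nn_integral) (use int in \<open>simp add: set_integrable_def\<close>)
    also have "\<dots> \<le> (\<integral>\<^sup>+x. rate (g x) * indicator {s<..t} x \<partial>lborel)"
    proof (rule nn_integral_mono_AE)
      show "AE x in lborel. ennreal (indicator {s..t} x *\<^sub>R (\<xi> * g x - Psi \<xi>)) \<le> rate (g x) * indicator {s<..t} x"
        using AE_lborel_singleton[of s]
      proof eventually_elim
        case (elim x)
        then show ?case using legendre_le_rate[of \<xi> "g x"] by (auto simp: indicator_def)
      qed
    qed
    finally show ?thesis .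
  qed
  then show ?thesis
    unfolding rate_eq_SUP by (subst SUP_mult_left_ennreal) (rule SUP_least)
qed

lemma cell_slope_rate_le:
  assumes m: "0 < m" and b: "b < m" and g: "integrable lborel g"
    and \<phi>: "\<And>s t. 0 \<le> s \<Longrightarrow> s \<le> t \<Longrightarrow> t \<le> 1 \<Longrightarrow> \<phi> t - \<phi> s = (LINT x:{s..t}|lborel. g x)"
  shows "ennreal (1 / real m) * rate (cell_slope m \<phi> b) \<le> (\<integral>\<^sup>+x. rate (g x) * indicator (cell m b) x \<partial>lborel)"
proof -
  let ?s = "real b / real m" and ?t = "real (Suc b) / real m"
  have st: "?s < ?t" using m by (simp add: divide_strict_right_mono)
  have "?t \<le> 1" using m b by (simp add: divide_le_eq_1)
  then have "\<phi> ?t - \<phi> ?s = (LINT x:{?s..?t}|lborel. g x)" using st by (intro \<phi>) auto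
  moreover have len: "?t - ?s = 1 / real m" by (simp add: add_divide_distrib)
  ultimately have "cell_slope m \<phi> b = (LINT x:{?s..?t}|lborel. g x) / (?t - ?s)"
    unfolding cell_slope_def by simp
  then show ?thesis using rate_jensen[OF g st] by (simp only: len cell_def)
qed

text \<open>One half of the characterisation of the action by grid sums; the converse is the last
  step of \<open>action_limit\<close>.\<close>

lemma grid_action_le:
  assumes \<phi>: "\<phi> \<in> AC01" and m: "0 < m"
  shows "(\<Sum>b<m. ennreal (1 / real m) * rate (cell_slope m \<phi> b)) \<le> action \<phi>"
proof -
  obtain g where g: "integrable lborel g"
    "\<And>s t. 0 \<le> s \<Longrightarrow> s \<le> t \<Longrightarrow> t \<le> 1 \<Longrightarrow> \<phi> t - \<phi> s = (LINT x:{s..t}|lborel. g x)"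
    "action \<phi> = (\<integral>\<^sup>+t. rate (g t) * indicator {0<..1} t \<partial>lborel)"
    using AC01_density[OF \<phi>] by blast
  have [measurable]: "g \<in> borel_measurable borel" using g(1) by auto
  have "action \<phi> = (\<Sum>b<m. \<integral>\<^sup>+t. rate (g t) * indicator (cell m b) t \<partial>lborel)"
    unfolding g(3) by (rule nn_integral_cells[OF m]) measurable
  then show ?thesis by (simp only:) (intro sum_mono cell_slope_rate_le[OF m _ g(1,2)], simp)
qed

lemma grid_action_eq_nn_integral:
  assumes m: "0 < m"
  shows "(\<integral>\<^sup>+t. rate (p (cell_index m t)) * indicator {0<..1} t \<partial>lborel) = (\<Sum>b<m. ennreal (1 / real m) * rate (p b))"
proof -
  have "(\<lambda>t. rate (p (cell_index m t))) \<in> borel_measurable borel"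
    by (rule measurable_compose[OF cell_index_measurable]) simp
  from nn_integral_cells[OF m this] show ?thesis
    using nn_integral_cell_const[OF m, of "\<lambda>b. rate (p b)"] by simp
qed

text \<open>Integrates \<open>rate_superlinear\<close> over the intervals. Dividing by a large
  \<open>C\<close> and then taking the total length small makes the variation small, uniformly over
  the sublevel set.\<close>

lemma action_bound_variation:
  assumes \<phi>: "\<phi> \<in> AC01" and r: "action \<phi> \<le> ennreal r" "0 \<le> r" and C: "0 \<le> C"
    and I: "finite I" "\<And>i. i \<in> I \<Longrightarrow> 0 \<le> u i \<and> u i \<le> v i \<and> v i \<le> 1"
      "disjoint_family_on (\<lambda>i. {u i<..<v i}) I"
  shows "C * (\<Sum>i\<in>I. \<bar>\<phi> (v i) - \<phi> (u i)\<bar>) \<le> r + growth_const C * (\<Sum>i\<in>I. v i - u i)"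
proof -
  obtain g where g: "integrable lborel g"
    "\<And>s t. 0 \<le> s \<Longrightarrow> s \<le> t \<Longrightarrow> t \<le> 1 \<Longrightarrow> \<phi> t - \<phi> s = (LINT x:{s..t}|lborel. g x)"
    "action \<phi> = (\<integral>\<^sup>+t. rate (g t) * indicator {0<..1} t \<partial>lborel)"
    using AC01_density[OF \<phi>] by blast
  have [measurable]: "g \<in> borel_measurable borel" using g(1) by auto
  let ?K = "growth_const C"
  have one: "ennreal (C * \<bar>\<phi> (v i) - \<phi> (u i)\<bar>) \<le> (\<integral>\<^sup>+x. ennreal (C * \<bar>g x\<bar>) * indicator {u i<..<v i} x \<partial>lborel)" if "i \<in> I" for i
  proof -
    have "\<phi> (v i) - \<phi> (u i) = (\<integral>x. indicator {u i..v i} x *\<^sub>R g x \<partial>lborel)"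
      using g(2) I(2)[OF that] by (simp add: set_lebesgue_integral_def)
    then have "\<bar>\<phi> (v i) - \<phi> (u i)\<bar> \<le> (\<integral>x. norm (indicator {u i..v i} x *\<^sub>R g x) \<partial>lborel)"
      using integral_norm_bound[of lborel "\<lambda>x. indicator {u i..v i} x *\<^sub>R g x"] by simp
    then have "C * \<bar>\<phi> (v i) - \<phi> (u i)\<bar> \<le> (\<integral>x. C * norm (indicator {u i..v i} x *\<^sub>R g x) \<partial>lborel)"
      using C by (simp add: mult_left_mono)
    then have "ennreal (C * \<bar>\<phi> (v i) - \<phi> (u i)\<bar>) \<le> ennreal (\<integral>x. C * norm (indicator {u i..v i} x *\<^sub>R g x) \<partial>lborel)"
      by (rule ennreal_leI)
    also have "\<dots> \<le> (\<integral>\<^sup>+x. ennreal (C * norm (indicator {u i..v i} x *\<^sub>R g x)) \<partial>lborel)"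
      by (rule ennreal_integral_le_nn_integral)
         (intro integrable_mult_right integrable_norm integrable_mult_indicator g(1), simp)
    also have "\<dots> = (\<integral>\<^sup>+x. ennreal (C * \<bar>g x\<bar>) * indicator {u i<..<v i} x \<partial>lborel)"
    proof (rule nn_integral_cong_AE)
      show "AE x in lborel. ennreal (C * norm (indicator {u i..v i} x *\<^sub>R g x)) = ennreal (C * \<bar>g x\<bar>) * indicator {u i<..<v i} x"
        using AE_lborel_singleton[of "u i"] AE_lborel_singleton[of "v i"]
        by eventually_elim (auto simp: indicator_def)
    qed
    finally show ?thesis .
  qed
  \<comment> \<open>Disjointness keeps the sum of the indicators at most one, so all intervals
    together consume the action only once.\<close>
  have ind: "(\<Sum>i\<in>I. indicator {u i<..<v i} x :: ennreal) \<le> indicator {0<..1} x" for x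
  proof (cases "\<exists>i\<in>I. x \<in> {u i<..<v i}")
    case True
    then obtain i where i: "i \<in> I" "x \<in> {u i<..<v i}" by blast
    have "(\<Sum>j\<in>I. indicator {u j<..<v j} x :: ennreal) = (\<Sum>j\<in>I. if j = i then 1 else 0)"
    proof (intro sum.cong refl)
      fix j assume j: "j \<in> I"
      have "x \<notin> {u j<..<v j}" if "j \<noteq> i"
        using I(3) i j that unfolding disjoint_family_on_def by blast
      then show "(indicator {u j<..<v j} x :: ennreal) = (if j = i then 1 else 0)"
        using i(2) by (cases "j = i") simp_all
    qed
    also have "\<dots> = 1" using I(1) i(1) by simp
    finally show ?thesis using i I(2)[OF i(1)] by simp
  next
    case False
    then have "(\<Sum>i\<in>I. indicator {u i<..<v i} x :: ennreal) = 0" by (intro sum.neutral) simp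
    then show ?thesis by simp
  qed
  have "ennreal (C * (\<Sum>i\<in>I. \<bar>\<phi> (v i) - \<phi> (u i)\<bar>)) = (\<Sum>i\<in>I. ennreal (C * \<bar>\<phi> (v i) - \<phi> (u i)\<bar>))"
    unfolding sum_distrib_left using C by (subst sum_ennreal) auto
  also have "\<dots> \<le> (\<Sum>i\<in>I. \<integral>\<^sup>+x. ennreal (C * \<bar>g x\<bar>) * indicator {u i<..<v i} x \<partial>lborel)"
    by (intro sum_mono one)
  also have "\<dots> \<le> (\<Sum>i\<in>I. \<integral>\<^sup>+x. rate (g x) * indicator {u i<..<v i} x + ennreal ?K * indicator {u i<..<v i} x \<partial>lborel)"
  proof (intro sum_mono nn_integral_mono)
    fix i x
    show "ennreal (C * \<bar>g x\<bar>) * indicator {u i<..<v i} x \<le> rate (g x) * indicator {u i<..<v i} x + ennreal ?K * indicator {u i<..<v i} x"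
      unfolding distrib_right[symmetric] by (intro mult_right_mono rate_superlinear) simp
  qed
  also have "\<dots> = (\<Sum>i\<in>I. (\<integral>\<^sup>+x. rate (g x) * indicator {u i<..<v i} x \<partial>lborel) + ennreal ?K * ennreal (v i - u i))"
  proof (intro sum.cong refl)
    fix i assume "i \<in> I"
    then have "u i \<le> v i" using I(2) by auto
    then show "(\<integral>\<^sup>+x. rate (g x) * indicator {u i<..<v i} x + ennreal ?K * indicator {u i<..<v i} x \<partial>lborel) =
       (\<integral>\<^sup>+x. rate (g x) * indicator {u i<..<v i} x \<partial>lborel) + ennreal ?K * ennreal (v i - u i)"
      by (subst nn_integral_add) (simp_all add: nn_integral_cmult_indicator)
  qed
  also have "\<dots> = (\<integral>\<^sup>+x. rate (g x) * (\<Sum>i\<in>I. indicator {u i<..<v i} x) \<partial>lborel) + (\<Sum>i\<in>I. ennreal ?K * ennreal (v i - u i))"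
    unfolding sum.distrib sum_distrib_left by (subst nn_integral_sum) simp_all
  also have "\<dots> \<le> action \<phi> + (\<Sum>i\<in>I. ennreal ?K * ennreal (v i - u i))"
    unfolding g(3) by (intro add_right_mono nn_integral_mono mult_left_mono ind) simp
  also have "(\<Sum>i\<in>I. ennreal ?K * ennreal (v i - u i)) = ennreal (?K * (\<Sum>i\<in>I. v i - u i))"
  proof -
    have "(\<Sum>i\<in>I. ennreal ?K * ennreal (v i - u i)) = (\<Sum>i\<in>I. ennreal (?K * (v i - u i)))"
      by (intro sum.cong refl ennreal_mult'[symmetric]) simp
    also have "\<dots> = ennreal (\<Sum>i\<in>I. ?K * (v i - u i))"
      using I(2) by (intro sum_ennreal mult_nonneg_nonneg) auto
    finally show ?thesis by (simp only: sum_distrib_left)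
  qed
  also have "action \<phi> + ennreal (?K * (\<Sum>i\<in>I. v i - u i)) \<le> ennreal r + ennreal (?K * (\<Sum>i\<in>I. v i - u i))"
    by (intro add_right_mono r)
  also have "\<dots> = ennreal (r + ?K * (\<Sum>i\<in>I. v i - u i))"
    using r(2) I(2) by (intro ennreal_plus[symmetric] mult_nonneg_nonneg sum_nonneg) auto
  finally show ?thesis
    using r(2) I(2) by (subst (asm) ennreal_le_iff) (auto intro!: add_nonneg_nonneg mult_nonneg_nonneg sum_nonneg)
qed

end

section \<open>Polygonal paths and compactness of the sublevel sets\<close>

lemma continuous_imp_D01:
  assumes "f \<in> extensional {0..1}" "continuous_on {0..1} f"
  shows "f \<in> D01"
proof -
  have "(f \<longlongrightarrow> f t) (at t within {0..1} \<inter> J)" if "t \<in> {0..1}" for t J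
    using assms(2) that by (auto simp: continuous_on_def intro: tendsto_within_subset)
  then show ?thesis using assms(1) unfolding D01_def cadlag_on_def by blast
qed

lemma AC01_subset_D01: "AC01 \<subseteq> D01"
  by (auto simp: AC01_def intro: continuous_imp_D01 absolutely_continuous_fun_continuous)

lemma mdist_D01_le:
  assumes "f \<in> D01" "g \<in> D01" "\<And>t. t \<in> {0..1} \<Longrightarrow> \<bar>f t - g t\<bar> \<le> e"
  shows "mdist D01_metric f g \<le> e"
  unfolding mdist_D01_metric[OF assms(1,2)] by (rule cSUP_least) (use assms(3) in auto)

lemma polygon_cell:
  assumes T: "0 < T" and b: "b < m" and u: "real b * T \<le> u" "u \<le> real (Suc b) * T"
  shows "polygon m T p u = polygon m T p (real b * T) + p b * (u - real b * T)"
proof -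
  have val: "polygon m T p u = (\<Sum>c<m. if c < b then p c * T else 0) + p b * (u - real b * T)"
    if u: "real b * T \<le> u" "u \<le> real (Suc b) * T" for u
  proof -
    have "polygon m T p u = (\<Sum>c<m. (if c < b then p c * T else 0) + (if c = b then p b * (u - real b * T) else 0))"
      unfolding polygon_def
    proof (intro sum.cong refl)
      fix c
      consider "c < b" | "c = b" | "b < c" by linarith
      then show "p c * min T (max 0 (u - real c * T)) = (if c < b then p c * T else 0) + (if c = b then p b * (u - real b * T) else 0)"
      proof cases
        case 1
        then have "real (Suc c) * T \<le> real b * T" using T by (intro mult_right_mono) auto
        then have "T \<le> u - real c * T" using u by (simp add: algebra_simps)
        then show ?thesis using 1 T by (simp add: min_absorb1 max_absorb2)
      next
        case 2
        have "0 \<le> u - real b * T" "u - real b * T \<le> T" using u by (auto simp: algebra_simps)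
        then show ?thesis using 2 by (simp add: min_absorb2 max_absorb2)
      next
        case 3
        then have "real (Suc b) * T \<le> real c * T" using T by (intro mult_right_mono) auto
        then have "u - real c * T \<le> 0" using u by simp
        then show ?thesis using 3 T by (simp add: max_absorb1 min_absorb2)
      qed
    qed
    then show ?thesis using b by (simp add: sum.distrib sum.delta)
  qed
  have "polygon m T p (real b * T) = (\<Sum>c<m. if c < b then p c * T else 0)"
    using val[of "real b * T"] T by (simp add: mult_right_mono)
  then show ?thesis using val[OF u] by simp
qed

lemma polygon_lipschitz: "\<bar>polygon m T p u - polygon m T p v\<bar> \<le> (\<Sum>b<m. \<bar>p b\<bar>) * \<bar>u - v\<bar>"
proof -
  have "\<bar>polygon m T p u - polygon m T p v\<bar> =
      \<bar>\<Sum>b<m. p b * (min T (max 0 (u - real b * T)) - min T (max 0 (v - real b * T)))\<bar>"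
    unfolding polygon_def by (simp add: sum_subtractf right_diff_distrib)
  also have "\<dots> \<le> (\<Sum>b<m. \<bar>p b * (min T (max 0 (u - real b * T)) - min T (max 0 (v - real b * T)))\<bar>)"
    by (rule sum_abs)
  also have "\<dots> \<le> (\<Sum>b<m. \<bar>p b\<bar> * \<bar>u - v\<bar>)"
    unfolding abs_mult by (intro sum_mono mult_left_mono) auto
  finally show ?thesis by (simp add: sum_distrib_right)
qed

lemma polygon_AC01: "(\<lambda>t\<in>{0..1}. polygon m (1 / real m) p t) \<in> AC01"
proof -
  let ?B = "(\<Sum>b<m. \<bar>p b\<bar>) + 1"
  have B: "0 < ?B" by (intro add_nonneg_pos sum_nonneg) auto
  have "absolutely_continuous_fun 0 1 (\<lambda>t\<in>{0..1}. polygon m (1 / real m) p t)"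
    unfolding absolutely_continuous_fun_def
  proof (intro allI impI)
    fix e :: real assume e: "0 < e"
    show "\<exists>d>0. \<forall>(n::nat) u v. (\<forall>i<n. 0 \<le> u i \<and> u i \<le> v i \<and> v i \<le> 1) \<and>
        disjoint_family_on (\<lambda>i. {u i<..<v i}) {..<n} \<and> (\<Sum>i<n. v i - u i) < d \<longrightarrow>
        (\<Sum>i<n. \<bar>(\<lambda>t\<in>{0..1}. polygon m (1 / real m) p t) (v i) - (\<lambda>t\<in>{0..1}. polygon m (1 / real m) p t) (u i)\<bar>) < e"
    proof (intro exI[of _ "e / ?B"] conjI allI impI)
      show "0 < e / ?B" using e B by simp
      fix n :: nat and u v
      assume h: "(\<forall>i<n. 0 \<le> u i \<and> u i \<le> v i \<and> v i \<le> 1) \<and>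
        disjoint_family_on (\<lambda>i. {u i<..<v i}) {..<n} \<and> (\<Sum>i<n. v i - u i) < e / ?B"
      have "(\<Sum>i<n. \<bar>(\<lambda>t\<in>{0..1}. polygon m (1 / real m) p t) (v i) - (\<lambda>t\<in>{0..1}. polygon m (1 / real m) p t) (u i)\<bar>) \<le>
        (\<Sum>i<n. ?B * (v i - u i))"
      proof (intro sum_mono)
        fix i assume "i \<in> {..<n}"
        then have i: "0 \<le> u i" "u i \<le> v i" "v i \<le> 1" using h by auto
        have "\<bar>polygon m (1 / real m) p (v i) - polygon m (1 / real m) p (u i)\<bar> \<le> (\<Sum>b<m. \<bar>p b\<bar>) * \<bar>v i - u i\<bar>"
          by (rule polygon_lipschitz)
        also have "\<dots> \<le> ?B * (v i - u i)" using i by (simp add: mult_right_mono)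
        finally show "\<bar>(\<lambda>t\<in>{0..1}. polygon m (1 / real m) p t) (v i) - (\<lambda>t\<in>{0..1}. polygon m (1 / real m) p t) (u i)\<bar> \<le> ?B * (v i - u i)"
          using i by simp
      qed
      also have "\<dots> = ?B * (\<Sum>i<n. v i - u i)" by (simp add: sum_distrib_left)
      also have "\<dots> < ?B * (e / ?B)" using h B by (intro mult_strict_left_mono) auto
      also have "\<dots> = e" using B by simp
      finally show "(\<Sum>i<n. \<bar>(\<lambda>t\<in>{0..1}. polygon m (1 / real m) p t) (v i) - (\<lambda>t\<in>{0..1}. polygon m (1 / real m) p t) (u i)\<bar>) < e" .
    qed
  qed
  then show ?thesis by (simp add: AC01_def)
qed

lemma polygon_has_derivative:
  assumes m: "0 < m" and t: "t \<in> {0<..<1}" "\<And>b. b \<le> m \<Longrightarrow> t \<noteq> real b / real m"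
  shows "((\<lambda>t\<in>{0..1}. polygon m (1 / real m) p t) has_real_derivative p (cell_index m t)) (at t)"
proof -
  define b where "b = cell_index m t"
  define T where "T = 1 / real m"
  have T: "0 < T" using m by (simp add: T_def)
  have b: "b < m" unfolding b_def by (rule cell_index_less[OF m]) (use t in auto)
  have "t \<in> cell m b" using cell_iff[OF m, of t b] t(1) by (simp add: b_def)
  then have "real b / real m < t" "t \<le> real (Suc b) / real m" by (auto simp: cell_def)
  moreover have "t \<noteq> real (Suc b) / real m" using b by (intro t(2)) simp
  ultimately have tb: "t \<in> {real b * T<..<real (Suc b) * T}" by (simp add: T_def)
  have "((\<lambda>u. polygon m T p (real b * T) + p b * (u - real b * T)) has_real_derivative p b) (at t)"
    by (auto intro!: derivative_eq_intros)
  moreover have "open ({0<..<1} \<inter> {real b * T<..<real (Suc b) * T})" by (intro open_Int) auto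
  ultimately have "((\<lambda>t\<in>{0..1}. polygon m T p t) has_real_derivative p b) (at t)"
  proof (rule has_field_derivative_transform_within_open)
    show "t \<in> {0<..<1} \<inter> {real b * T<..<real (Suc b) * T}" using t(1) tb by simp
    fix u assume u: "u \<in> {0<..<1} \<inter> {real b * T<..<real (Suc b) * T}"
    then have "polygon m T p u = polygon m T p (real b * T) + p b * (u - real b * T)"
      by (intro polygon_cell[OF T b]) auto
    then show "polygon m T p (real b * T) + p b * (u - real b * T) = (\<lambda>t\<in>{0..1}. polygon m T p t) u"
      using u by simp
  qed
  then show ?thesis by (simp only: b_def T_def)
qed

context exponential_levy_process
begin

lemma action_polygon:
  assumes m: "0 < m"
  shows "action (\<lambda>t\<in>{0..1}. polygon m (1 / real m) p t) = (\<Sum>b<m. ennreal (1 / real m) * rate (p b))"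
proof -
  have "AE t in lborel. t \<notin> (\<lambda>b. real b / real m) ` {..m}"
    by (intro AE_not_in finite_imp_null_set_lborel) simp
  then have "AE t in lborel. t \<in> {0<..<1} \<longrightarrow>
      ((\<lambda>t\<in>{0..1}. polygon m (1 / real m) p t) has_real_derivative p (cell_index m t)) (at t)"
    by eventually_elim (auto intro!: polygon_has_derivative[OF m])
  from action_eq[OF polygon_AC01 this] show ?thesis
    by (simp only: grid_action_eq_nn_integral[OF m])
qed

lemma action_finite_imp_AC01: "action \<phi> \<le> ennreal r \<Longrightarrow> \<phi> \<in> AC01"
  by (auto simp: levy_action_def top_unique split: if_splits)

lemma AC01_zero: "\<phi> \<in> AC01 \<Longrightarrow> \<phi> 0 = 0"
  by (simp add: AC01_def)

text \<open>Pointwise convergence is enough. The variation bound passes to the limit first and makes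
  \<psi> absolutely continuous; then Fatou is used twice, along \<open>k\<close> with the grid fixed
  and along the grids with \<psi> fixed.\<close>

lemma action_limit:
  assumes \<phi>: "\<And>k. action (\<phi> k) \<le> ennreal r" and r: "0 \<le> r"
    and lim: "\<And>t. t \<in> {0..1} \<Longrightarrow> (\<lambda>k. \<phi> k t) \<longlonglongrightarrow> \<psi> t" and ext: "\<psi> \<in> extensional {0..1}"
  shows "\<psi> \<in> AC01" "action \<psi> \<le> ennreal r"
proof -
  have AC: "\<phi> k \<in> AC01" for k by (rule action_finite_imp_AC01[OF \<phi>])
  have bound: "C * (\<Sum>i<n. \<bar>\<psi> (v i) - \<psi> (u i)\<bar>) \<le> r + growth_const C * (\<Sum>i<n. v i - u i)"
    if C: "0 \<le> C" and uv: "\<And>i. i < n \<Longrightarrow> 0 \<le> u i \<and> u i \<le> v i \<and> v i \<le> 1"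
      and dis: "disjoint_family_on (\<lambda>i. {u i<..<v i}) {..<n}" for C and n :: nat and u v
  proof (rule LIMSEQ_le_const2)
    have "(\<lambda>k. \<phi> k (v i)) \<longlonglongrightarrow> \<psi> (v i)" "(\<lambda>k. \<phi> k (u i)) \<longlonglongrightarrow> \<psi> (u i)" if "i < n" for i
      using uv[OF that] by (intro lim; simp)+
    then show "(\<lambda>k. C * (\<Sum>i<n. \<bar>\<phi> k (v i) - \<phi> k (u i)\<bar>)) \<longlonglongrightarrow> C * (\<Sum>i<n. \<bar>\<psi> (v i) - \<psi> (u i)\<bar>)"
      by (intro tendsto_intros) auto
    show "\<exists>N. \<forall>k\<ge>N. C * (\<Sum>i<n. \<bar>\<phi> k (v i) - \<phi> k (u i)\<bar>) \<le> r + growth_const C * (\<Sum>i<n. v i - u i)"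
      using action_bound_variation[OF AC \<phi> r C, of "{..<n}" u v] uv dis by auto
  qed
  have "absolutely_continuous_fun 0 1 \<psi>"
    unfolding absolutely_continuous_fun_def
  proof (intro allI impI)
    fix e :: real assume e: "0 < e"
    \<comment> \<open>Chosen so that \<open>r + (r + 1) < C * e\<close>, where \<open>r + 1\<close>
      bounds the contribution of the lengths.\<close>
    define C where "C = 2 * (r + 1) / e"
    have C: "0 < C" "C * e = 2 * (r + 1)" using e r by (auto simp: C_def)
    let ?K = "growth_const C + 1"
    have K: "0 < ?K" by (intro add_nonneg_pos) simp_all
    show "\<exists>d>0. \<forall>(n::nat) u v. (\<forall>i<n. 0 \<le> u i \<and> u i \<le> v i \<and> v i \<le> 1) \<and>
        disjoint_family_on (\<lambda>i. {u i<..<v i}) {..<n} \<and> (\<Sum>i<n. v i - u i) < d \<longrightarrow>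
        (\<Sum>i<n. \<bar>\<psi> (v i) - \<psi> (u i)\<bar>) < e"
    proof (intro exI[of _ "(r + 1) / ?K"] conjI allI impI)
      show "0 < (r + 1) / ?K" using r K by simp
      fix n :: nat and u v
      assume h: "(\<forall>i<n. 0 \<le> u i \<and> u i \<le> v i \<and> v i \<le> 1) \<and>
        disjoint_family_on (\<lambda>i. {u i<..<v i}) {..<n} \<and> (\<Sum>i<n. v i - u i) < (r + 1) / ?K"
      have len: "0 \<le> (\<Sum>i<n. v i - u i)" using h by (intro sum_nonneg) auto
      have "C * (\<Sum>i<n. \<bar>\<psi> (v i) - \<psi> (u i)\<bar>) \<le> r + growth_const C * (\<Sum>i<n. v i - u i)"
        using h C by (intro bound) auto
      also have "\<dots> \<le> r + ?K * (\<Sum>i<n. v i - u i)" using len by (simp add: mult_right_mono)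
      also have "\<dots> < r + ?K * ((r + 1) / ?K)" using h K by (intro add_strict_left_mono mult_strict_left_mono) auto
      also have "\<dots> < C * e" using K r by (simp add: C(2))
      finally show "(\<Sum>i<n. \<bar>\<psi> (v i) - \<psi> (u i)\<bar>) < e" using C(1) by simp
    qed
  qed
  moreover have "\<psi> 0 = 0"
  proof (rule LIMSEQ_unique)
    show "(\<lambda>k. \<phi> k 0) \<longlonglongrightarrow> \<psi> 0" by (rule lim) simp
    show "(\<lambda>k. \<phi> k 0) \<longlonglongrightarrow> 0" using AC01_zero[OF AC] by simp
  qed
  ultimately show AC': "\<psi> \<in> AC01" using ext by (simp add: AC01_def)
  have slope_le: "(\<integral>\<^sup>+t. rate (cell_slope m \<psi> (cell_index m t)) * indicator {0<..1} t \<partial>lborel) \<le> ennreal r" if m: "0 < m" for m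
  proof (rule nn_integral_le_liminf)
    fix k
    show "(\<lambda>t. rate (cell_slope m (\<phi> k) (cell_index m t)) * indicator {0<..1} t) \<in> borel_measurable lborel"
      by (intro borel_measurable_times_ennreal measurable_compose[OF cell_index_measurable]) simp_all
    show "(\<integral>\<^sup>+t. rate (cell_slope m (\<phi> k) (cell_index m t)) * indicator {0<..1} t \<partial>lborel) \<le> ennreal r"
      unfolding grid_action_eq_nn_integral[OF m] by (rule order_trans[OF grid_action_le[OF AC m] \<phi>])
  next
    have "rate (cell_slope m \<psi> (cell_index m t)) \<le> liminf (\<lambda>k. rate (cell_slope m (\<phi> k) (cell_index m t)))"
      if t: "t \<in> {0<..1}" for t
    proof (rule rate_lsc)
      have "cell_index m t < m" by (rule cell_index_less[OF m]) (use t in auto)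
      then have "real (cell_index m t) / real m \<in> {0..1}" "real (Suc (cell_index m t)) / real m \<in> {0..1}"
        using m by (auto simp: divide_le_eq_1)
      then show "(\<lambda>k. cell_slope m (\<phi> k) (cell_index m t)) \<longlonglongrightarrow> cell_slope m \<psi> (cell_index m t)"
        unfolding cell_slope_def by (intro tendsto_intros lim)
    qed
    then show "AE t in lborel. rate (cell_slope m \<psi> (cell_index m t)) * indicator {0<..1} t \<le>
        liminf (\<lambda>k. rate (cell_slope m (\<phi> k) (cell_index m t)) * indicator {0<..1} t)"
      by (intro AE_I2) (auto simp: indicator_def)
  qed
  from AC' have "absolutely_continuous_fun 0 1 \<psi>" by (simp add: AC01_def)
  from absolutely_continuous_fun_FTC[OF this] obtain g where
    g: "AE t in lborel. t \<in> {0<..<1} \<longrightarrow> (\<psi> has_real_derivative g t) (at t)" by blast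
  show "action \<psi> \<le> ennreal r"
    unfolding action_eq[OF AC' g]
  proof (rule nn_integral_le_liminf)
    fix n
    show "(\<lambda>t. rate (cell_slope (Suc n) \<psi> (cell_index (Suc n) t)) * indicator {0<..1} t) \<in> borel_measurable lborel"
      by (intro borel_measurable_times_ennreal measurable_compose[OF cell_index_measurable]) simp_all
    show "(\<integral>\<^sup>+t. rate (cell_slope (Suc n) \<psi> (cell_index (Suc n) t)) * indicator {0<..1} t \<partial>lborel) \<le> ennreal r"
      by (rule slope_le) simp
  next
    show "AE t in lborel. rate (g t) * indicator {0<..1} t \<le>
        liminf (\<lambda>n. rate (cell_slope (Suc n) \<psi> (cell_index (Suc n) t)) * indicator {0<..1} t)"
      using g AE_lborel_singleton[of 1]
    proof eventually_elim
      case (elim t)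
      show ?case
      proof (cases "t \<in> {0<..1}")
        case True
        then have t: "t \<in> {0<..<1}" using elim(2) by simp
        with elim(1) have "(\<psi> has_real_derivative g t) (at t)" by blast
        then have "rate (g t) \<le> liminf (\<lambda>n. rate (cell_slope (Suc n) \<psi> (cell_index (Suc n) t)))"
          using t by (intro rate_lsc cell_slope_LIMSEQ) auto
        then show ?thesis using True by simp
      qed simp
    qed
  qed
qed

text \<open>Functions in a sublevel set are continuous, and \<open>action_bound_variation\<close>
  for single intervals makes them bounded and equicontinuous. So Arzela-Ascoli applies although
  \<open>D01\<close> contains jumps.\<close>

theorem action_functional_levy_action: "action_functional (mtopology_of D01_metric) action"
  unfolding action_functional_def
proof (intro allI impI)
  fix r :: real assume r: "0 \<le> r"
  interpret D: Metric_space D01 "mdist D01_metric"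
    using Metric_space_mspace_mdist[of D01_metric] by simp
  have top: "mtopology_of D01_metric = D.mtopology" by (simp add: mtopology_of_def)
  have "compactin D.mtopology {x \<in> D01. action x \<le> ennreal r}"
    unfolding D.compactin_sequentially
  proof (intro conjI allI impI)
    show "{x \<in> D01. action x \<le> ennreal r} \<subseteq> D01" by blast
    fix s :: "nat \<Rightarrow> real \<Rightarrow> real" assume "range s \<subseteq> {x \<in> D01. action x \<le> ennreal r}"
    then have s: "s n \<in> D01" "action (s n) \<le> ennreal r" for n by auto
    have AC: "s n \<in> AC01" for n by (rule action_finite_imp_AC01[OF s(2)])
    have incr: "C * \<bar>s n y - s n x\<bar> \<le> r + growth_const C * \<bar>y - x\<bar>" if C: "0 \<le> C" and xy: "x \<in> {0..1}" "y \<in> {0..1}" for C x y n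
    proof -
      have "C * \<bar>s n y - s n x\<bar> \<le> r + growth_const C * (y - x)" if "x \<in> {0..1}" "y \<in> {0..1}" "x \<le> y" for x y
        using action_bound_variation[OF AC s(2) r C, of "{0::nat}" "\<lambda>_. x" "\<lambda>_. y" n] that
        by (simp add: disjoint_family_on_def)
      from this[of x y] this[of y x] show ?thesis using xy by (cases "x \<le> y") (auto simp: abs_minus_commute)
    qed
    have bdd: "norm (s n x) \<le> r + growth_const 1" if x: "x \<in> {0..1}" for n x
    proof -
      have "1 * \<bar>s n x - s n 0\<bar> \<le> r + growth_const 1 * \<bar>x - 0\<bar>" by (rule incr) (use x in auto)
      also have "\<dots> \<le> r + growth_const 1 * 1" using x by (intro add_left_mono mult_left_mono) auto
      finally show ?thesis using AC01_zero[OF AC, of n] by simp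
    qed
    have equi: "\<exists>d. 0 < d \<and> (\<forall>n y. y \<in> {0..1} \<and> norm (x - y) < d \<longrightarrow> norm (s n x - s n y) < e)"
      if x: "x \<in> {0..1}" and e: "0 < e" for x e
    proof -
      define C where "C = 2 * (r + 1) / e"
      have C: "0 < C" "C * e = 2 * (r + 1)" using e r by (auto simp: C_def)
      let ?K = "growth_const C + 1"
      have K: "0 < ?K" by (intro add_nonneg_pos) simp_all
      have "norm (s n x - s n y) < e" if y: "y \<in> {0..1}" "norm (x - y) < (r + 1) / ?K" for n y
      proof -
        have "C * \<bar>s n x - s n y\<bar> \<le> r + growth_const C * \<bar>x - y\<bar>" using C x y by (intro incr) auto
        also have "\<dots> \<le> r + ?K * \<bar>x - y\<bar>" by (simp add: mult_right_mono)
        also have "\<dots> < r + ?K * ((r + 1) / ?K)" using y K by (intro add_strict_left_mono mult_strict_left_mono) auto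
        also have "\<dots> < C * e" using K r by (simp add: C(2))
        finally show ?thesis using C(1) by simp
      qed
      then show ?thesis using K r by (intro exI[of _ "(r + 1) / ?K"]) auto
    qed
    obtain g k where g: "continuous_on {0..1} g" "strict_mono (k :: nat \<Rightarrow> nat)"
      "\<And>e. 0 < e \<Longrightarrow> \<exists>N. \<forall>n x. n \<ge> N \<and> x \<in> {0..1} \<longrightarrow> norm (s (k n) x - g x) < e"
      using Arzela_Ascoli[OF compact_Icc bdd equi] by blast
    define \<psi> where "\<psi> = restrict g {0..1}"
    have lim: "(\<lambda>n. s (k n) t) \<longlonglongrightarrow> \<psi> t" if "t \<in> {0..1}" for t
    proof (rule LIMSEQ_I)
      fix e :: real assume "0 < e"
      from g(3)[OF this] show "\<exists>no. \<forall>n\<ge>no. norm (s (k n) t - \<psi> t) < e"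
        using that by (auto simp: \<psi>_def)
    qed
    have \<psi>: "\<psi> \<in> AC01" "action \<psi> \<le> ennreal r"
      using action_limit[OF s(2) r lim] restrict_extensional[of g "{0..1}"] unfolding \<psi>_def by blast+
    then have D: "\<psi> \<in> D01" using AC01_subset_D01 by blast
    show "\<exists>l k. l \<in> {x \<in> D01. action x \<le> ennreal r} \<and> strict_mono k \<and> limitin D.mtopology (s \<circ> k) l sequentially"
    proof (intro exI[of _ \<psi>] exI[of _ k] conjI g(2))
      show "\<psi> \<in> {x \<in> D01. action x \<le> ennreal r}" using D \<psi> by simp
      show "limitin D.mtopology (s \<circ> k) \<psi> sequentially"
        unfolding D.limit_metric_sequentially
      proof (intro conjI D allI impI)
        fix e :: real assume "0 < e"
        then have "0 < e / 2" by simp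
        from g(3)[OF this] obtain N where N: "\<forall>n x. n \<ge> N \<and> x \<in> {0..1} \<longrightarrow> norm (s (k n) x - g x) < e / 2" by blast
        have "mdist D01_metric (s (k n)) \<psi> < e" if "n \<ge> N" for n
        proof -
          have "mdist D01_metric (s (k n)) \<psi> \<le> e / 2"
          proof (rule mdist_D01_le[OF s(1) D])
            fix t :: real assume "t \<in> {0..1}"
            then show "\<bar>s (k n) t - \<psi> t\<bar> \<le> e / 2" using N that by (auto simp: \<psi>_def intro: less_imp_le)
          qed
          then show ?thesis using \<open>0 < e\<close> by simp
        qed
        then show "\<exists>N. \<forall>n\<ge>N. (s \<circ> k) n \<in> D01 \<and> mdist D01_metric ((s \<circ> k) n) \<psi> < e"
          using s(1) by auto
      qed
    qed
  qed
  then show "compactin (mtopology_of D01_metric) {x \<in> topspace (mtopology_of D01_metric). action x \<le> ennreal r}"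
    by (simp add: top)
qed

end

section \<open>The upper bound\<close>

text \<open>The prefactor contributes \<open>\<epsilon> * ln D\<close>, which tends to 0; a
  vanishing probability has logarithm minus infinity.\<close>

lemma Limsup_log_prob_le:
  fixes P :: "real \<Rightarrow> real"
  assumes D: "0 < D" and P: "\<forall>\<^sub>F \<epsilon> in at_right 0. 0 \<le> P \<epsilon> \<and> P \<epsilon> \<le> D * exp (- c / \<epsilon>)"
  shows "Limsup (at_right 0) (\<lambda>\<epsilon>. ereal \<epsilon> * ext_log (P \<epsilon>)) \<le> ereal (- c)"
proof -
  have "\<forall>\<^sub>F \<epsilon> in at_right 0. ereal \<epsilon> * ext_log (P \<epsilon>) \<le> ereal (\<epsilon> * ln D - c)"
    using P eventually_at_right_less[of "0 :: real"]
  proof eventually_elim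
    case (elim \<epsilon>)
    show ?case
    proof (cases "P \<epsilon> = 0")
      case True
      then show ?thesis using elim by (simp add: ext_log_def)
    next
      case False
      then have "ln (P \<epsilon>) \<le> ln (D * exp (- c / \<epsilon>))" using elim by (intro ln_mono) auto
      also have "\<dots> = ln D - c / \<epsilon>" using D by (simp add: ln_mult)
      finally have "\<epsilon> * ln (P \<epsilon>) \<le> \<epsilon> * (ln D - c / \<epsilon>)" using elim by (intro mult_left_mono) auto
      also have "\<dots> = \<epsilon> * ln D - c" using elim by (simp add: right_diff_distrib)
      finally show ?thesis using False by (simp add: ext_log_def)
    qed
  qed
  then have "Limsup (at_right 0) (\<lambda>\<epsilon>. ereal \<epsilon> * ext_log (P \<epsilon>)) \<le> Limsup (at_right 0) (\<lambda>\<epsilon>. ereal (\<epsilon> * ln D - c))"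
    by (rule Limsup_mono)
  also have "\<dots> = ereal (0 * ln D - c)"
    by (intro lim_imp_Limsup tendsto_ereal tendsto_intros) simp_all
  finally show ?thesis by simp
qed

lemma Liminf_log_prob_ge:
  fixes P :: "real \<Rightarrow> real"
  assumes D: "0 < D" and P: "\<forall>\<^sub>F \<epsilon> in at_right 0. D * exp (- c / \<epsilon>) \<le> P \<epsilon>"
  shows "ereal (- c) \<le> Liminf (at_right 0) (\<lambda>\<epsilon>. ereal \<epsilon> * ext_log (P \<epsilon>))"
proof -
  have "\<forall>\<^sub>F \<epsilon> in at_right 0. ereal (\<epsilon> * ln D - c) \<le> ereal \<epsilon> * ext_log (P \<epsilon>)"
    using P eventually_at_right_less[of "0 :: real"]
  proof eventually_elim
    case (elim \<epsilon>)
    have "0 < D * exp (- c / \<epsilon>)" using D by simp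
    then have pos: "0 < P \<epsilon>" using elim by linarith
    have "\<epsilon> * ln D - c = \<epsilon> * (ln D - c / \<epsilon>)" using elim by (simp add: right_diff_distrib)
    also have "ln D - c / \<epsilon> = ln (D * exp (- c / \<epsilon>))" using D by (simp add: ln_mult)
    also have "\<epsilon> * \<dots> \<le> \<epsilon> * ln (P \<epsilon>)" using elim D pos by (intro mult_left_mono ln_mono) auto
    finally show ?case using pos by (simp add: ext_log_def)
  qed
  then have "Liminf (at_right 0) (\<lambda>\<epsilon>. ereal (\<epsilon> * ln D - c)) \<le> Liminf (at_right 0) (\<lambda>\<epsilon>. ereal \<epsilon> * ext_log (P \<epsilon>))"
    by (rule Liminf_mono)
  moreover have "Liminf (at_right 0) (\<lambda>\<epsilon>. ereal (\<epsilon> * ln D - c)) = ereal (0 * ln D - c)"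
    by (intro lim_imp_Liminf tendsto_ereal tendsto_intros) simp_all
  ultimately show ?thesis by simp
qed

text \<open>A step function dominating \<open>\<lambda>v. exp (\<eta> * v)\<close>, whose expectation is read off directly from the
  tail probabilities of its argument.\<close>

definition exp_majorant :: "real \<Rightarrow> ennreal \<Rightarrow> ennreal" where
  "exp_majorant \<eta> v = 1 + (\<Sum>k. ennreal (exp (\<eta> * real (Suc k))) * indicator {ennreal (real k)<..} v)"

text \<open>Stated through a real \<open>w\<close> below \<open>v\<close>, since \<open>v\<close>
  may be infinite.\<close>

lemma exp_majorant_ge:
  assumes \<eta>: "0 < \<eta>" and w: "0 \<le> w" "ennreal w \<le> v"
  shows "ennreal (exp (\<eta> * w)) \<le> exp_majorant \<eta> v"
proof (cases "w = 0")
  case True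
  then show ?thesis by (simp add: exp_majorant_def)
next
  case False
  \<comment> \<open>The integer with \<open>k < w \<le> k + 1\<close>, whose term of the series
    alone dominates.\<close>
  define k where "k = nat (\<lceil>w\<rceil> - 1)"
  have "1 \<le> \<lceil>w\<rceil>" using w False by linarith
  then have "real k = of_int \<lceil>w\<rceil> - 1" by (simp add: k_def of_nat_nat)
  then have k: "real k < w" "w \<le> real (Suc k)" by linarith+
  have "ennreal (real k) < ennreal w" using k by (simp add: ennreal_less_iff)
  then have kv: "ennreal (real k) < v" using w(2) by (rule less_le_trans)
  have "ennreal (exp (\<eta> * w)) \<le> ennreal (exp (\<eta> * real (Suc k)))"
    using k \<eta> by (intro ennreal_leI) simp
  also have "\<dots> = (\<Sum>j\<in>{k}. ennreal (exp (\<eta> * real (Suc j))) * indicator {ennreal (real j)<..} v)"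
    using kv by simp
  also have "\<dots> \<le> (\<Sum>k. ennreal (exp (\<eta> * real (Suc k))) * indicator {ennreal (real k)<..} v)"
    by (rule sum_le_suminf) simp_all
  also have "\<dots> \<le> exp_majorant \<eta> v" unfolding exp_majorant_def by (simp add: add_increasing)
  finally show ?thesis .
qed

lemma exp_majorant_measurable [measurable]: "exp_majorant \<eta> \<in> borel_measurable borel"
  unfolding exp_majorant_def by measurable

lemma prod_exp_majorant_ge:
  assumes \<eta>: "0 < \<eta>" and I: "finite I" and c: "0 \<le> c" "ennreal c < (\<Sum>i\<in>I. v i)"
  shows "ennreal (exp (\<eta> * c)) \<le> (\<Prod>i\<in>I. exp_majorant \<eta> (v i))"
proof -
  \<comment> \<open>The \<open>v i\<close> are replaced by real numbers below them whose sum is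
    still at least \<open>c\<close>; if some \<open>v i\<close> is infinite, all of \<open>c\<close>
    is put on that index.\<close>
  obtain w where w: "\<And>i. i \<in> I \<Longrightarrow> 0 \<le> w i \<and> ennreal (w i) \<le> v i" "c \<le> (\<Sum>i\<in>I. w i)"
  proof (cases "\<exists>i\<in>I. v i = \<top>")
    case True
    then obtain i where i: "i \<in> I" "v i = \<top>" by blast
    show ?thesis
    proof (rule that[of "\<lambda>j. if j = i then c else 0"])
      show "0 \<le> (if j = i then c else 0) \<and> ennreal (if j = i then c else 0) \<le> v j" for j using c i by simp
      show "c \<le> (\<Sum>j\<in>I. if j = i then c else 0)" using I i by simp
    qed
  next
    case False
    then have v: "v i = ennreal (enn2real (v i))" if "i \<in> I" for i using that by (simp add: less_top)
    then have "(\<Sum>i\<in>I. v i) = (\<Sum>i\<in>I. ennreal (enn2real (v i)))" by (intro sum.cong) auto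
    also have "\<dots> = ennreal (\<Sum>i\<in>I. enn2real (v i))" by (rule sum_ennreal) simp
    finally have "c < (\<Sum>i\<in>I. enn2real (v i))" using c by (simp add: ennreal_less_iff)
    then show ?thesis using v by (intro that[of "\<lambda>i. enn2real (v i)"]) (auto simp: eq_refl[OF v[symmetric]])
  qed
  have "ennreal (exp (\<eta> * c)) \<le> ennreal (exp (\<Sum>i\<in>I. \<eta> * w i))"
    using w(2) \<eta> by (intro ennreal_leI) (simp flip: sum_distrib_left)
  also have "\<dots> = (\<Prod>i\<in>I. ennreal (exp (\<eta> * w i)))" by (rule prod_ennreal_exp[OF I, symmetric])
  also have "\<dots> \<le> (\<Prod>i\<in>I. exp_majorant \<eta> (v i))"
  proof (rule prod_mono_ennreal)
    fix i assume "i \<in> I"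
    then show "ennreal (exp (\<eta> * w i)) \<le> exp_majorant \<eta> (v i)" using w(1) by (intro exp_majorant_ge[OF \<eta>]) auto
  qed
  finally show ?thesis .
qed

text \<open>One plus the sum over \<open>k\<close> of \<open>exp (\<eta> * (k + 1))\<close> times
  the tail \<open>2 * exp (- k)\<close>, a geometric series that converges for
  \<open>\<eta> < 1\<close>. This is why the upper bound is first proved with a factor \<eta> below
  one.\<close>

definition tail_const :: "real \<Rightarrow> real" where
  "tail_const \<eta> = 1 + 2 * exp \<eta> / (1 - exp (\<eta> - 1))"

lemma tail_const_pos: "\<eta> < 1 \<Longrightarrow> 0 < tail_const \<eta>"
  unfolding tail_const_def by (intro add_pos_nonneg divide_nonneg_nonneg) auto

lemma nn_integral_exp_majorant:
  assumes \<eta>: "0 < \<eta>" "\<eta> < 1" and V: "V \<in> borel_measurable N" and N: "prob_space N"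
    and tail: "\<And>k :: nat. emeasure N {x \<in> space N. ennreal (real k) < V x} \<le> ennreal (2 * exp (- real k))"
  shows "(\<integral>\<^sup>+x. exp_majorant \<eta> (V x) \<partial>N) \<le> ennreal (tail_const \<eta>)"
proof -
  note [measurable] = V
  have sums: "(\<lambda>k. 2 * exp \<eta> * exp (\<eta> - 1) ^ k) sums (2 * exp \<eta> * (1 / (1 - exp (\<eta> - 1))))"
    by (intro sums_mult geometric_sums) (use \<eta> in simp)
  have "(\<integral>\<^sup>+x. exp_majorant \<eta> (V x) \<partial>N) = (\<integral>\<^sup>+x. 1 \<partial>N) + (\<integral>\<^sup>+x. (\<Sum>k. ennreal (exp (\<eta> * real (Suc k))) * indicator {ennreal (real k)<..} (V x)) \<partial>N)"
    unfolding exp_majorant_def by (rule nn_integral_add) measurable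
  also have "(\<integral>\<^sup>+x. 1 \<partial>N) = 1" using prob_space.emeasure_space_1[OF N] by simp
  also have "(\<integral>\<^sup>+x. (\<Sum>k. ennreal (exp (\<eta> * real (Suc k))) * indicator {ennreal (real k)<..} (V x)) \<partial>N) =
      (\<Sum>k. \<integral>\<^sup>+x. ennreal (exp (\<eta> * real (Suc k))) * indicator {ennreal (real k)<..} (V x) \<partial>N)"
    by (rule nn_integral_suminf) measurable
  also have "\<dots> \<le> (\<Sum>k. ennreal (2 * exp \<eta> * exp (\<eta> - 1) ^ k))"
  proof (intro suminf_le allI)
    fix k
    have "(\<integral>\<^sup>+x. ennreal (exp (\<eta> * real (Suc k))) * indicator {ennreal (real k)<..} (V x) \<partial>N) =
      (\<integral>\<^sup>+x. ennreal (exp (\<eta> * real (Suc k))) * indicator {x \<in> space N. ennreal (real k) < V x} x \<partial>N)"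
      by (intro nn_integral_cong) (simp add: indicator_def)
    also have "\<dots> = ennreal (exp (\<eta> * real (Suc k))) * emeasure N {x \<in> space N. ennreal (real k) < V x}"
      by (rule nn_integral_cmult_indicator) measurable
    also have "\<dots> \<le> ennreal (exp (\<eta> * real (Suc k))) * ennreal (2 * exp (- real k))"
      by (rule mult_left_mono[OF tail]) simp
    also have "\<dots> = ennreal (exp (\<eta> * real (Suc k)) * (2 * exp (- real k)))" by (rule ennreal_mult[symmetric]) simp_all
    also have "exp (\<eta> * real (Suc k)) * (2 * exp (- real k)) = 2 * exp \<eta> * exp (\<eta> - 1) ^ k"
      by (simp add: exp_of_nat_mult[symmetric] exp_add[symmetric] algebra_simps)
    finally show "(\<integral>\<^sup>+x. ennreal (exp (\<eta> * real (Suc k))) * indicator {ennreal (real k)<..} (V x) \<partial>N) \<le>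
      ennreal (2 * exp \<eta> * exp (\<eta> - 1) ^ k)" .
  qed simp_all
  also have "\<dots> = ennreal (2 * exp \<eta> * (1 / (1 - exp (\<eta> - 1))))"
    by (rule suminf_ennreal_eq[OF _ sums]) simp
  finally have "(\<integral>\<^sup>+x. exp_majorant \<eta> (V x) \<partial>N) \<le> 1 + ennreal (2 * exp \<eta> * (1 / (1 - exp (\<eta> - 1))))"
    by (simp add: add_left_mono)
  also have "\<dots> = ennreal 1 + ennreal (2 * exp \<eta> * (1 / (1 - exp (\<eta> - 1))))" by simp
  also have "\<dots> = ennreal (tail_const \<eta>)"
    unfolding tail_const_def using \<eta> by (subst ennreal_plus[symmetric]) auto
  finally show ?thesis .
qed

section \<open>Chernoff bounds for slopes and excursions\<close>

context exponential_levy_process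
begin

lemma increment_measurable:
  assumes "0 \<le> s" "0 \<le> h"
  shows "(\<lambda>\<omega>. L (s + h) \<omega> - L s \<omega>) \<in> borel_measurable M"
  using assms by (intro borel_measurable_diff random_variable_L) auto

lemma chernoff:
  assumes "0 \<le> s" "0 \<le> h"
  shows "emeasure M {\<omega> \<in> space M. c \<le> \<theta> * (L (s + h) \<omega> - L s \<omega>)} \<le> ennreal (exp (h * Psi \<theta> - c))"
proof -
  note [measurable] = increment_measurable[OF assms]
  have "emeasure M {\<omega> \<in> space M. c \<le> \<theta> * (L (s + h) \<omega> - L s \<omega>)} =
     (\<integral>\<^sup>+\<omega>. indicator {\<omega> \<in> space M. c \<le> \<theta> * (L (s + h) \<omega> - L s \<omega>)} \<omega> \<partial>M)"
    by (rule nn_integral_indicator[symmetric]) measurable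
  also have "\<dots> \<le> (\<integral>\<^sup>+\<omega>. ennreal (exp (\<theta> * (L (s + h) \<omega> - L s \<omega>) + (- c))) \<partial>M)"
  proof (rule nn_integral_mono)
    fix \<omega>
    show "indicator {\<omega> \<in> space M. c \<le> \<theta> * (L (s + h) \<omega> - L s \<omega>)} \<omega> \<le> ennreal (exp (\<theta> * (L (s + h) \<omega> - L s \<omega>) + (- c)))"
    proof (cases "c \<le> \<theta> * (L (s + h) \<omega> - L s \<omega>)")
      case True
      have "indicator {\<omega> \<in> space M. c \<le> \<theta> * (L (s + h) \<omega> - L s \<omega>)} \<omega> \<le> (1 :: ennreal)"
        by (simp add: indicator_def)
      also have "1 \<le> ennreal (exp (\<theta> * (L (s + h) \<omega> - L s \<omega>) + (- c)))"
        unfolding ennreal_ge_1 one_le_exp_iff using True by simp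
      finally show ?thesis .
    qed simp
  qed
  also have "\<dots> = ennreal (exp (h * Psi \<theta> + (- c)))" by (rule nn_integral_exp_increment_affine[OF assms])
  finally show ?thesis by simp
qed

text \<open>In dimension one \<open>{rate > y}\<close> is a union of two half-lines, so Chernoff's bound controls it
  without a covering argument.\<close>

lemma half_line_tail:
  assumes s: "0 \<le> s" and T: "0 < T" and \<zeta>: "\<zeta> = 1 \<or> \<zeta> = - 1"
  shows "emeasure M {\<omega> \<in> space M. \<exists>\<xi>>0. y < \<zeta> * \<xi> * ((L (s + T) \<omega> - L s \<omega>) / T) - Psi (\<zeta> * \<xi>)} \<le> ennreal (exp (- T * y))"
proof -
  note [measurable] = increment_measurable[OF s less_imp_le[OF T]]
  define Y where "Y \<omega> = \<zeta> * ((L (s + T) \<omega> - L s \<omega>) / T)" for \<omega>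
  have Ym [measurable]: "Y \<in> borel_measurable M"
    unfolding Y_def by measurable
  \<comment> \<open>The slopes, measured in direction \<zeta>, at which some tilt in that direction
    certifies a rate above \<open>y\<close>. The set is closed upwards and has no least element, so
    its rational points suffice as thresholds.\<close>
  define A where "A = {q. \<exists>\<xi>>0. y < \<xi> * q - Psi (\<zeta> * \<xi>)}"
  have ev: "{\<omega> \<in> space M. \<exists>\<xi>>0. y < \<zeta> * \<xi> * ((L (s + T) \<omega> - L s \<omega>) / T) - Psi (\<zeta> * \<xi>)} = {\<omega> \<in> space M. Y \<omega> \<in> A}"
    by (simp add: A_def Y_def mult.assoc mult.left_commute)
  have one: "emeasure M {\<omega> \<in> space M. q \<le> Y \<omega>} \<le> ennreal (exp (- T * y))" if qA: "q \<in> A" for q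
  proof -
    obtain \<xi> where \<xi>: "0 < \<xi>" "y < \<xi> * q - Psi (\<zeta> * \<xi>)" using qA by (auto simp: A_def)
    have "{\<omega> \<in> space M. q \<le> Y \<omega>} \<subseteq> {\<omega> \<in> space M. T * \<xi> * q \<le> (\<zeta> * \<xi>) * (L (s + T) \<omega> - L s \<omega>)}"
    proof safe
      fix \<omega> assume "q \<le> Y \<omega>"
      then have "T * \<xi> * q \<le> T * \<xi> * Y \<omega>" using T \<xi> by (intro mult_left_mono) auto
      also have "\<dots> = (\<zeta> * \<xi>) * (L (s + T) \<omega> - L s \<omega>)" using T by (simp add: Y_def)
      finally show "T * \<xi> * q \<le> (\<zeta> * \<xi>) * (L (s + T) \<omega> - L s \<omega>)" .
    qed
    then have "emeasure M {\<omega> \<in> space M. q \<le> Y \<omega>} \<le> emeasure M {\<omega> \<in> space M. T * \<xi> * q \<le> (\<zeta> * \<xi>) * (L (s + T) \<omega> - L s \<omega>)}"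
      by (rule emeasure_mono) measurable
    also have "\<dots> \<le> ennreal (exp (T * Psi (\<zeta> * \<xi>) - T * \<xi> * q))" by (rule chernoff[OF s less_imp_le[OF T]])
    also have "\<dots> \<le> ennreal (exp (- T * y))"
    proof (intro ennreal_leI, subst exp_le_cancel_iff)
      have "T * y \<le> T * (\<xi> * q - Psi (\<zeta> * \<xi>))" using T \<xi> by (intro mult_left_mono) auto
      then show "T * Psi (\<zeta> * \<xi>) - T * \<xi> * q \<le> - T * y" by (simp add: algebra_simps)
    qed
    finally show ?thesis .
  qed
  have below: "\<exists>r\<in>\<rat>. r \<in> A \<and> r \<le> q" if qA: "q \<in> A" for q
  proof -
    obtain \<xi> where \<xi>: "0 < \<xi>" "y < \<xi> * q - Psi (\<zeta> * \<xi>)" using qA by (auto simp: A_def)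
    then have "(y + Psi (\<zeta> * \<xi>)) / \<xi> < q" by (simp add: field_simps)
    from Rats_dense_in_real[OF this] obtain r where r: "r \<in> \<rat>" "(y + Psi (\<zeta> * \<xi>)) / \<xi> < r" "r < q" by blast
    then have "y < \<xi> * r - Psi (\<zeta> * \<xi>)" using \<xi> by (simp add: field_simps)
    then show ?thesis using r \<xi> by (intro bexI[of _ r]) (auto simp: A_def)
  qed
  have up: "x \<in> A" if qA: "q \<in> A" and qx: "q \<le> x" for q x
  proof -
    obtain \<xi> where \<xi>: "0 < \<xi>" "y < \<xi> * q - Psi (\<zeta> * \<xi>)" using qA by (auto simp: A_def)
    have "\<xi> * q \<le> \<xi> * x" using \<xi> qx by (intro mult_left_mono) auto
    then have "y < \<xi> * x - Psi (\<zeta> * \<xi>)" using \<xi>(2) by linarith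
    then show ?thesis using \<xi>(1) by (auto simp: A_def)
  qed
  show ?thesis
  proof (cases "A \<inter> \<rat> = {}")
    case True
    then have "A = {}" using below by blast
    then show ?thesis unfolding ev by simp
  next
    case False
    define r where "r = from_nat_into (A \<inter> \<rat>)"
    have r: "range r = A \<inter> \<rat>"
      unfolding r_def by (intro range_from_nat_into False countable_Int2 countable_rat)
    define B where "B n = {\<omega> \<in> space M. \<exists>i\<le>n. r i \<le> Y \<omega>}" for n :: nat
    have Bm: "B n \<in> sets M" for n
    proof -
      have "B n = (\<Union>i\<in>{..n}. {\<omega> \<in> space M. r i \<le> Y \<omega>})" by (auto simp: B_def)
      also have "\<dots> \<in> sets M" by (intro sets.finite_UN) auto
      finally show ?thesis .
    qed
    have Bn: "emeasure M (B n) \<le> ennreal (exp (- T * y))" for n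
    proof -
      \<comment> \<open>A finite union of nested half-lines is the one with the least threshold, so
        Chernoff's bound is paid once and survives the countable union.\<close>
      define q where "q = Min (r ` {..n})"
      have q: "q \<in> r ` {..n}" unfolding q_def by (rule Min_in) auto
      have "B n \<subseteq> {\<omega> \<in> space M. q \<le> Y \<omega>}"
      proof
        fix \<omega> assume "\<omega> \<in> B n"
        then obtain i where i: "\<omega> \<in> space M" "i \<le> n" "r i \<le> Y \<omega>" by (auto simp: B_def)
        have "q \<le> r i" unfolding q_def using i by (intro Min_le) auto
        then show "\<omega> \<in> {\<omega> \<in> space M. q \<le> Y \<omega>}" using i by simp
      qed
      then have "emeasure M (B n) \<le> emeasure M {\<omega> \<in> space M. q \<le> Y \<omega>}" by (intro emeasure_mono) measurable
      also have "q \<in> A" using q r by blast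
      then have "emeasure M {\<omega> \<in> space M. q \<le> Y \<omega>} \<le> ennreal (exp (- T * y))" by (rule one)
      finally show ?thesis .
    qed
    have "{\<omega> \<in> space M. Y \<omega> \<in> A} = (\<Union>n. B n)"
    proof (intro set_eqI iffI)
      fix \<omega> assume w: "\<omega> \<in> {\<omega> \<in> space M. Y \<omega> \<in> A}"
      then obtain q where "q \<in> A \<inter> \<rat>" "q \<le> Y \<omega>" using below by blast
      then obtain i where "r i \<le> Y \<omega>" using r by (metis rangeE)
      then show "\<omega> \<in> (\<Union>n. B n)" using w by (auto simp: B_def)
    next
      fix \<omega> assume "\<omega> \<in> (\<Union>n. B n)"
      then obtain i where i: "\<omega> \<in> space M" "r i \<le> Y \<omega>" by (auto simp: B_def)
      have "r i \<in> A" using r by blast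
      then show "\<omega> \<in> {\<omega> \<in> space M. Y \<omega> \<in> A}" using up i by blast
    qed
    moreover have "emeasure M (\<Union>n. B n) = (SUP n. emeasure M (B n))"
    proof (rule SUP_emeasure_incseq[symmetric])
      show "range B \<subseteq> sets M" using Bm by blast
      show "incseq B" unfolding incseq_def B_def by (blast intro: order_trans)
    qed
    ultimately show ?thesis unfolding ev using Bn by (simp add: SUP_least)
  qed
qed

lemma rate_tail:
  assumes s: "0 \<le> s" and T: "0 < T" and y: "0 \<le> y"
  shows "emeasure M {\<omega> \<in> space M. ennreal y < rate ((L (s + T) \<omega> - L s \<omega>) / T)} \<le> ennreal (2 * exp (- T * y))"
proof -
  let ?q = "\<lambda>\<omega>. (L (s + T) \<omega> - L s \<omega>) / T"
  let ?A = "\<lambda>\<zeta>. {\<omega> \<in> space M. \<exists>\<xi>>0. y < \<zeta> * \<xi> * ?q \<omega> - Psi (\<zeta> * \<xi>)}"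
  have qm [measurable]: "?q \<in> borel_measurable M" using increment_measurable[OF s less_imp_le[OF T]] by measurable
  have Am: "?A \<zeta> \<in> sets M" for \<zeta>
  proof -
    have "open {q. \<exists>\<xi>>0. y < \<zeta> * \<xi> * q - Psi (\<zeta> * \<xi>)}"
    proof -
      have "{q. \<exists>\<xi>>0. y < \<zeta> * \<xi> * q - Psi (\<zeta> * \<xi>)} = (\<Union>\<xi>\<in>{0<..}. {q. y < \<zeta> * \<xi> * q - Psi (\<zeta> * \<xi>)})" by auto
      also have "open \<dots>" by (intro open_UN ballI open_Collect_less continuous_intros)
      finally show ?thesis .
    qed
    then have "?q -` {q. \<exists>\<xi>>0. y < \<zeta> * \<xi> * q - Psi (\<zeta> * \<xi>)} \<inter> space M \<in> sets M"
      by (intro measurable_sets[OF qm]) auto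
    then show ?thesis by (simp add: vimage_def Int_def conj_commute)
  qed
  have "{\<omega> \<in> space M. ennreal y < rate (?q \<omega>)} \<subseteq> ?A 1 \<union> ?A (- 1)"
  proof
    fix \<omega> assume w: "\<omega> \<in> {\<omega> \<in> space M. ennreal y < rate (?q \<omega>)}"
    then obtain \<xi> where "ennreal y < ennreal (\<xi> * ?q \<omega> - Psi \<xi>)"
      unfolding rate_eq_SUP less_SUP_iff by auto
    then have \<xi>: "y < \<xi> * ?q \<omega> - Psi \<xi>" using y by (simp add: ennreal_less_iff)
    \<comment> \<open>\<xi> = 0 contributes nothing, as \<open>y \<ge> 0\<close> and
      \<open>Psi 0 = 0\<close>. The two signs account for the factor 2.\<close>
    consider "0 < \<xi>" | "\<xi> = 0" | "0 < - \<xi>" by linarith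
    then show "\<omega> \<in> ?A 1 \<union> ?A (- 1)"
    proof cases
      case 1
      then show ?thesis using \<xi> w by auto
    next
      case 2
      then show ?thesis using \<xi> y by simp
    next
      case 3
      then have "\<omega> \<in> ?A (- 1)" using \<xi> w by (auto intro!: exI[of _ "- \<xi>"])
      then show ?thesis by blast
    qed
  qed
  then have "emeasure M {\<omega> \<in> space M. ennreal y < rate (?q \<omega>)} \<le> emeasure M (?A 1 \<union> ?A (- 1))"
    by (rule emeasure_mono) (intro sets.Un Am)
  also have "\<dots> \<le> emeasure M (?A 1) + emeasure M (?A (- 1))" by (rule emeasure_subadditive[OF Am Am])
  also have "\<dots> \<le> ennreal (exp (- T * y)) + ennreal (exp (- T * y))"
    by (intro add_mono half_line_tail[OF s T]) simp_all
  also have "\<dots> = ennreal (2 * exp (- T * y))" by (simp flip: ennreal_plus)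
  finally show ?thesis .
qed

text \<open>By \<open>rate_tail\<close> at \<open>y = k / T\<close>, the variable
  \<open>T * rate\<close> of a slope has tail at most \<open>2 * exp (- k)\<close> whatever
  \<open>T\<close> is. Hence its exponential moment of order \<eta>, and with it the prefactor, does
  not depend on the length of the blocks.\<close>

lemma grid_rate_tail:
  assumes T: "0 < T" and \<eta>: "0 < \<eta>" "\<eta> < 1" and c: "0 \<le> c"
  shows "emeasure M {\<omega> \<in> space M. ennreal c < (\<Sum>b<m. ennreal T * rate ((L (real (Suc b) * T) \<omega> - L (real b * T) \<omega>) / T))}
    \<le> ennreal (tail_const \<eta> ^ m * exp (- \<eta> * c))"
proof -
  define V where "V b \<omega> = ennreal T * rate ((L (real (Suc b) * T) \<omega> - L (real b * T) \<omega>) / T)" for b \<omega>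
  have pos: "0 \<le> real b * T" for b using T by simp
  have step: "real (Suc b) * T = real b * T + T" for b by (simp add: algebra_simps)
  have Vm [measurable]: "V b \<in> borel_measurable M" for b
    unfolding V_def step using increment_measurable[OF pos less_imp_le[OF T]] by measurable
  have ind: "indep_vars (\<lambda>_. borel) (\<lambda>b \<omega>. exp_majorant \<eta> (V b \<omega>)) {..<m}"
  proof -
    have "indep_vars (\<lambda>_. borel) (\<lambda>i \<omega>. L (real (Suc i) * T) \<omega> - L (real i * T) \<omega>) {..<m}"
      using indep_grid_increments[of 0 T m] T by simp
    then show ?thesis unfolding V_def by (rule indep_vars_compose2) measurable
  qed
  have E: "(\<integral>\<^sup>+\<omega>. exp_majorant \<eta> (V b \<omega>) \<partial>M) \<le> ennreal (tail_const \<eta>)" for b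
  proof (rule nn_integral_exp_majorant[OF \<eta> Vm prob_space_axioms])
    fix k :: nat
    note [measurable] = increment_measurable[OF pos less_imp_le[OF T], of b]
    have "{\<omega> \<in> space M. ennreal (real k) < V b \<omega>} \<subseteq> {\<omega> \<in> space M. ennreal (real k / T) < rate ((L (real b * T + T) \<omega> - L (real b * T) \<omega>) / T)}"
    proof safe
      fix \<omega> assume "ennreal (real k) < V b \<omega>"
      moreover have "ennreal (real k) = ennreal T * ennreal (real k / T)"
        using T by (subst ennreal_mult[symmetric]) auto
      ultimately have "ennreal T * ennreal (real k / T) < ennreal T * rate ((L (real b * T + T) \<omega> - L (real b * T) \<omega>) / T)"
        by (simp only: V_def step)
      then show "ennreal (real k / T) < rate ((L (real b * T + T) \<omega> - L (real b * T) \<omega>) / T)"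
        by (meson mult_left_mono not_le zero_le)
    qed
    then have "emeasure M {\<omega> \<in> space M. ennreal (real k) < V b \<omega>} \<le>
        emeasure M {\<omega> \<in> space M. ennreal (real k / T) < rate ((L (real b * T + T) \<omega> - L (real b * T) \<omega>) / T)}"
      by (rule emeasure_mono) measurable
    also have "\<dots> \<le> ennreal (2 * exp (- T * (real k / T)))" by (rule rate_tail[OF pos T]) (use T in simp)
    also have "- T * (real k / T) = - real k" using T by simp
    finally show "emeasure M {\<omega> \<in> space M. ennreal (real k) < V b \<omega>} \<le> ennreal (2 * exp (- real k))" .
  qed
  have Am: "{\<omega> \<in> space M. ennreal c < (\<Sum>b<m. V b \<omega>)} \<in> sets M" by measurable
  have "emeasure M {\<omega> \<in> space M. ennreal c < (\<Sum>b<m. V b \<omega>)} = (\<integral>\<^sup>+\<omega>. indicator {\<omega> \<in> space M. ennreal c < (\<Sum>b<m. V b \<omega>)} \<omega> \<partial>M)"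
    using Am by simp
  also have "\<dots> \<le> (\<integral>\<^sup>+\<omega>. ennreal (exp (- \<eta> * c)) * (\<Prod>b<m. exp_majorant \<eta> (V b \<omega>)) \<partial>M)"
  proof (rule nn_integral_mono)
    fix \<omega>
    show "indicator {\<omega> \<in> space M. ennreal c < (\<Sum>b<m. V b \<omega>)} \<omega> \<le> ennreal (exp (- \<eta> * c)) * (\<Prod>b<m. exp_majorant \<eta> (V b \<omega>))"
    proof (cases "ennreal c < (\<Sum>b<m. V b \<omega>)")
      case True
      have "1 = ennreal (exp (- \<eta> * c)) * ennreal (exp (\<eta> * c))"
        by (subst ennreal_mult[symmetric]) (simp_all add: exp_add[symmetric])
      also have "\<dots> \<le> ennreal (exp (- \<eta> * c)) * (\<Prod>b<m. exp_majorant \<eta> (V b \<omega>))"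
        by (intro mult_left_mono prod_exp_majorant_ge \<eta>(1) c True) simp_all
      finally show ?thesis by (simp add: indicator_def)
    qed simp
  qed
  also have "\<dots> = ennreal (exp (- \<eta> * c)) * (\<integral>\<^sup>+\<omega>. (\<Prod>b<m. exp_majorant \<eta> (V b \<omega>)) \<partial>M)"
    by (rule nn_integral_cmult) measurable
  also have "(\<integral>\<^sup>+\<omega>. (\<Prod>b<m. exp_majorant \<eta> (V b \<omega>)) \<partial>M) = (\<Prod>b<m. \<integral>\<^sup>+\<omega>. exp_majorant \<eta> (V b \<omega>) \<partial>M)"
    by (rule indep_vars_nn_integral[OF _ ind]) auto
  also have "ennreal (exp (- \<eta> * c)) * \<dots> \<le> ennreal (exp (- \<eta> * c)) * (\<Prod>b<m. ennreal (tail_const \<eta>))"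
    by (intro mult_left_mono prod_mono_ennreal E) simp
  also have "\<dots> = ennreal (tail_const \<eta> ^ m * exp (- \<eta> * c))"
    using tail_const_pos[OF \<eta>(2)] by (simp add: ennreal_power mult.commute flip: ennreal_mult)
  finally show ?thesis unfolding V_def .
qed

text \<open>The slope \<open>p\<close> is artificial:
  \<open>\<theta> * p = - \<bar>Psi \<theta>\<bar>\<close> secures the submartingale hypothesis even
  where \<open>Psi \<theta>\<close> is negative, and subtracting the polygon then only enlarges the
  excursion. The price is the factor 2 in the exponent.\<close>

lemma one_block_excursion:
  assumes s: "0 \<le> s" and T: "0 < T" and \<theta>: "\<theta> \<noteq> 0"
  obtains E where "E \<in> sets M" "emeasure M E \<le> ennreal (exp (2 * T * \<bar>Psi \<theta>\<bar> - x))"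
    "\<And>\<omega> u. \<omega> \<in> space M \<Longrightarrow> 0 \<le> u \<Longrightarrow> u \<le> T \<Longrightarrow> x < \<theta> * (L (s + u) \<omega> - L s \<omega>) \<Longrightarrow> \<omega> \<in> E"
proof -
  define p where "p = (\<lambda>_ :: nat. - \<bar>Psi \<theta>\<bar> / \<theta>)"
  have p: "\<theta> * p b = - \<bar>Psi \<theta>\<bar>" for b using \<theta> by (simp add: p_def)
  define E where "E = {\<omega> \<in> space M. \<exists>u\<in>{0..real 1 * T}. x < \<theta> * (L (s + u) \<omega> - L s \<omega> - polygon 1 T p u)}"
  have k: "Psi ((\<lambda>_. 0) b) + \<theta> * p b \<le> Psi ((\<lambda>_. 0) b + \<theta>)" for b by (simp add: p)
  have Em: "E \<in> sets M" unfolding E_def by (rule path_excursion_measurable[OF s T k])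
  have tilt1: "tilt s T 1 (\<lambda>_. 0) \<omega> = 1" for \<omega> by (simp add: tilt_def)
  have "emeasure M E = (\<integral>\<^sup>+\<omega>. tilt s T 1 (\<lambda>_. 0) \<omega> * indicator E \<omega> \<partial>M)"
    by (simp only: tilt1 mult_1_left nn_integral_indicator[OF Em])
  also have "\<dots> \<le> ennreal (exp (T * (\<Sum>b<1. Psi (0 + \<theta>) - Psi 0 - \<theta> * p b) - x))"
    unfolding E_def by (rule path_maximal[OF s T k])
  also have "T * (\<Sum>b<1. Psi (0 + \<theta>) - Psi 0 - \<theta> * p b) = T * (Psi \<theta> + \<bar>Psi \<theta>\<bar>)" by (simp add: p)
  also have "ennreal (exp (T * (Psi \<theta> + \<bar>Psi \<theta>\<bar>) - x)) \<le> ennreal (exp (2 * T * \<bar>Psi \<theta>\<bar> - x))"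
  proof (intro ennreal_leI, subst exp_le_cancel_iff)
    have "T * (Psi \<theta> + \<bar>Psi \<theta>\<bar>) \<le> T * (2 * \<bar>Psi \<theta>\<bar>)" using T by (intro mult_left_mono) auto
    then show "T * (Psi \<theta> + \<bar>Psi \<theta>\<bar>) - x \<le> 2 * T * \<bar>Psi \<theta>\<bar> - x" by simp
  qed
  finally have Eb: "emeasure M E \<le> ennreal (exp (2 * T * \<bar>Psi \<theta>\<bar> - x))" .
  show ?thesis
  proof (rule that[OF Em Eb])
    fix \<omega> u assume u: "\<omega> \<in> space M" "0 \<le> u" "u \<le> T" "x < \<theta> * (L (s + u) \<omega> - L s \<omega>)"
    have "polygon 1 T p u = p 0 * u" using u by (simp add: polygon_def)
    then have "\<theta> * polygon 1 T p u = - \<bar>Psi \<theta>\<bar> * u" using p[of 0] by (metis mult.assoc)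
    moreover have "0 \<le> \<bar>Psi \<theta>\<bar> * u" using u by simp
    ultimately have "x < \<theta> * (L (s + u) \<omega> - L s \<omega> - polygon 1 T p u)" using u(4) by (simp add: right_diff_distrib)
    then show "\<omega> \<in> E" using u by (auto simp: E_def)
  qed
qed

end

section \<open>Separation from sublevel sets and the upper bound\<close>

lemma openin_D01_ball:
  assumes "openin (mtopology_of D01_metric) U" "f \<in> U"
  obtains \<delta> where "0 < \<delta>" "\<And>g. g \<in> D01 \<Longrightarrow> mdist D01_metric f g < \<delta> \<Longrightarrow> g \<in> U"
proof -
  interpret D: Metric_space D01 "mdist D01_metric"
    using Metric_space_mspace_mdist[of D01_metric] by simp
  have "openin D.mtopology U" using assms(1) by (simp add: mtopology_of_def)
  then have "f \<in> D01" "\<exists>r>0. D.mball f r \<subseteq> U" using assms(2) by (auto simp: D.openin_mtopology)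
  then show ?thesis using that by (auto simp: subset_iff)
qed

text \<open>A Lebesgue number of the cover of \<open>K\<close> by the single open set
  \<open>D01 - F\<close>.\<close>

lemma compactin_closedin_D01_separated:
  assumes K: "compactin (mtopology_of D01_metric) K" and F: "closedin (mtopology_of D01_metric) F"
    and KF: "K \<inter> F = {}"
  obtains \<delta> where "0 < \<delta>" "\<And>f g. f \<in> K \<Longrightarrow> g \<in> F \<Longrightarrow> \<delta> \<le> mdist D01_metric f g"
proof -
  interpret D: Metric_space D01 "mdist D01_metric"
    using Metric_space_mspace_mdist[of D01_metric] by simp
  have top: "mtopology_of D01_metric = D.mtopology" by (simp add: mtopology_of_def)
  have K': "compactin D.mtopology K" and F': "closedin D.mtopology F" using K F by (simp_all add: top)
  have KD: "K \<subseteq> D01" using compactin_subset_topspace[OF K'] by simp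
  have FD: "F \<subseteq> D01" using closedin_subset[OF F'] by simp
  have "openin D.mtopology (D01 - F)" using F' by (auto simp: closedin_def)
  then obtain \<epsilon> where \<epsilon>: "\<epsilon> > 0" "\<forall>x\<in>K. \<exists>U\<in>{D01 - F}. D.mball x \<epsilon> \<subseteq> U"
    using D.lebesgue_number[OF K', of "{D01 - F}"] KD KF by auto
  show ?thesis
  proof (rule that[OF \<epsilon>(1)])
    fix f g assume fg: "f \<in> K" "g \<in> F"
    show "\<epsilon> \<le> mdist D01_metric f g"
    proof (rule ccontr)
      assume "\<not> \<epsilon> \<le> mdist D01_metric f g"
      then have "g \<in> D.mball f \<epsilon>" using fg KD FD by auto
      then show False using \<epsilon>(2) fg by blast
    qed
  qed
qed

lemma space_D01_sigma: "space D01_sigma = D01"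
  unfolding D01_sigma_def by (rule space_measure_of) auto

context exponential_levy_process
begin

lemma scaled_path_eq: "t \<in> {0..1} \<Longrightarrow> scaled_path L \<epsilon> \<omega> t = \<epsilon> * L (t / \<epsilon>) \<omega>"
  by (simp add: scaled_path_def)

lemma scaled_path_D01: "0 < \<epsilon> \<Longrightarrow> \<omega> \<in> space M \<Longrightarrow> scaled_path L \<epsilon> \<omega> \<in> D01"
  using measurable_space[OF measurable_scaled_path, of \<epsilon> \<omega>] by (simp only: space_D01_sigma)

lemma path_event_measurable:
  assumes "0 < \<epsilon>" "F \<in> sets D01_sigma"
  shows "{\<omega> \<in> space M. scaled_path L \<epsilon> \<omega> \<in> F} \<in> sets M"
  using measurable_sets[OF measurable_scaled_path[OF assms(1)] assms(2)]
  by (simp add: vimage_def Int_def conj_commute)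

lemma cell_of_time:
  assumes m: "0 < m" and t: "t \<in> {0..1}"
  obtains b where "b < m" "real b / real m \<le> t" "t \<le> real (Suc b) / real m"
proof (cases "t = 0")
  case True
  then show ?thesis using that[of 0] m by simp
next
  case False
  then have "0 < t" using t by simp
  then have "t \<in> cell m (cell_index m t)" "cell_index m t < m"
    using cell_iff[OF m] cell_index_less[OF m] t by auto
  then show ?thesis using that[of "cell_index m t"] by (simp add: cell_def)
qed

text \<open>Inside a block, path and interpolation both stay within \<open>\<epsilon> * x\<close> of
  their common value at the left end of the block.\<close>

lemma scaled_path_near_polygon:
  assumes m: "0 < m" and \<epsilon>: "0 < \<epsilon>" and T: "T = 1 / (real m * \<epsilon>)" and L0: "L 0 \<omega> = 0"
    and x: "\<And>b u. b < m \<Longrightarrow> 0 \<le> u \<Longrightarrow> u \<le> T \<Longrightarrow> \<bar>L (real b * T + u) \<omega> - L (real b * T) \<omega>\<bar> \<le> x"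
    and p: "p = (\<lambda>b. (L (real (Suc b) * T) \<omega> - L (real b * T) \<omega>) / T)"
    and t: "t \<in> {0..1}"
  shows "\<bar>scaled_path L \<epsilon> \<omega> t - polygon m (1 / real m) p t\<bar> \<le> 2 * \<epsilon> * x"
proof -
  have T0: "0 < T" using m \<epsilon> by (simp add: T)
  have sc: "real b / real m / \<epsilon> = real b * T" for b by (simp add: T)
  have pe: "p b * (1 / real m) = \<epsilon> * (L (real (Suc b) * T) \<omega> - L (real b * T) \<omega>)" for b
    using m \<epsilon> by (simp add: p T)
  have grid: "polygon m (1 / real m) p (real b * (1 / real m)) = \<epsilon> * L (real b * T) \<omega>" if "b \<le> m" for b
    using that
  proof (induction b)
    case 0
    then show ?case by (simp add: L0)
  next
    case (Suc b)
    have "polygon m (1 / real m) p (real (Suc b) * (1 / real m)) =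
        polygon m (1 / real m) p (real b * (1 / real m)) + p b * (real (Suc b) * (1 / real m) - real b * (1 / real m))"
      using Suc m by (intro polygon_cell) (auto simp: divide_right_mono)
    also have "real (Suc b) * (1 / real m) - real b * (1 / real m) = 1 / real m" by (simp add: add_divide_distrib)
    also have "polygon m (1 / real m) p (real b * (1 / real m)) = \<epsilon> * L (real b * T) \<omega>"
      by (rule Suc.IH) (use Suc.prems in simp)
    finally show ?case unfolding pe by (simp only: right_diff_distrib)
  qed
  obtain b where b: "b < m" "real b / real m \<le> t" "t \<le> real (Suc b) / real m"
    using cell_of_time[OF m t] .
  define u where "u = t / \<epsilon> - real b * T"
  have u: "0 \<le> u" "u \<le> T"
  proof -
    have "real b / real m / \<epsilon> \<le> t / \<epsilon>"
      by (rule divide_right_mono[OF b(2)]) (use \<epsilon> in simp)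
    moreover have "t / \<epsilon> \<le> real (Suc b) / real m / \<epsilon>"
      by (rule divide_right_mono[OF b(3)]) (use \<epsilon> in simp)
    ultimately show "0 \<le> u" "u \<le> T" unfolding sc u_def by (auto simp: algebra_simps)
  qed
  have "polygon m (1 / real m) p t = polygon m (1 / real m) p (real b * (1 / real m)) + p b * (t - real b * (1 / real m))"
    using b m by (intro polygon_cell) auto
  also have "\<dots> = \<epsilon> * L (real b * T) \<omega> + p b * (t - real b * (1 / real m))" using grid[of b] b by simp
  finally have Z: "polygon m (1 / real m) p t = \<epsilon> * L (real b * T) \<omega> + p b * (t - real b * (1 / real m))" .
  have "\<bar>p b * (t - real b * (1 / real m))\<bar> \<le> \<bar>p b\<bar> * (1 / real m)"
    unfolding abs_mult using b by (intro mult_left_mono) (auto simp: add_divide_distrib)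
  also have "\<dots> = \<bar>p b * (1 / real m)\<bar>" by (simp add: abs_mult)
  also have "\<dots> = \<epsilon> * \<bar>L (real b * T + T) \<omega> - L (real b * T) \<omega>\<bar>"
    unfolding pe abs_mult using \<epsilon> by (simp add: distrib_right add.commute)
  also have "\<dots> \<le> \<epsilon> * x" using x[OF b(1), of T] T0 \<epsilon> by (intro mult_left_mono) auto
  finally have 1: "\<bar>p b * (t - real b * (1 / real m))\<bar> \<le> \<epsilon> * x" .
  have "\<bar>\<epsilon> * L (t / \<epsilon>) \<omega> - \<epsilon> * L (real b * T) \<omega>\<bar> = \<epsilon> * \<bar>L (real b * T + u) \<omega> - L (real b * T) \<omega>\<bar>"
    using \<epsilon> by (simp add: u_def abs_mult flip: right_diff_distrib)
  also have "\<dots> \<le> \<epsilon> * x" using x[OF b(1) u] \<epsilon> by (intro mult_left_mono) auto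
  finally show ?thesis
    using 1 unfolding scaled_path_eq[OF t] Z by (simp add: abs_le_iff)
qed

text \<open>A path in \<open>F\<close> is at distance at least \<delta> from the sublevel set. So
  either its interpolation has action above \<open>l\<close>, or it strays from the interpolation by
  more than half of \<delta> and has an excursion above \<open>x\<close> in some block. Both events
  have the exponent \<open>\<eta> * l\<close>.\<close>

lemma upper_bound_prob:
  assumes F: "closedin (mtopology_of D01_metric) F" "F \<in> sets D01_sigma"
    and l: "0 \<le> l" "\<And>\<phi>. \<phi> \<in> F \<Longrightarrow> ennreal l < action \<phi>" and \<eta>: "0 < \<eta>" "\<eta> < 1"
  obtains D where "0 < D"
    "\<And>\<epsilon>. 0 < \<epsilon> \<Longrightarrow> prob {\<omega> \<in> space M. scaled_path L \<epsilon> \<omega> \<in> F} \<le> D * exp (- (\<eta> * l) / \<epsilon>)"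
proof -
  define K where "K = {\<phi> \<in> D01. action \<phi> \<le> ennreal l}"
  have K: "compactin (mtopology_of D01_metric) K"
    using action_functional_levy_action l(1) unfolding action_functional_def K_def by simp
  have KF: "K \<inter> F = {}" using l(2) by (force simp: K_def)
  obtain \<delta> where \<delta>: "0 < \<delta>" "\<And>f g. f \<in> K \<Longrightarrow> g \<in> F \<Longrightarrow> \<delta> \<le> mdist D01_metric f g"
    using compactin_closedin_D01_separated[OF K F(1) KF] by blast
  \<comment> \<open>Makes \<open>C * x = (\<eta> * l + 1) / \<epsilon>\<close> for the excursion
    size \<open>x = \<delta> / (4 * \<epsilon>)\<close>; the extra 1 is spent on \<Psi> in the
    choice of \<open>m\<close>.\<close>
  define C where "C = (\<eta> * l + 1) * 4 / \<delta>"
  have C: "0 < C" "C * (\<delta> / 4) = \<eta> * l + 1"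
    using \<delta>(1) \<eta> l(1) by (auto simp: C_def intro!: divide_pos_pos mult_pos_pos add_nonneg_pos)
  define Q where "Q = max \<bar>Psi C\<bar> \<bar>Psi (- C)\<bar>"
  \<comment> \<open>For \<open>T = 1 / (m * \<epsilon>)\<close> this gives
    \<open>2 * T * \<bar>Psi \<theta>\<bar> \<le> 1 / \<epsilon>\<close> at
    \<open>\<theta> = C\<close> and \<open>\<theta> = - C\<close>.\<close>
  obtain m :: nat where m: "0 < m" "2 * Q \<le> real m"
  proof -
    obtain n :: nat where "2 * Q \<le> real n" using real_arch_simple by blast
    then show ?thesis using that[of "Suc n"] by simp
  qed
  \<comment> \<open>The \<open>m\<close> moments of the grid estimate, and excursions in two
    directions on each of \<open>m\<close> blocks.\<close>
  define D where "D = tail_const \<eta> ^ m + 2 * real m"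
  have tc: "0 < tail_const \<eta>" by (rule tail_const_pos[OF \<eta>(2)])
  have "0 < D" unfolding D_def using tc by (intro add_pos_nonneg) auto
  moreover have "prob {\<omega> \<in> space M. scaled_path L \<epsilon> \<omega> \<in> F} \<le> D * exp (- (\<eta> * l) / \<epsilon>)" if \<epsilon>: "0 < \<epsilon>" for \<epsilon>
  proof -
    define T where "T = 1 / (real m * \<epsilon>)"
    define x where "x = \<delta> / (4 * \<epsilon>)"
    have T: "0 < T" using m \<epsilon> by (simp add: T_def)
    have pos: "0 \<le> real b * T" for b using T by simp
    have Q: "2 * T * \<bar>Psi \<theta>\<bar> - C * x \<le> - (\<eta> * l) / \<epsilon>" if "\<theta> = C \<or> \<theta> = - C" for \<theta>
    proof -
      have "2 * \<bar>Psi \<theta>\<bar> \<le> real m" using that m(2) by (auto simp: Q_def)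
      then have "2 * T * \<bar>Psi \<theta>\<bar> \<le> T * real m" using T by simp
      also have "\<dots> = 1 / \<epsilon>" using m by (simp add: T_def)
      finally have "2 * T * \<bar>Psi \<theta>\<bar> \<le> 1 / \<epsilon>" .
      moreover have "C * x = (\<eta> * l + 1) / \<epsilon>" unfolding x_def C(2)[symmetric] using \<epsilon> by simp
      ultimately show ?thesis by (simp add: add_divide_distrib)
    qed
    have ex: "\<exists>E. E \<in> sets M \<and> emeasure M E \<le> ennreal (exp (- (\<eta> * l) / \<epsilon>)) \<and>
       (\<forall>\<omega> u. \<omega> \<in> space M \<longrightarrow> 0 \<le> u \<longrightarrow> u \<le> T \<longrightarrow> C * x < \<theta> * (L (real b * T + u) \<omega> - L (real b * T) \<omega>) \<longrightarrow> \<omega> \<in> E)"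
      if th: "\<theta> = C \<or> \<theta> = - C" for \<theta> b
    proof -
      have "\<theta> \<noteq> 0" using C th by auto
      from one_block_excursion[OF pos[of b] T this, where x="C * x"] obtain E where E: "E \<in> sets M"
        "emeasure M E \<le> ennreal (exp (2 * T * \<bar>Psi \<theta>\<bar> - C * x))"
        "\<And>\<omega> u. \<omega> \<in> space M \<Longrightarrow> 0 \<le> u \<Longrightarrow> u \<le> T \<Longrightarrow> C * x < \<theta> * (L (real b * T + u) \<omega> - L (real b * T) \<omega>) \<Longrightarrow> \<omega> \<in> E"
        by blast
      have "ennreal (exp (2 * T * \<bar>Psi \<theta>\<bar> - C * x)) \<le> ennreal (exp (- (\<eta> * l) / \<epsilon>))"
        by (intro ennreal_leI) (simp only: exp_le_cancel_iff Q[OF th])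
      then show ?thesis using E by (intro exI[of _ E]) (auto intro: order_trans)
    qed
    obtain E1 where E1: "\<And>b. E1 b \<in> sets M" "\<And>b. emeasure M (E1 b) \<le> ennreal (exp (- (\<eta> * l) / \<epsilon>))"
       "\<And>b \<omega> u. \<omega> \<in> space M \<Longrightarrow> 0 \<le> u \<Longrightarrow> u \<le> T \<Longrightarrow> C * x < C * (L (real b * T + u) \<omega> - L (real b * T) \<omega>) \<Longrightarrow> \<omega> \<in> E1 b"
      using ex[of C] by metis
    obtain E2 where E2: "\<And>b. E2 b \<in> sets M" "\<And>b. emeasure M (E2 b) \<le> ennreal (exp (- (\<eta> * l) / \<epsilon>))"
       "\<And>b \<omega> u. \<omega> \<in> space M \<Longrightarrow> 0 \<le> u \<Longrightarrow> u \<le> T \<Longrightarrow> C * x < - C * (L (real b * T + u) \<omega> - L (real b * T) \<omega>) \<Longrightarrow> \<omega> \<in> E2 b"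
      using ex[of "- C"] by metis
    define H where "H = (\<Union>b<m. E1 b \<union> E2 b)"
    define R where "R = {\<omega> \<in> space M. ennreal (l / \<epsilon>) < (\<Sum>b<m. ennreal T * rate ((L (real (Suc b) * T) \<omega> - L (real b * T) \<omega>) / T))}"
    have Hm: "H \<in> sets M" unfolding H_def using E1(1) E2(1) by (intro sets.finite_UN sets.Un) auto
    have Rm: "R \<in> sets M"
    proof -
      have [measurable]: "L (real b * T) \<in> borel_measurable M" for b by (rule random_variable_L[OF pos])
      show ?thesis unfolding R_def by measurable
    qed
    have incl: "\<omega> \<in> H \<union> R" if w: "\<omega> \<in> space M" "L 0 \<omega> = 0" "scaled_path L \<epsilon> \<omega> \<in> F" for \<omega>
    proof (rule ccontr)
      assume nHR: "\<omega> \<notin> H \<union> R"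
      define p where "p = (\<lambda>b. (L (real (Suc b) * T) \<omega> - L (real b * T) \<omega>) / T)"
      define Z where "Z = (\<lambda>t\<in>{0..1}. polygon m (1 / real m) p t)"
      have "\<not> ennreal (l / \<epsilon>) < (\<Sum>b<m. ennreal T * rate (p b))" using nHR w by (simp add: R_def p_def)
      then have "(\<Sum>b<m. ennreal T * rate (p b)) \<le> ennreal (l / \<epsilon>)" by simp
      then have "ennreal \<epsilon> * (\<Sum>b<m. ennreal T * rate (p b)) \<le> ennreal \<epsilon> * ennreal (l / \<epsilon>)"
        by (rule mult_left_mono) simp
      also have "ennreal \<epsilon> * ennreal (l / \<epsilon>) = ennreal l"
        using \<epsilon> l(1) by (subst ennreal_mult[symmetric]) auto
      also have "ennreal \<epsilon> * (\<Sum>b<m. ennreal T * rate (p b)) = action Z"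
      proof -
        have "ennreal \<epsilon> * ennreal T = ennreal (1 / real m)"
          using \<epsilon> T m by (subst ennreal_mult[symmetric]) (auto simp: T_def)
        then show ?thesis unfolding Z_def action_polygon[OF m(1)] sum_distrib_left
          by (simp only: mult.assoc[symmetric])
      qed
      finally have aZ: "action Z \<le> ennreal l" .
      have "Z \<in> AC01" unfolding Z_def by (rule polygon_AC01)
      then have ZD: "Z \<in> D01" using AC01_subset_D01 by blast
      then have "Z \<in> K" using aZ by (simp add: K_def)
      then have far: "\<delta> \<le> mdist D01_metric Z (scaled_path L \<epsilon> \<omega>)" using w(3) by (rule \<delta>(2))
      have near: "\<bar>L (real b * T + u) \<omega> - L (real b * T) \<omega>\<bar> \<le> x" if b: "b < m" "0 \<le> u" "u \<le> T" for b u
      proof (rule ccontr)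
        assume "\<not> ?thesis"
        then have "x < L (real b * T + u) \<omega> - L (real b * T) \<omega> \<or> x < - (L (real b * T + u) \<omega> - L (real b * T) \<omega>)" by linarith
        then have "\<omega> \<in> E1 b \<union> E2 b"
        proof
          assume "x < L (real b * T + u) \<omega> - L (real b * T) \<omega>"
          then have "C * x < C * (L (real b * T + u) \<omega> - L (real b * T) \<omega>)" using C(1) by (rule mult_strict_left_mono)
          then show ?thesis using E1(3)[OF w(1) b(2,3)] by blast
        next
          assume "x < - (L (real b * T + u) \<omega> - L (real b * T) \<omega>)"
          then have "C * x < C * (- (L (real b * T + u) \<omega> - L (real b * T) \<omega>))" using C(1) by (rule mult_strict_left_mono)
          then have "C * x < - C * (L (real b * T + u) \<omega> - L (real b * T) \<omega>)" by (simp only: mult_minus_left mult_minus_right)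
          then show ?thesis using E2(3)[OF w(1) b(2,3)] by blast
        qed
        then show False using nHR b(1) by (auto simp: H_def)
      qed
      have "mdist D01_metric Z (scaled_path L \<epsilon> \<omega>) \<le> \<delta> / 2"
      proof (rule mdist_D01_le[OF ZD scaled_path_D01[OF \<epsilon> w(1)]])
        fix t :: real assume t: "t \<in> {0..1}"
        have "\<bar>scaled_path L \<epsilon> \<omega> t - polygon m (1 / real m) p t\<bar> \<le> 2 * \<epsilon> * x"
          by (rule scaled_path_near_polygon[OF m(1) \<epsilon> T_def w(2) near p_def t])
        also have "2 * \<epsilon> * x = \<delta> / 2" using \<epsilon> by (simp add: x_def)
        finally show "\<bar>Z t - scaled_path L \<epsilon> \<omega> t\<bar> \<le> \<delta> / 2" using t by (simp add: Z_def abs_minus_commute)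
      qed
      then show False using far \<delta>(1) by simp
    qed
    have "emeasure M {\<omega> \<in> space M. scaled_path L \<epsilon> \<omega> \<in> F} \<le> emeasure M (H \<union> R)"
    proof (rule emeasure_mono_AE)
      show "AE \<omega> in M. \<omega> \<in> {\<omega> \<in> space M. scaled_path L \<epsilon> \<omega> \<in> F} \<longrightarrow> \<omega> \<in> H \<union> R"
        using start_0 incl by (auto elim: eventually_mono)
      show "H \<union> R \<in> sets M" using Hm Rm by auto
    qed
    also have "\<dots> \<le> emeasure M H + emeasure M R" by (rule emeasure_subadditive[OF Hm Rm])
    also have "\<dots> \<le> ennreal (2 * real m * exp (- (\<eta> * l) / \<epsilon>)) + ennreal (tail_const \<eta> ^ m * exp (- (\<eta> * l) / \<epsilon>))"
    proof (rule add_mono)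
      have "emeasure M H \<le> (\<Sum>b<m. emeasure M (E1 b \<union> E2 b))"
        unfolding H_def using E1(1) E2(1) by (intro emeasure_subadditive_finite) auto
      also have "\<dots> \<le> (\<Sum>b<m. ennreal (2 * exp (- (\<eta> * l) / \<epsilon>)))"
      proof (rule sum_mono)
        fix b
        have "emeasure M (E1 b \<union> E2 b) \<le> emeasure M (E1 b) + emeasure M (E2 b)"
          by (rule emeasure_subadditive[OF E1(1) E2(1)])
        also have "\<dots> \<le> ennreal (exp (- (\<eta> * l) / \<epsilon>)) + ennreal (exp (- (\<eta> * l) / \<epsilon>))" by (intro add_mono E1(2) E2(2))
        also have "\<dots> = ennreal (2 * exp (- (\<eta> * l) / \<epsilon>))" by (simp flip: ennreal_plus)
        finally show "emeasure M (E1 b \<union> E2 b) \<le> ennreal (2 * exp (- (\<eta> * l) / \<epsilon>))" .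
      qed
      also have "\<dots> = ennreal (\<Sum>b<m. 2 * exp (- (\<eta> * l) / \<epsilon>))" by (rule sum_ennreal) simp
      finally show "emeasure M H \<le> ennreal (2 * real m * exp (- (\<eta> * l) / \<epsilon>))" by (simp add: mult_ac)
      have "emeasure M R \<le> ennreal (tail_const \<eta> ^ m * exp (- \<eta> * (l / \<epsilon>)))"
        unfolding R_def by (rule grid_rate_tail[OF T \<eta>]) (use l \<epsilon> in simp)
      then show "emeasure M R \<le> ennreal (tail_const \<eta> ^ m * exp (- (\<eta> * l) / \<epsilon>))" by simp
    qed
    also have "\<dots> = ennreal (D * exp (- (\<eta> * l) / \<epsilon>))"
      unfolding D_def using tc by (subst ennreal_plus[symmetric]) (auto simp: algebra_simps)
    finally show ?thesis
      using \<open>0 < D\<close> by (simp add: emeasure_eq_measure)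
  qed
  ultimately show ?thesis by (rule that)
qed

theorem levy_ldp_upper_bound:
  assumes F: "closedin (mtopology_of D01_metric) F" "F \<in> sets D01_sigma"
  shows "Limsup (at_right 0) (\<lambda>\<epsilon>. ereal \<epsilon> * ext_log (measure M {\<omega> \<in> space M. scaled_path L \<epsilon> \<omega> \<in> F}))
    \<le> - enn2ereal (INF \<phi>\<in>F. action \<phi>)" (is "?LS \<le> - enn2ereal ?I")
proof (rule ccontr)
  assume "\<not> ?LS \<le> - enn2ereal ?I"
  then have "- enn2ereal ?I < ?LS" by simp
  then obtain z where z: "- enn2ereal ?I < ereal z" "ereal z < ?LS" using ereal_dense2 by blast
  \<comment> \<open>Probabilities are at most one, so the upper limit is at most 0; hence
    \<open>z\<close> is negative and the number \<open>l\<close> below is positive.\<close>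
  have "?LS \<le> ereal (- 0)"
    by (rule Limsup_log_prob_le[of 1]) (simp_all add: measure_nonneg)
  with z(2) have "ereal z < ereal (- 0)" by (rule less_le_trans)
  then have "z < 0" by simp
  have "ereal (- z) < enn2ereal ?I" using z(1) by (simp add: ereal_uminus_less_reorder)
  then obtain l where l: "ereal (- z) < ereal l" "ereal l < enn2ereal ?I" using ereal_dense2 by blast
  have l0: "0 < - z" "- z < l" using \<open>z < 0\<close> l(1) by simp_all
  have "ennreal l < ?I"
    using l(2) l0 by (simp add: less_ennreal.rep_eq enn2ereal_ennreal)
  then have lF: "ennreal l < action \<phi>" if "\<phi> \<in> F" for \<phi> using that by (meson INF_lower less_le_trans)
  \<comment> \<open>\<open>l\<close> lies strictly between \<open>- z\<close> and the infimum, which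
    leaves room for a factor \<eta> below one with \<open>\<eta> * l = - z\<close>.\<close>
  define \<eta> where "\<eta> = - z / l"
  have \<eta>: "0 < \<eta>" "\<eta> < 1" "\<eta> * l = - z" using l0 by (auto simp: \<eta>_def field_simps)
  obtain D where D: "0 < D"
    "\<And>\<epsilon>. 0 < \<epsilon> \<Longrightarrow> prob {\<omega> \<in> space M. scaled_path L \<epsilon> \<omega> \<in> F} \<le> D * exp (- (\<eta> * l) / \<epsilon>)"
    using upper_bound_prob[OF F _ lF \<eta>(1,2)] l0 by auto
  have "?LS \<le> ereal (- (\<eta> * l))"
  proof (rule Limsup_log_prob_le[OF D(1)])
    show "\<forall>\<^sub>F \<epsilon> in at_right 0. 0 \<le> prob {\<omega> \<in> space M. scaled_path L \<epsilon> \<omega> \<in> F} \<and>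
        prob {\<omega> \<in> space M. scaled_path L \<epsilon> \<omega> \<in> F} \<le> D * exp (- (\<eta> * l) / \<epsilon>)"
      using eventually_at_right_less[of "0 :: real"] by eventually_elim (use D(2) in \<open>simp add: measure_nonneg\<close>)
  qed
  then show False using z(2) \<eta>(3) by simp
qed

end

section \<open>The lower bound\<close>

context exponential_levy_process
begin

text \<open>Maximising \<open>\<xi> * p - Psi \<xi> - \<kappa> * \<xi>\<^sup>2 / 2\<close> instead of the Legendre functional yields a maximiser even
  where the supremum defining the rate is not attained.\<close>

lemma approximate_maximiser:
  assumes p: "rate p = ennreal r" and r: "0 \<le> r" and d: "0 < d"
  obtains \<xi> where "\<bar>Psi_deriv \<xi> - p\<bar> \<le> d" "\<xi> * Psi_deriv \<xi> - Psi \<xi> \<le> r"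
proof -
  \<comment> \<open>Comparison of the maximiser with 0 will give
    \<open>\<kappa> * \<xi>\<^sup>2 \<le> 2 * r\<close>, so that this choice yields
    \<open>\<bar>\<kappa> * \<xi>\<bar> \<le> d\<close>. The added 1 avoids a division by 0.\<close>
  define \<kappa> where "\<kappa> = d\<^sup>2 / (2 * r + 1)"
  have \<kappa>: "0 < \<kappa>" "2 * r * \<kappa> \<le> d\<^sup>2"
  proof -
    show "0 < \<kappa>" using d r by (simp add: \<kappa>_def)
    have "2 * r * \<kappa> = d\<^sup>2 * (2 * r / (2 * r + 1))" by (simp add: \<kappa>_def)
    also have "\<dots> \<le> d\<^sup>2 * 1" using r by (intro mult_left_mono) (auto simp: divide_le_eq_1)
    finally show "2 * r * \<kappa> \<le> d\<^sup>2" by simp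
  qed
  define f where "f \<xi> = \<xi> * p - Psi \<xi> - \<kappa> * \<xi>\<^sup>2 / 2" for \<xi>
  have le: "\<xi> * p - Psi \<xi> \<le> r" for \<xi>
    using legendre_le_rate[of \<xi> p] r unfolding p by (simp add: ennreal_le_iff)
  \<comment> \<open>Beyond \<open>R\<close> the penalty exceeds \<open>r\<close>, so
    \<open>f\<close> is below \<open>f 0 = 0\<close> and the maximum over a compact interval is
    global.\<close>
  define R where "R = 2 * r / \<kappa> + 1"
  have R: "1 \<le> R" "2 * r < \<kappa> * R" using r \<kappa> by (auto simp: R_def field_simps)
  have "continuous_on {-R..R} f"
    unfolding f_def by (intro continuous_intros continuous_on_subset[OF Psi_continuous]) auto
  then obtain \<xi> where \<xi>: "\<xi> \<in> {-R..R}" "\<And>\<zeta>. \<zeta> \<in> {-R..R} \<Longrightarrow> f \<zeta> \<le> f \<xi>"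
    using continuous_attains_sup[of "{-R..R}" f] R(1) by auto
  have f0: "0 \<le> f \<xi>" using \<xi>(2)[of 0] R(1) by (simp add: f_def)
  have outside: "f \<zeta> < 0" if "\<zeta> \<notin> {-R..R}" for \<zeta>
  proof -
    have "R < \<bar>\<zeta>\<bar>" using that by auto
    then have "R * R < \<bar>\<zeta>\<bar> * \<bar>\<zeta>\<bar>" using R(1) by (intro mult_strict_mono) auto
    then have "R * R < \<zeta>\<^sup>2" by (simp add: power2_eq_square)
    moreover have "R * 1 \<le> R * R" using R(1) by (intro mult_left_mono) auto
    ultimately have "R < \<zeta>\<^sup>2" by linarith
    then have "\<kappa> * R < \<kappa> * \<zeta>\<^sup>2" using \<kappa>(1) by simp
    then show ?thesis using le[of \<zeta>] R(2) unfolding f_def by linarith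
  qed
  have max: "f \<zeta> \<le> f \<xi>" for \<zeta>
    using \<xi>(2)[of \<zeta>] outside[of \<zeta>] f0 by (cases "\<zeta> \<in> {-R..R}") auto
  have "(f has_real_derivative (p - Psi_deriv \<xi> - \<kappa> * \<xi>)) (at \<xi>)"
    unfolding f_def by (auto intro!: derivative_eq_intros Psi_has_derivative)
  then have "p - Psi_deriv \<xi> - \<kappa> * \<xi> = 0"
    by (rule DERIV_local_max[of _ _ _ 1]) (use max in auto)
  then have pe: "Psi_deriv \<xi> = p - \<kappa> * \<xi>" by simp
  show ?thesis
  proof (rule that[of \<xi>])
    have "\<kappa> * \<xi>\<^sup>2 \<le> 2 * r" using f0 le[of \<xi>] unfolding f_def by linarith
    then have "\<kappa> * (\<kappa> * \<xi>\<^sup>2) \<le> \<kappa> * (2 * r)" using \<kappa>(1) by (intro mult_left_mono) auto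
    then have "(\<kappa> * \<xi>)\<^sup>2 \<le> d\<^sup>2" using \<kappa>(2) by (simp add: power2_eq_square mult_ac)
    then have "\<bar>\<kappa> * \<xi>\<bar> \<le> d" using d by (simp add: abs_le_square_iff[symmetric])
    then show "\<bar>Psi_deriv \<xi> - p\<bar> \<le> d" unfolding pe by simp
    \<comment> \<open>The slope obtained differs from \<open>p\<close> by
      \<open>\<kappa> * \<xi>\<close>, with the sign that lowers the cost.\<close>
    have "0 \<le> \<xi> * (\<kappa> * \<xi>)" using \<kappa>(1) by (simp add: mult.left_commute)
    then show "\<xi> * Psi_deriv \<xi> - Psi \<xi> \<le> r"
      unfolding pe using le[of \<xi>] by (simp add: right_diff_distrib)
  qed
qed

text \<open>The remainder is of smaller order than \<theta>, and one \<open>d\<close> serves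
  finitely many blocks. It is set against the linear gain \<open>\<theta> * \<beta>\<close> in
  \<open>tilted_lower_bound\<close>.\<close>

lemma Psi_remainder_small:
  assumes e: "0 < e"
  obtains d where "0 < d" "\<And>b \<theta>. b < (m :: nat) \<Longrightarrow> \<bar>\<theta>\<bar> < d \<Longrightarrow> Psi (\<xi> b + \<theta>) - Psi (\<xi> b) - \<theta> * Psi_deriv (\<xi> b) \<le> e * \<bar>\<theta>\<bar>"
proof -
  have "\<exists>d>0. \<forall>\<theta>. \<bar>\<theta>\<bar> < d \<longrightarrow> Psi (\<xi> b + \<theta>) - Psi (\<xi> b) - \<theta> * Psi_deriv (\<xi> b) \<le> e * \<bar>\<theta>\<bar>" for b
  proof -
    have "((\<lambda>h. (Psi (\<xi> b + h) - Psi (\<xi> b)) / h) \<longlongrightarrow> Psi_deriv (\<xi> b)) (at 0)"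
      using Psi_has_derivative[of "\<xi> b"] by (simp add: DERIV_def)
    from LIM_D[OF this e] obtain d where d: "0 < d"
      "\<And>h. h \<noteq> 0 \<Longrightarrow> \<bar>h\<bar> < d \<Longrightarrow> \<bar>(Psi (\<xi> b + h) - Psi (\<xi> b)) / h - Psi_deriv (\<xi> b)\<bar> < e"
      by auto
    have "Psi (\<xi> b + \<theta>) - Psi (\<xi> b) - \<theta> * Psi_deriv (\<xi> b) \<le> e * \<bar>\<theta>\<bar>" if th: "\<bar>\<theta>\<bar> < d" for \<theta>
    proof (cases "\<theta> = 0")
      case False
      have "Psi (\<xi> b + \<theta>) - Psi (\<xi> b) - \<theta> * Psi_deriv (\<xi> b) = ((Psi (\<xi> b + \<theta>) - Psi (\<xi> b)) / \<theta> - Psi_deriv (\<xi> b)) * \<theta>"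
        using False unfolding left_diff_distrib by (simp add: mult.commute)
      also have "\<dots> \<le> \<bar>((Psi (\<xi> b + \<theta>) - Psi (\<xi> b)) / \<theta> - Psi_deriv (\<xi> b)) * \<theta>\<bar>" by (rule abs_ge_self)
      also have "\<dots> \<le> e * \<bar>\<theta>\<bar>" unfolding abs_mult using d(2)[OF False th] by (intro mult_right_mono) auto
      finally show ?thesis .
    qed simp
    then show ?thesis using d(1) by blast
  qed
  then obtain D where D: "\<And>b. 0 < D b"
    "\<And>b \<theta>. \<bar>\<theta>\<bar> < D b \<Longrightarrow> Psi (\<xi> b + \<theta>) - Psi (\<xi> b) - \<theta> * Psi_deriv (\<xi> b) \<le> e * \<bar>\<theta>\<bar>"
    by metis
  define d where "d = Min (insert 1 (D ` {..<m}))"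
  have d: "0 < d" unfolding d_def using D(1) by (subst Min_gr_iff) auto
  have le: "d \<le> D b" if "b < m" for b unfolding d_def using that by (intro Min_le) auto
  show ?thesis
  proof (rule that[OF d])
    fix b \<theta> assume "b < m" "\<bar>\<theta>\<bar> < d"
    then show "Psi (\<xi> b + \<theta>) - Psi (\<xi> b) - \<theta> * Psi_deriv (\<xi> b) \<le> e * \<bar>\<theta>\<bar>" using le[of b] by (intro D(2)) auto
  qed
qed

lemma polygon_scale:
  assumes \<epsilon>: "0 < \<epsilon>" and T: "T = 1 / (real m * \<epsilon>)"
  shows "\<epsilon> * polygon m T p (t / \<epsilon>) = polygon m (1 / real m) p t"
  unfolding polygon_def sum_distrib_left
proof (intro sum.cong refl)
  fix b
  have e: "\<epsilon> * T = 1 / real m" "\<epsilon> * (t / \<epsilon> - real b * T) = t - real b * (1 / real m)"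
    using \<epsilon> by (auto simp: T right_diff_distrib)
  have "\<epsilon> * min T (max 0 (t / \<epsilon> - real b * T)) = min (\<epsilon> * T) (max (\<epsilon> * 0) (\<epsilon> * (t / \<epsilon> - real b * T)))"
    using \<epsilon> by (simp add: min_mult_distrib_left max_mult_distrib_left)
  then show "\<epsilon> * (p b * min T (max 0 (t / \<epsilon> - real b * T))) = p b * min (1 / real m) (max 0 (t - real b * (1 / real m)))"
    unfolding e by (simp add: mult.left_commute)
qed

text \<open>The bound is made of \<open>d\<close> for slope errors accumulated over at most
  \<open>m\<close> cells of length 1/m, \<open>2 * d\<close> for the movement of the polygon inside
  the cell of \<open>t\<close>, and \<open>d\<close> for that of \<open>f\<close>.\<close>

lemma polygon_near_function:
  assumes m: "0 < m" and w: "\<And>s t. s \<in> {0..1} \<Longrightarrow> t \<in> {0..1} \<Longrightarrow> \<bar>t - s\<bar> \<le> 1 / real m \<Longrightarrow> \<bar>f t - f s\<bar> \<le> d"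
    and f0: "f 0 = 0" and p: "\<And>b. b < m \<Longrightarrow> \<bar>p b - cell_slope m f b\<bar> \<le> d" and t: "t \<in> {0..1}"
  shows "\<bar>polygon m (1 / real m) p t - f t\<bar> \<le> 4 * d"
proof -
  have d: "0 \<le> d" using w[of 0 0] by simp
  have sl: "cell_slope m f b * (1 / real m) = f (real (Suc b) / real m) - f (real b / real m)" for b
    using m by (simp add: cell_slope_def)
  have grid: "\<bar>polygon m (1 / real m) p (real b * (1 / real m)) - f (real b / real m)\<bar> \<le> real b * (d / real m)" if "b \<le> m" for b
    using that
  proof (induction b)
    case 0
    then show ?case by (simp add: f0)
  next
    case (Suc b)
    have "polygon m (1 / real m) p (real (Suc b) * (1 / real m)) =
        polygon m (1 / real m) p (real b * (1 / real m)) + p b * (real (Suc b) * (1 / real m) - real b * (1 / real m))"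
      using Suc m by (intro polygon_cell) (auto simp: divide_right_mono)
    also have "real (Suc b) * (1 / real m) - real b * (1 / real m) = 1 / real m" by (simp add: add_divide_distrib)
    finally have "polygon m (1 / real m) p (real (Suc b) * (1 / real m)) - f (real (Suc b) / real m) =
        (polygon m (1 / real m) p (real b * (1 / real m)) - f (real b / real m)) + (p b - cell_slope m f b) * (1 / real m)"
      unfolding left_diff_distrib sl by simp
    moreover have "\<bar>(p b - cell_slope m f b) * (1 / real m)\<bar> \<le> d * (1 / real m)"
      unfolding abs_mult using p[of b] Suc.prems by (intro mult_mono) auto
    moreover have "\<bar>polygon m (1 / real m) p (real b * (1 / real m)) - f (real b / real m)\<bar> \<le> real b * (d / real m)"
      by (rule Suc.IH) (use Suc.prems in simp)
    ultimately have "\<bar>polygon m (1 / real m) p (real (Suc b) * (1 / real m)) - f (real (Suc b) / real m)\<bar> \<le> real b * (d / real m) + d * (1 / real m)"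
      by (simp only: order_trans[OF abs_triangle_ineq add_mono])
    also have "\<dots> = real (Suc b) * (d / real m)" by (simp add: distrib_right add_divide_distrib)
    finally show ?case .
  qed
  obtain b where b: "b < m" "real b / real m \<le> t" "t \<le> real (Suc b) / real m"
    using cell_of_time[OF m t] .
  have ends: "real b / real m \<in> {0..1}" "real (Suc b) / real m \<in> {0..1}" using b(1) m by (auto simp: divide_le_eq_1)
  have len: "real (Suc b) / real m - real b / real m = 1 / real m" by (simp add: add_divide_distrib)
  have "polygon m (1 / real m) p t = polygon m (1 / real m) p (real b * (1 / real m)) + p b * (t - real b * (1 / real m))"
    using b m by (intro polygon_cell) auto
  moreover have "\<bar>p b * (t - real b * (1 / real m))\<bar> \<le> 2 * d"
  proof -
    have "\<bar>p b * (t - real b * (1 / real m))\<bar> \<le> \<bar>p b\<bar> * (1 / real m)"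
      unfolding abs_mult using b len by (intro mult_left_mono) auto
    also have "\<dots> \<le> (\<bar>cell_slope m f b\<bar> + d) * (1 / real m)"
      using p[OF b(1)] by (intro mult_right_mono) auto
    also have "\<dots> = \<bar>cell_slope m f b * (1 / real m)\<bar> + d / real m" by (simp add: abs_mult distrib_right add_divide_distrib)
    also have "\<bar>cell_slope m f b * (1 / real m)\<bar> \<le> d"
      unfolding sl by (rule w[OF ends]) (simp add: len del: of_nat_Suc)
    also have "d / real m \<le> d" using d m by (simp add: divide_le_eq mult_le_cancel_left1)
    finally show ?thesis by simp
  qed
  moreover have "\<bar>polygon m (1 / real m) p (real b * (1 / real m)) - f (real b / real m)\<bar> \<le> d"
  proof -
    have "\<bar>polygon m (1 / real m) p (real b * (1 / real m)) - f (real b / real m)\<bar> \<le> real b * (d / real m)"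
      by (rule grid) (use b in simp)
    also have "\<dots> \<le> real m * (d / real m)" using b d by (intro mult_right_mono) auto
    finally show ?thesis using m by simp
  qed
  moreover have "\<bar>f t - f (real b / real m)\<bar> \<le> d" using b len ends t by (intro w) auto
  ultimately show ?thesis by linarith
qed

text \<open>Under the tilt the polygon with slopes \<open>Psi_deriv (\<xi> b)\<close> is typical:
  leaving the tube of width \<beta> around it has tilted mass at most 1/4 on each side. In the tube
  the density is at most \<open>exp S\<close>, so the tube, and with it \<open>A \<epsilon>\<close>,
  has probability at least \<open>exp (- S) / 2\<close>.\<close>

lemma tilted_lower_bound:
  fixes \<xi> :: "nat \<Rightarrow> real"
  assumes m: "0 < m" and \<beta>: "0 < \<beta>"
  defines "p \<equiv> \<lambda>b. Psi_deriv (\<xi> b)"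
  assumes A: "\<And>\<epsilon>. 0 < \<epsilon> \<Longrightarrow> A \<epsilon> \<in> sets M"
    "\<And>\<epsilon> \<omega>. 0 < \<epsilon> \<Longrightarrow> \<omega> \<in> space M \<Longrightarrow> L 0 \<omega> = 0 \<Longrightarrow>
       (\<And>t. t \<in> {0..1} \<Longrightarrow> \<bar>scaled_path L \<epsilon> \<omega> t - polygon m (1 / real m) p t\<bar> \<le> \<beta>) \<Longrightarrow> \<omega> \<in> A \<epsilon>"
  shows "\<forall>\<^sub>F \<epsilon> in at_right 0. 1 / 2 * exp (- ((\<Sum>b<m. 1 / real m * (\<xi> b * p b - Psi (\<xi> b))) + 2 * \<beta> * (\<Sum>b<m. \<bar>\<xi> b\<bar>)) / \<epsilon>) \<le> prob (A \<epsilon>)"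
proof -
  obtain d where d: "0 < d" "\<And>b \<theta>. b < m \<Longrightarrow> \<bar>\<theta>\<bar> < d \<Longrightarrow> Psi (\<xi> b + \<theta>) - Psi (\<xi> b) - \<theta> * Psi_deriv (\<xi> b) \<le> \<beta> / 2 * \<bar>\<theta>\<bar>"
    using Psi_remainder_small[of "\<beta> / 2" m \<xi>] \<beta> by auto
  \<comment> \<open>Small enough for the remainder of \<Psi> to take at most half of the gain
    \<open>\<theta> * \<beta> / \<epsilon>\<close>; the other half is \<open>c / \<epsilon>\<close>
    with the \<open>c\<close> below.\<close>
  define \<theta> where "\<theta> = d / 2"
  have \<theta>: "0 < \<theta>" "\<bar>\<theta>\<bar> < d" "\<bar>- \<theta>\<bar> < d" using d(1) by (auto simp: \<theta>_def)
  define c where "c = \<theta> * \<beta> / 2"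
  have c: "0 < c" using \<theta> \<beta> by (simp add: c_def)
  have "((\<lambda>\<epsilon>. exp (- c / \<epsilon>)) \<longlongrightarrow> 0) (at_right 0)"
    using c by real_asymp
  then have "\<forall>\<^sub>F \<epsilon> in at_right 0. exp (- c / \<epsilon>) < 1 / 4" by (rule order_tendstoD) simp
  then show ?thesis using eventually_at_right_less[of "0 :: real"]
  proof eventually_elim
    case (elim \<epsilon>)
    then have \<epsilon>: "0 < \<epsilon>" by simp
    define T where "T = 1 / (real m * \<epsilon>)"
    have T: "0 < T" "real m * T = 1 / \<epsilon>" using m \<epsilon> by (auto simp: T_def)
    define H where "H \<zeta> = {\<omega> \<in> space M. \<exists>u\<in>{0..real m * T}. \<theta> * (\<beta> / \<epsilon>) < \<zeta> * (L (0 + u) \<omega> - L 0 \<omega> - polygon m T p u)}" for \<zeta>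
    have kappa: "Psi (\<xi> b) + \<zeta> * p b \<le> Psi (\<xi> b + \<zeta>)" for b \<zeta>
      using Psi_tangent[of "\<xi> b" "\<xi> b + \<zeta>"] by (simp add: p_def)
    have Hm: "H \<zeta> \<in> sets M" for \<zeta> unfolding H_def by (rule path_excursion_measurable[OF order_refl T(1) kappa])
    have N: "0 < (1 :: nat)" by simp
    note tm [measurable] = tilt_measurable[OF order_refl T(1) N kappa]
    have Hs: "(\<integral>\<^sup>+\<omega>. tilt 0 T m \<xi> \<omega> * indicator (H \<zeta>) \<omega> \<partial>M) \<le> ennreal (1 / 4)" if z: "\<zeta> = \<theta> \<or> \<zeta> = - \<theta>" for \<zeta>
    proof -
      have "(\<integral>\<^sup>+\<omega>. tilt 0 T m \<xi> \<omega> * indicator (H \<zeta>) \<omega> \<partial>M) \<le> ennreal (exp (T * (\<Sum>b<m. Psi (\<xi> b + \<zeta>) - Psi (\<xi> b) - \<zeta> * p b) - \<theta> * (\<beta> / \<epsilon>)))"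
        unfolding H_def by (rule path_maximal[OF order_refl T(1) kappa])
      also have "\<dots> \<le> ennreal (1 / 4)"
      proof (rule ennreal_leI)
        have "(\<Sum>b<m. Psi (\<xi> b + \<zeta>) - Psi (\<xi> b) - \<zeta> * p b) \<le> (\<Sum>b<m. \<beta> / 2 * \<theta>)"
        proof (rule sum_mono)
          fix b assume "b \<in> {..<m}"
          then have "Psi (\<xi> b + \<zeta>) - Psi (\<xi> b) - \<zeta> * p b \<le> \<beta> / 2 * \<bar>\<zeta>\<bar>"
            unfolding p_def using z \<theta> by (intro d(2)) auto
          then show "Psi (\<xi> b + \<zeta>) - Psi (\<xi> b) - \<zeta> * p b \<le> \<beta> / 2 * \<theta>" using z \<theta>(1) by auto
        qed
        then have "T * (\<Sum>b<m. Psi (\<xi> b + \<zeta>) - Psi (\<xi> b) - \<zeta> * p b) \<le> T * (\<Sum>b<m. \<beta> / 2 * \<theta>)"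
          using T(1) by (intro mult_left_mono) auto
        also have "\<dots> = (real m * T) * c" by (simp add: c_def)
        also have "\<dots> = c / \<epsilon>" unfolding T(2) by simp
        finally have "T * (\<Sum>b<m. Psi (\<xi> b + \<zeta>) - Psi (\<xi> b) - \<zeta> * p b) - \<theta> * (\<beta> / \<epsilon>) \<le> c / \<epsilon> - \<theta> * (\<beta> / \<epsilon>)" by simp
        also have "\<dots> = - c / \<epsilon>" by (simp add: c_def)
        finally have "exp (T * (\<Sum>b<m. Psi (\<xi> b + \<zeta>) - Psi (\<xi> b) - \<zeta> * p b) - \<theta> * (\<beta> / \<epsilon>)) \<le> exp (- c / \<epsilon>)" by simp
        then show "exp (T * (\<Sum>b<m. Psi (\<xi> b + \<zeta>) - Psi (\<xi> b) - \<zeta> * p b) - \<theta> * (\<beta> / \<epsilon>)) \<le> 1 / 4"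
          using elim by linarith
      qed
      finally show ?thesis .
    qed
    \<comment> \<open>The cost of the polygon, plus \<open>2 * \<beta> / \<epsilon>\<close> times
      \<open>\<bar>\<xi> b\<bar>\<close> for each block, since the path at both ends of a block is
      known up to \<open>\<beta> / \<epsilon>\<close>.\<close>
    define S where "S = ((\<Sum>b<m. 1 / real m * (\<xi> b * p b - Psi (\<xi> b))) + 2 * \<beta> * (\<Sum>b<m. \<bar>\<xi> b\<bar>)) / \<epsilon>"
    have good: "\<omega> \<in> A \<epsilon> \<and> tilt 0 T m \<xi> \<omega> \<le> ennreal (exp S)"
      if w: "\<omega> \<in> space M" "L 0 \<omega> = 0" "\<omega> \<notin> H \<theta>" "\<omega> \<notin> H (- \<theta>)" for \<omega>
    proof -
      have near: "\<bar>L u \<omega> - polygon m T p u\<bar> \<le> \<beta> / \<epsilon>" if u: "u \<in> {0..real m * T}" for u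
      proof -
        have "\<not> \<theta> * (\<beta> / \<epsilon>) < \<theta> * (L u \<omega> - polygon m T p u)" using w u by (auto simp: H_def)
        then have 1: "L u \<omega> - polygon m T p u \<le> \<beta> / \<epsilon>"
          using \<theta>(1) by (simp only: not_less mult_le_cancel_left_pos)
        have "\<not> \<theta> * (\<beta> / \<epsilon>) < - \<theta> * (L u \<omega> - polygon m T p u)" using w u by (auto simp: H_def)
        then have "\<theta> * (- (L u \<omega> - polygon m T p u)) \<le> \<theta> * (\<beta> / \<epsilon>)" by (simp only: not_less mult_minus_left mult_minus_right)
        then have "- (L u \<omega> - polygon m T p u) \<le> \<beta> / \<epsilon>" using \<theta>(1) by (simp only: mult_le_cancel_left_pos)
        with 1 show ?thesis by (simp add: abs_le_iff)
      qed
      have "\<omega> \<in> A \<epsilon>"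
      proof (rule A(2)[OF \<epsilon> w(1,2)])
        fix t :: real assume t: "t \<in> {0..1}"
        have "t / \<epsilon> \<in> {0..real m * T}" using t \<epsilon> unfolding T(2) by (auto simp: divide_right_mono)
        from near[OF this] have "\<epsilon> * \<bar>L (t / \<epsilon>) \<omega> - polygon m T p (t / \<epsilon>)\<bar> \<le> \<epsilon> * (\<beta> / \<epsilon>)"
          using \<epsilon> by (intro mult_left_mono) auto
        moreover have "\<epsilon> * \<bar>L (t / \<epsilon>) \<omega> - polygon m T p (t / \<epsilon>)\<bar> = \<bar>\<epsilon> * L (t / \<epsilon>) \<omega> - \<epsilon> * polygon m T p (t / \<epsilon>)\<bar>"
          using \<epsilon> by (simp add: abs_mult flip: right_diff_distrib)
        ultimately show "\<bar>scaled_path L \<epsilon> \<omega> t - polygon m (1 / real m) p t\<bar> \<le> \<beta>"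
          using \<epsilon> unfolding scaled_path_eq[OF t] polygon_scale[OF \<epsilon> T_def] by simp
      qed
      moreover have "tilt 0 T m \<xi> \<omega> \<le> ennreal (exp S)"
        unfolding tilt_def
      proof (intro ennreal_leI, subst exp_le_cancel_iff)
        have "(\<Sum>b<m. \<xi> b * (L (0 + real (Suc b) * T) \<omega> - L (0 + real b * T) \<omega>) - T * Psi (\<xi> b)) \<le>
            (\<Sum>b<m. T * (\<xi> b * p b - Psi (\<xi> b)) + 2 * (\<beta> / \<epsilon>) * \<bar>\<xi> b\<bar>)"
        proof (rule sum_mono)
          fix b assume b: "b \<in> {..<m}"
          have st: "polygon m T p (real (Suc b) * T) - polygon m T p (real b * T) = T * p b"
            using polygon_step[OF T(1), of 1 b m p] b by simp
          have "real (Suc b) * T \<le> real m * T" "real b * T \<le> real m * T"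
            using b T(1) by (intro mult_right_mono; simp)+
          then have "\<bar>L (real (Suc b) * T) \<omega> - polygon m T p (real (Suc b) * T)\<bar> \<le> \<beta> / \<epsilon>"
            "\<bar>L (real b * T) \<omega> - polygon m T p (real b * T)\<bar> \<le> \<beta> / \<epsilon>"
            using T(1) by (intro near; simp del: of_nat_Suc)+
          then have "\<bar>L (real (Suc b) * T) \<omega> - L (real b * T) \<omega> - T * p b\<bar> \<le> 2 * (\<beta> / \<epsilon>)"
            unfolding st[symmetric] by linarith
          then have "\<bar>\<xi> b\<bar> * \<bar>L (real (Suc b) * T) \<omega> - L (real b * T) \<omega> - T * p b\<bar> \<le> \<bar>\<xi> b\<bar> * (2 * (\<beta> / \<epsilon>))"
            by (rule mult_left_mono) simp
          then have "\<xi> b * (L (real (Suc b) * T) \<omega> - L (real b * T) \<omega> - T * p b) \<le> \<bar>\<xi> b\<bar> * (2 * (\<beta> / \<epsilon>))"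
            unfolding abs_mult[symmetric] by (rule order_trans[OF abs_ge_self])
          then show "\<xi> b * (L (0 + real (Suc b) * T) \<omega> - L (0 + real b * T) \<omega>) - T * Psi (\<xi> b) \<le>
              T * (\<xi> b * p b - Psi (\<xi> b)) + 2 * (\<beta> / \<epsilon>) * \<bar>\<xi> b\<bar>"
            by (simp add: algebra_simps)
        qed
        also have "\<dots> = S"
        proof -
          have "(\<Sum>b<m. T * (\<xi> b * p b - Psi (\<xi> b))) = (\<Sum>b<m. 1 / real m * (\<xi> b * p b - Psi (\<xi> b))) / \<epsilon>"
            unfolding sum_divide_distrib by (intro sum.cong refl) (simp add: T_def)
          then show ?thesis unfolding S_def sum.distrib sum_distrib_left[symmetric] by (simp add: add_divide_distrib)
        qed
        finally show "(\<Sum>b<m. \<xi> b * (L (0 + real (Suc b) * T) \<omega> - L (0 + real b * T) \<omega>) - T * Psi (\<xi> b)) \<le> S" .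
      qed
      ultimately show ?thesis by blast
    qed
    have Am: "A \<epsilon> \<in> sets M" by (rule A(1)[OF \<epsilon>])
    \<comment> \<open>The total tilted mass is split into the part in the tube, where the density is
      bounded, and the two excursions.\<close>
    have "1 = (\<integral>\<^sup>+\<omega>. tilt 0 T m \<xi> \<omega> \<partial>M)"
      by (rule nn_integral_tilt[OF order_refl T(1) N kappa, symmetric])
    also have "\<dots> \<le> (\<integral>\<^sup>+\<omega>. (ennreal (exp S) * indicator (A \<epsilon>) \<omega> + tilt 0 T m \<xi> \<omega> * indicator (H \<theta>) \<omega>) + tilt 0 T m \<xi> \<omega> * indicator (H (- \<theta>)) \<omega> \<partial>M)"
    proof (rule nn_integral_mono_AE, use start_0 AE_space in eventually_elim)
      case (elim \<omega>)
      show ?case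
      proof (cases "\<omega> \<in> H \<theta> \<or> \<omega> \<in> H (- \<theta>)")
        case True
        then show ?thesis by (auto simp: add_increasing add_increasing2)
      next
        case False
        then show ?thesis using good[of \<omega>] elim by simp
      qed
    qed
    also have "\<dots> = (\<integral>\<^sup>+\<omega>. ennreal (exp S) * indicator (A \<epsilon>) \<omega> \<partial>M) + (\<integral>\<^sup>+\<omega>. tilt 0 T m \<xi> \<omega> * indicator (H \<theta>) \<omega> \<partial>M) + (\<integral>\<^sup>+\<omega>. tilt 0 T m \<xi> \<omega> * indicator (H (- \<theta>)) \<omega> \<partial>M)"
    proof -
      note [measurable] = Am Hm
      show ?thesis by (subst nn_integral_add; (measurable)?; subst nn_integral_add; (measurable)?; simp)
    qed
    also have "\<dots> \<le> ennreal (exp S) * emeasure M (A \<epsilon>) + ennreal (1 / 4) + ennreal (1 / 4)"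
      by (intro add_mono Hs) (simp_all add: nn_integral_cmult_indicator Am)
    also have "\<dots> = ennreal (exp S * prob (A \<epsilon>) + 1 / 4 + 1 / 4)"
    proof -
      have "ennreal (x + 1 / 4 + 1 / 4) = ennreal x + ennreal (1 / 4) + ennreal (1 / 4)" if "0 \<le> x" for x :: real
        using that by (subst ennreal_plus, simp, simp, subst ennreal_plus, simp_all)
      from this[of "exp S * prob (A \<epsilon>)"] show ?thesis
        unfolding emeasure_eq_measure by (simp only: ennreal_mult measure_nonneg exp_ge_zero mult_nonneg_nonneg)
    qed
    finally have "1 \<le> exp S * prob (A \<epsilon>) + 1 / 4 + 1 / 4" by (simp only: ennreal_ge_1)
    then have "exp (- S) * (1 / 2) \<le> exp (- S) * (exp S * prob (A \<epsilon>))" by (intro mult_left_mono) auto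
    also have "\<dots> = prob (A \<epsilon>)" by (simp add: mult.assoc[symmetric] exp_add[symmetric])
    finally show ?case unfolding S_def minus_divide_left by (simp only: mult.commute[of "1 / 2"])
  qed
qed

text \<open>The order of choices matters: the grid from \<phi> and \<delta>, then the tilts \<xi>
  from the grid, and only then the tube width \<beta>, whose cost
  \<open>2 * \<beta> * (\<Sum>b<m. \<bar>\<xi> b\<bar>)\<close> depends on the tilts. By
  \<open>grid_action_le\<close> the cost of the polygon stays below the action of \<phi>.\<close>

lemma lower_bound_point:
  assumes U: "openin (mtopology_of D01_metric) U" "U \<in> sets D01_sigma" and \<phi>: "\<phi> \<in> U" "action \<phi> < \<infinity>"
  shows "- enn2ereal (action \<phi>) \<le> Liminf (at_right 0) (\<lambda>\<epsilon>. ereal \<epsilon> * ext_log (measure M {\<omega> \<in> space M. scaled_path L \<epsilon> \<omega> \<in> U}))" (is "_ \<le> ?LI")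
proof -
  define s where "s = enn2real (action \<phi>)"
  have s: "action \<phi> = ennreal s" "0 \<le> s" using \<phi>(2) by (auto simp: s_def)
  have AC: "\<phi> \<in> AC01" by (rule action_finite_imp_AC01[of _ s]) (simp add: s)
  then have \<phi>D: "\<phi> \<in> D01" using AC01_subset_D01 by blast
  obtain \<delta> where \<delta>: "0 < \<delta>" "\<And>g. g \<in> D01 \<Longrightarrow> mdist D01_metric \<phi> g < \<delta> \<Longrightarrow> g \<in> U"
    using openin_D01_ball[OF U(1) \<phi>(1)] by blast
  \<comment> \<open>The polygon will be within \<open>4 * d\<close> of \<phi> and the path within
    \<open>\<beta> \<le> d\<close> of the polygon, and \<open>5 * d < \<delta>\<close>.\<close>
  define d where "d = \<delta> / 8"
  have d: "0 < d" using \<delta>(1) by (simp add: d_def)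
  have "absolutely_continuous_fun 0 1 \<phi>" using AC by (simp add: AC01_def)
  from absolutely_continuous_fun_uniform[OF this d] obtain h where h: "0 < h"
    "\<forall>s\<in>{0..1}. \<forall>t\<in>{0..1}. \<bar>t - s\<bar> < h \<longrightarrow> \<bar>\<phi> t - \<phi> s\<bar> < d" by blast
  obtain n where n: "1 / real (Suc n) < h" using nat_approx_posE[OF h(1)] by blast
  define m where "m = Suc n"
  have m: "0 < m" "1 / real m < h" using n by (auto simp: m_def)
  have grid: "(\<Sum>b<m. ennreal (1 / real m) * rate (cell_slope m \<phi> b)) \<le> ennreal s"
    using grid_action_le[OF AC m(1)] by (simp add: s)
  \<comment> \<open>Finite action excludes an infinite rate on any cell, as
    \<open>approximate_maximiser\<close> requires.\<close>
  have fin: "rate (cell_slope m \<phi> b) = ennreal (enn2real (rate (cell_slope m \<phi> b)))" if b: "b < m" for b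
  proof -
    have "ennreal (1 / real m) * rate (cell_slope m \<phi> b) \<le> (\<Sum>b<m. ennreal (1 / real m) * rate (cell_slope m \<phi> b))"
      using b by (intro member_le_sum) auto
    then have "ennreal (1 / real m) * rate (cell_slope m \<phi> b) \<le> ennreal s" using grid by (rule order_trans)
    then have "rate (cell_slope m \<phi> b) \<noteq> \<top>" using m(1) by (auto simp: ennreal_mult_top top_unique)
    then show ?thesis by (simp add: less_top)
  qed
  define q where "q b = enn2real (rate (cell_slope m \<phi> b))" for b
  have "\<exists>\<xi>. \<bar>Psi_deriv \<xi> - cell_slope m \<phi> b\<bar> \<le> d \<and> \<xi> * Psi_deriv \<xi> - Psi \<xi> \<le> q b" if b: "b < m" for b
    using approximate_maximiser[OF fin[OF b] _ d] unfolding q_def by (metis enn2real_nonneg)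
  then obtain \<xi> where \<xi>: "\<And>b. b < m \<Longrightarrow> \<bar>Psi_deriv (\<xi> b) - cell_slope m \<phi> b\<bar> \<le> d"
    "\<And>b. b < m \<Longrightarrow> \<xi> b * Psi_deriv (\<xi> b) - Psi (\<xi> b) \<le> q b"
    by metis
  have sum_q: "(\<Sum>b<m. 1 / real m * (\<xi> b * Psi_deriv (\<xi> b) - Psi (\<xi> b))) \<le> s"
  proof -
    have "(\<Sum>b<m. 1 / real m * (\<xi> b * Psi_deriv (\<xi> b) - Psi (\<xi> b))) \<le> (\<Sum>b<m. 1 / real m * q b)"
      by (intro sum_mono mult_left_mono \<xi>(2)) auto
    moreover have "ennreal (\<Sum>b<m. 1 / real m * q b) \<le> ennreal s"
    proof -
      have "ennreal (\<Sum>b<m. 1 / real m * q b) = (\<Sum>b<m. ennreal (1 / real m * q b))"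
        by (rule sum_ennreal[symmetric]) (simp add: q_def)
      also have "\<dots> = (\<Sum>b<m. ennreal (1 / real m) * rate (cell_slope m \<phi> b))"
      proof (intro sum.cong refl)
        fix b assume "b \<in> {..<m}"
        then have "rate (cell_slope m \<phi> b) = ennreal (q b)" using fin unfolding q_def by simp
        then show "ennreal (1 / real m * q b) = ennreal (1 / real m) * rate (cell_slope m \<phi> b)"
          by (simp only: ennreal_mult'[symmetric] of_nat_0_le_iff zero_le_divide_1_iff)
      qed
      finally show ?thesis using grid by simp
    qed
    ultimately show ?thesis using s(2) by (simp add: ennreal_le_iff)
  qed
  have near: "\<bar>polygon m (1 / real m) (\<lambda>b. Psi_deriv (\<xi> b)) t - \<phi> t\<bar> \<le> 4 * d" if "t \<in> {0..1}" for t
  proof (rule polygon_near_function[OF m(1) _ AC01_zero[OF AC] \<xi>(1) that])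
    fix s t :: real assume "s \<in> {0..1}" "t \<in> {0..1}" "\<bar>t - s\<bar> \<le> 1 / real m"
    then show "\<bar>\<phi> t - \<phi> s\<bar> \<le> d" using h(2) m(2) by (intro less_imp_le) auto
  qed
  have step: "ereal (- (s + \<gamma>)) \<le> ?LI" if \<gamma>: "0 < \<gamma>" for \<gamma>
  proof -
    \<comment> \<open>The added 1 keeps the divisor of \<gamma> positive when all tilts
      vanish.\<close>
    define K where "K = 2 * (\<Sum>b<m. \<bar>\<xi> b\<bar>) + 1"
    have K: "0 < K" unfolding K_def by (intro add_nonneg_pos mult_nonneg_nonneg sum_nonneg) auto
    define \<beta> where "\<beta> = min d (\<gamma> / K)"
    have \<beta>: "0 < \<beta>" "\<beta> \<le> d" "\<beta> * K \<le> \<gamma>" using d \<gamma> K by (auto simp: \<beta>_def min_def field_simps)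
    have ev: "\<forall>\<^sub>F \<epsilon> in at_right 0. 1 / 2 * exp (- ((\<Sum>b<m. 1 / real m * (\<xi> b * Psi_deriv (\<xi> b) - Psi (\<xi> b))) + 2 * \<beta> * (\<Sum>b<m. \<bar>\<xi> b\<bar>)) / \<epsilon>)
        \<le> prob {\<omega> \<in> space M. scaled_path L \<epsilon> \<omega> \<in> U}"
    proof (rule tilted_lower_bound[OF m(1) \<beta>(1) path_event_measurable[OF _ U(2)]])
      fix \<epsilon> \<omega>
      assume w: "0 < \<epsilon>" "\<omega> \<in> space M"
        "\<And>t. t \<in> {0..1} \<Longrightarrow> \<bar>scaled_path L \<epsilon> \<omega> t - polygon m (1 / real m) (\<lambda>b. Psi_deriv (\<xi> b)) t\<bar> \<le> \<beta>"
      have XD: "scaled_path L \<epsilon> \<omega> \<in> D01" by (rule scaled_path_D01[OF w(1,2)])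
      have "mdist D01_metric \<phi> (scaled_path L \<epsilon> \<omega>) \<le> 5 * d"
      proof (rule mdist_D01_le[OF \<phi>D XD])
        fix t :: real assume t: "t \<in> {0..1}"
        show "\<bar>\<phi> t - scaled_path L \<epsilon> \<omega> t\<bar> \<le> 5 * d" using w(3)[OF t] near[OF t] \<beta>(2) by linarith
      qed
      also have "5 * d < \<delta>" using \<delta>(1) by (simp add: d_def)
      finally show "\<omega> \<in> {\<omega> \<in> space M. scaled_path L \<epsilon> \<omega> \<in> U}" using \<delta>(2)[OF XD] w(2) by simp
    qed simp
    have cost: "(\<Sum>b<m. 1 / real m * (\<xi> b * Psi_deriv (\<xi> b) - Psi (\<xi> b))) + 2 * \<beta> * (\<Sum>b<m. \<bar>\<xi> b\<bar>) \<le> s + \<gamma>"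
    proof -
      have "2 * \<beta> * (\<Sum>b<m. \<bar>\<xi> b\<bar>) \<le> \<beta> * K" using \<beta>(1) by (simp add: K_def algebra_simps)
      then show ?thesis using sum_q \<beta>(3) by linarith
    qed
    show ?thesis
    proof (rule Liminf_log_prob_ge[of "1 / 2"])
      show "\<forall>\<^sub>F \<epsilon> in at_right 0. 1 / 2 * exp (- (s + \<gamma>) / \<epsilon>) \<le> prob {\<omega> \<in> space M. scaled_path L \<epsilon> \<omega> \<in> U}"
        using ev eventually_at_right_less[of "0 :: real"]
      proof eventually_elim
        case (elim \<epsilon>)
        have "- (s + \<gamma>) / \<epsilon> \<le> - ((\<Sum>b<m. 1 / real m * (\<xi> b * Psi_deriv (\<xi> b) - Psi (\<xi> b))) + 2 * \<beta> * (\<Sum>b<m. \<bar>\<xi> b\<bar>)) / \<epsilon>"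
          using cost elim(2) by (intro divide_right_mono) auto
        then have "1 / 2 * exp (- (s + \<gamma>) / \<epsilon>) \<le> 1 / 2 * exp (- ((\<Sum>b<m. 1 / real m * (\<xi> b * Psi_deriv (\<xi> b) - Psi (\<xi> b))) + 2 * \<beta> * (\<Sum>b<m. \<bar>\<xi> b\<bar>)) / \<epsilon>)"
          by simp
        then show ?case using elim(1) by (rule order_trans)
      qed
    qed simp
  qed
  have "ereal (- s) \<le> ?LI + ereal \<gamma>" if "0 < \<gamma>" for \<gamma>
  proof -
    have "ereal (- s) = ereal (- (s + \<gamma>)) + ereal \<gamma>" by simp
    also have "\<dots> \<le> ?LI + ereal \<gamma>" by (intro add_right_mono step that)
    finally show ?thesis .
  qed
  then have "ereal (- s) \<le> ?LI" by (rule ereal_le_epsilon2)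
  then show ?thesis using s by (simp add: enn2ereal_ennreal)
qed

text \<open>If the bound failed, some point of \<open>U\<close> would have finite action below a
  number \<open>l\<close> that the lower limit contradicts; points of infinite action never have to
  be treated.\<close>

theorem levy_ldp_lower_bound:
  assumes U: "openin (mtopology_of D01_metric) U" "U \<in> sets D01_sigma"
  shows "- enn2ereal (INF \<phi>\<in>U. action \<phi>)
    \<le> Liminf (at_right 0) (\<lambda>\<epsilon>. ereal \<epsilon> * ext_log (measure M {\<omega> \<in> space M. scaled_path L \<epsilon> \<omega> \<in> U}))" (is "- enn2ereal ?I \<le> ?LI")
proof (rule ccontr)
  assume "\<not> - enn2ereal ?I \<le> ?LI"
  then have "enn2ereal ?I < - ?LI" by (simp add: not_le ereal_less_uminus_reorder)
  then obtain l where l: "enn2ereal ?I < ereal l" "ereal l < - ?LI" using ereal_dense2 by blast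
  have l0: "0 < l" using l(1) by (metis enn2ereal_nonneg ereal_less(2) le_less_trans)
  then have "?I < ennreal l" using l(1) by (simp add: less_ennreal.rep_eq enn2ereal_ennreal)
  then obtain \<phi> where \<phi>: "\<phi> \<in> U" "action \<phi> < ennreal l" by (auto simp: INF_less_iff)
  have "action \<phi> < \<infinity>" using \<phi>(2) by (rule less_trans) simp
  from lower_bound_point[OF U \<phi>(1) this] have ge: "- enn2ereal (action \<phi>) \<le> ?LI" .
  have "enn2ereal (action \<phi>) < ereal l" using \<phi>(2) l0 by (simp add: less_ennreal.rep_eq enn2ereal_ennreal)
  then have "- ereal l < - enn2ereal (action \<phi>)" by (simp only: ereal_minus_less_minus)
  also note ge
  also have "?LI < - ereal l" by (rule ereal_less_uminus_reorder[THEN iffD1, OF l(2)])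
  finally show False .
qed

end

theorem lemma4p3:
  fixes M :: "'w measure" and L :: "real \<Rightarrow> 'w \<Rightarrow> real"
    and a \<sigma> :: real and \<nu> :: "real measure"
  assumes "levy_process M L"
    and "has_levy_triplet M L a \<sigma> \<nu>"
    and "\<forall>\<theta>\<ge>0. (\<integral>\<^sup>+ \<omega>. ennreal (exp (\<theta> * \<bar>L 1 \<omega>\<bar>)) \<partial>M) < \<infinity>"
  shows "large_deviation_principle M (mtopology_of D01_metric) D01_sigma
           (scaled_path L) (levy_action a \<sigma> \<nu>)"
proof -
  interpret levy_process M L by fact
  interpret exponential_levy_process M L a \<sigma> \<nu>
    by unfold_locales (use assms in auto)
  show ?thesis
    unfolding large_deviation_principle_def
    using action_functional_levy_action levy_ldp_upper_bound levy_ldp_lower_bound by blast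
qed

end
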